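(* Let $k$ be a field and let $r \geq 3$ and $d \geq 2$ be integers. Then \[\beta_{i,i+j}(I_{G_{r,d}}) = \beta_{i,i+j}(\mathrm{in}(I_{G_{r,d}})) \quad\text{for all } i,j \geq 0.\] In particular, the graded Betti numbers of $I_{G_{r,d}}$ are \[\beta_{i,i+2}(I_{G_{r,d}}) = (i+1)\binom{d}{i+2}\ \text{ for } 0 \leq i \leq d-2, \qquad \beta_{i,i+r}(I_{G_{r,d}}) = d\binom{d-1}{i}\ \text{ for } 0 \leq i \leq d-1,\] and $\beta_{i,i+j}(I_{G_{r,d}}) = 0$ everywhere else.
   Context: For a finite simple graph $G$ with vertices $V(G)$ and edges $E(G)$, let $k[V(G)]$ and $k[E(G)]$ be the polynomial rings over a field $k$ whose variables are the vertices, respectively the edges, of $G$. The toric ideal $I_G \subseteq k[E(G)]$ is the kernel of the $k$-algebra homomorphism $\phi_G: k[E(G)] \to k[V(G)]$ sending the variable of each edge $e=\{x,x'\}$ to $x x'$. All polynomial rings are standard graded. For integers $r\geq 3$, $d \geq 2$, the graph $G_{r,d}$ has vertex set $\{x_1,x_2,y_1,\ldots,y_d,z_1,\ldots,z_{2r-3}\}$ and edges: $a_i=\{x_1,y_i\}$ and $b_i=\{x_2,y_i\}$ for $1\leq i\leq d$; $e_1=\{x_1,z_1\}$; $e_i=\{z_{i-1},z_i\}$ for $2\leq i\leq 2r-3$; and $e_{2r-2}=\{z_{2r-3},x_2\}$. (So $G_{r,d}$ is the complete bipartite graph $K_{2,d}$ with a path of length $2r-2$ joining $x_1$ and $x_2$.)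 $\mathrm{in}(I_{G_{r,d}})$ denotes the initial ideal of $I_{G_{r,d}}$ with respect to the graded reverse lexicographic order on $k[E(G_{r,d})]$ with $a_1>\cdots>a_d>e_1>\cdots>e_{2r-2}>b_1>\cdots>b_d$. For a homogeneous ideal $I$ of a polynomial ring $R$, $\beta_{i,j}(I)$ is the $(i,j)$-th graded Betti number of $I$ as a graded $R$-module: the multiplicity of $R(-j)$ in homological degree $i$ of the minimal graded free resolution of $I$ (so $\beta_{0,j}(I)$ is the number of minimal generators of $I$ of degree $j$). *)

theory Defs
  imports "HOL-Library.Poly_Mapping" "HOL-Algebra.RingHom" "Jordan_Normal_Form.Matrix"
begin

section \<open>Polynomial rings on a set of variables\<close>

text \<open>Power products are finitely supported exponent functions; polynomials are finitely
  supported coefficient functions on power products. The ring operations on \<^typ>\<open>_ \<Rightarrow>\<^sub>0 _\<close> are the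
  usual (convolution) ones.\<close>

type_synonym ('x, 'k) mpoly = "('x \<Rightarrow>\<^sub>0 nat) \<Rightarrow>\<^sub>0 'k"

definition mvar :: "'x \<Rightarrow> ('x, 'k::field) mpoly" where
  "mvar x = Poly_Mapping.single (Poly_Mapping.single x 1) 1"

text \<open>\<open>k[X]\<close> for a set \<open>X\<close> of variables.\<close>

definition mpoly_ring :: "'x set \<Rightarrow> ('x, 'k::field) mpoly ring" where
  "mpoly_ring X =
    \<lparr>carrier = {p. \<forall>m \<in> Poly_Mapping.keys p. Poly_Mapping.keys m \<subseteq> X},
     monoid.mult = (*), one = 1, zero = 0, add = (+)\<rparr>"

text \<open>The \<open>k\<close>-algebra homomorphism that sends each variable \<open>x\<close> to \<open>g x\<close>.\<close>

definition mpoly_subst :: "('x \<Rightarrow> ('y, 'k::field) mpoly) \<Rightarrow> ('x, 'k) mpoly \<Rightarrow> ('y, 'k) mpoly" where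
  "mpoly_subst g p =
    (\<Sum>m \<in> Poly_Mapping.keys p. Poly_Mapping.single 0 (Poly_Mapping.lookup p m) *
       (\<Prod>x \<in> Poly_Mapping.keys m. g x ^ Poly_Mapping.lookup m x))"

definition mdegree :: "('x \<Rightarrow>\<^sub>0 nat) \<Rightarrow> nat" where
  "mdegree m = (\<Sum>x \<in> Poly_Mapping.keys m. Poly_Mapping.lookup m x)"

text \<open>Membership in the graded piece of degree \<open>n\<close>, which is zero for \<open>n < 0\<close>.\<close>

definition homogeneous :: "int \<Rightarrow> ('x, 'k::field) mpoly \<Rightarrow> bool" where
  "homogeneous n p \<longleftrightarrow> (\<forall>m \<in> Poly_Mapping.keys p. int (mdegree m) = n)"


section \<open>Initial ideals\<close>

text \<open>The graded reverse lexicographic order on power products in the distinct variables listed,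
  in decreasing order, by \<open>xs\<close>.\<close>

definition grevlex_less :: "'x list \<Rightarrow> ('x \<Rightarrow>\<^sub>0 nat) \<Rightarrow> ('x \<Rightarrow>\<^sub>0 nat) \<Rightarrow> bool" where
  "grevlex_less xs s t \<longleftrightarrow>
    mdegree s < mdegree t \<or>
    mdegree s = mdegree t \<and>
      (\<exists>i < length xs.
         Poly_Mapping.lookup s (xs ! i) > Poly_Mapping.lookup t (xs ! i) \<and>
         (\<forall>j < length xs. i < j \<longrightarrow>
            Poly_Mapping.lookup s (xs ! j) = Poly_Mapping.lookup t (xs ! j)))"

definition is_leading_monomial ::
    "(('x \<Rightarrow>\<^sub>0 nat) \<Rightarrow> ('x \<Rightarrow>\<^sub>0 nat) \<Rightarrow> bool) \<Rightarrow> ('x, 'k::field) mpoly \<Rightarrow> ('x \<Rightarrow>\<^sub>0 nat) \<Rightarrow> bool" where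
  "is_leading_monomial lt p m \<longleftrightarrow>
    m \<in> Poly_Mapping.keys p \<and> (\<forall>m' \<in> Poly_Mapping.keys p. m' \<noteq> m \<longrightarrow> lt m' m)"

definition initial_ideal ::
    "'x set \<Rightarrow> (('x \<Rightarrow>\<^sub>0 nat) \<Rightarrow> ('x \<Rightarrow>\<^sub>0 nat) \<Rightarrow> bool) \<Rightarrow> ('x, 'k::field) mpoly set
      \<Rightarrow> ('x, 'k) mpoly set" where
  "initial_ideal X lt I =
    genideal (mpoly_ring X)
      {Poly_Mapping.single m 1 | m. \<exists>p \<in> I. is_leading_monomial lt p m}"


section \<open>Graded Betti numbers\<close>

definition free_module :: "'x set \<Rightarrow> nat \<Rightarrow> ('x, 'k::field) mpoly vec set" where
  "free_module X n = {v \<in> carrier_vec n. \<forall>q < n. v $ q \<in> carrier (mpoly_ring X)}"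

text \<open>
  With \<open>R = k[X]\<close>, a graded free resolution of an ideal \<open>I\<close> of \<open>R\<close> by finitely generated free modules
  \<open>\<dots> \<rightarrow> F\<^sub>2 \<rightarrow> F\<^sub>1 \<rightarrow> F\<^sub>0 \<rightarrow> I \<rightarrow> 0\<close>. Here \<open>F\<^sub>i\<close> is the direct sum of the \<open>R(-c)\<close> for \<open>c\<close> in the list \<open>s i\<close>,
  the augmentation \<open>F\<^sub>0 \<rightarrow> I\<close> sends the \<open>q\<close>-th basis element to \<open>f $ q\<close>, and the map
  \<open>F\<^bsub>i+1\<^esub> \<rightarrow> F\<^sub>i\<close> is given by the matrix \<open>A i\<close>. All these maps preserve degrees.
\<close>

definition graded_free_resolution ::
    "'x set \<Rightarrow> ('x, 'k::field) mpoly set \<Rightarrow> (nat \<Rightarrow> int list) \<Rightarrow> ('x, 'k) mpoly vec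
      \<Rightarrow> (nat \<Rightarrow> ('x, 'k) mpoly mat) \<Rightarrow> bool" where
  "graded_free_resolution X I s f A \<longleftrightarrow>
    f \<in> free_module X (length (s 0)) \<and>
    (\<forall>q < length (s 0). homogeneous (s 0 ! q) (f $ q)) \<and>
    (\<forall>i. A i \<in> carrier_mat (length (s i)) (length (s (Suc i))) \<and>
         (\<forall>p < length (s i). \<forall>q < length (s (Suc i)).
            A i $$ (p, q) \<in> carrier (mpoly_ring X) \<and>
            homogeneous (s (Suc i) ! q - s i ! p) (A i $$ (p, q)))) \<and>
    (\<lambda>v. f \<bullet> v) ` free_module X (length (s 0)) = I \<and>
    {v \<in> free_module X (length (s 0)). f \<bullet> v = 0}
      = (\<lambda>v. A 0 *\<^sub>v v) ` free_module X (length (s 1)) \<and>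
    (\<forall>i. {v \<in> free_module X (length (s (Suc i))). A i *\<^sub>v v = 0\<^sub>v (length (s i))}
      = (\<lambda>v. A (Suc i) *\<^sub>v v) ` free_module X (length (s (Suc (Suc i)))))"

text \<open>Minimality: the image of \<open>F\<^bsub>i+1\<^esub>\<close> lies in \<open>\<mm> F\<^sub>i\<close>, where \<open>\<mm>\<close> is generated by the
  variables; that is, the matrix entries have no constant term.\<close>

definition minimal_graded_free_resolution ::
    "'x set \<Rightarrow> ('x, 'k::field) mpoly set \<Rightarrow> (nat \<Rightarrow> int list) \<Rightarrow> ('x, 'k) mpoly vec
      \<Rightarrow> (nat \<Rightarrow> ('x, 'k) mpoly mat) \<Rightarrow> bool" where
  "minimal_graded_free_resolution X I s f A \<longleftrightarrow>
    graded_free_resolution X I s f A \<and>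
    (\<forall>i. \<forall>p < length (s i). \<forall>q < length (s (Suc i)). Poly_Mapping.lookup (A i $$ (p, q)) 0 = 0)"

text \<open>\<open>betti X I i j\<close> is the multiplicity of \<open>R(-j)\<close> in homological degree \<open>i\<close> of the minimal graded
  free resolution of the homogeneous ideal \<open>I\<close> of \<open>R = k[X]\<close>, \<open>X\<close> finite. Minimal resolutions exist
  and are unique up to isomorphism, so the description is well defined.\<close>

definition betti :: "'x set \<Rightarrow> ('x, 'k::field) mpoly set \<Rightarrow> nat \<Rightarrow> int \<Rightarrow> nat" where
  "betti X I i j =
    (THE n. \<exists>s f A. minimal_graded_free_resolution X I s f A \<and> n = count_list (s i) j)"


section \<open>Toric ideals of graphs\<close>

text \<open>A finite simple graph is given by its set of vertices and its set of edges, each edge being a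
  two-element set of vertices.\<close>

definition finite_simple_graph :: "'v set \<times> 'v set set \<Rightarrow> bool" where
  "finite_simple_graph G \<longleftrightarrow> finite (fst G) \<and> (\<forall>e \<in> snd G. e \<subseteq> fst G \<and> card e = 2)"

definition edge_hom :: "('v set, 'k::field) mpoly \<Rightarrow> ('v, 'k) mpoly" where
  "edge_hom = mpoly_subst (\<lambda>e. \<Prod>x \<in> e. mvar x)"

definition toric_ideal :: "'v set \<times> 'v set set \<Rightarrow> ('v set, 'k::field) mpoly set" where
  "toric_ideal G = a_kernel (mpoly_ring (snd G)) (mpoly_ring (fst G)) edge_hom"


section \<open>The graphs \<open>G\<^bsub>r,d\<^esub>\<close>\<close>

datatype vertex = Vx nat | Vy nat | Vz nat

definition edge_a :: "nat \<Rightarrow> vertex set" where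
  "edge_a i = {Vx 1, Vy i}"

definition edge_b :: "nat \<Rightarrow> vertex set" where
  "edge_b i = {Vx 2, Vy i}"

definition edge_e :: "nat \<Rightarrow> nat \<Rightarrow> vertex set" where
  "edge_e r i =
    (if i = 1 then {Vx 1, Vz 1}
     else if i = 2 * r - 2 then {Vz (2 * r - 3), Vx 2}
     else {Vz (i - 1), Vz i})"

definition graph_G :: "nat \<Rightarrow> nat \<Rightarrow> vertex set \<times> vertex set set" where
  "graph_G r d =
    ({Vx 1, Vx 2} \<union> Vy ` {1..d} \<union> Vz ` {1..2 * r - 3},
     edge_a ` {1..d} \<union> edge_b ` {1..d} \<union> edge_e r ` {1..2 * r - 2})"

text \<open>The edges in decreasing order
  \<open>a\<^sub>1 > \<dots> > a\<^sub>d > e\<^sub>1 > \<dots> > e\<^bsub>2r-2\<^esub> > b\<^sub>1 > \<dots> > b\<^sub>d\<close>.\<close>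

definition edge_list :: "nat \<Rightarrow> nat \<Rightarrow> vertex set list" where
  "edge_list r d =
    map edge_a [1..<Suc d] @ map (edge_e r) [1..<Suc (2 * r - 2)] @ map edge_b [1..<Suc d]"

lemma set_edge_list: "set (edge_list r d) = snd (graph_G r d)"
  by (auto simp: edge_list_def graph_G_def simp del: upt_Suc)

lemma finite_simple_graph_G:
  assumes "r \<ge> 3"
  shows "finite_simple_graph (graph_G r d)"
proof -
  let ?V = "fst (graph_G r d)"
  have ab: "edge_a i \<subseteq> ?V \<and> card (edge_a i) = 2" "edge_b i \<subseteq> ?V \<and> card (edge_b i) = 2"
    if "i \<in> {1..d}" for i
    using that by (simp_all add: edge_a_def edge_b_def graph_G_def)
  have e: "edge_e r i \<subseteq> ?V \<and> card (edge_e r i) = 2" if "i \<in> {1..2 * r - 2}" for i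
  proof -
    have "1 \<in> {1..2 * r - 3}" "2 * r - 3 \<in> {1..2 * r - 3}" using assms by auto
    moreover have "i - 1 \<in> {1..2 * r - 3}" "i \<in> {1..2 * r - 3}" "i - 1 \<noteq> i"
      if "i \<noteq> 1" "i \<noteq> 2 * r - 2"
      using that \<open>i \<in> {1..2 * r - 2}\<close> by auto
    ultimately show ?thesis
      unfolding edge_e_def graph_G_def fst_conv
      by (cases "i = 1"; cases "i = 2 * r - 2") (simp_all del: atLeastAtMost_iff)
  qed
  have "f \<subseteq> ?V \<and> card f = 2" if "f \<in> snd (graph_G r d)" for f
  proof -
    consider i where "i \<in> {1..d}" "f = edge_a i" | i where "i \<in> {1..d}" "f = edge_b i"
      | i where "i \<in> {1..2 * r - 2}" "f = edge_e r i"
      using \<open>f \<in> snd (graph_G r d)\<close> unfolding graph_G_def snd_conv by blast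
    then show ?thesis
      by cases (use ab e in metis)+
  qed
  moreover have "finite ?V"
    by (simp add: graph_G_def)
  ultimately show ?thesis
    by (simp add: finite_simple_graph_def)
qed

lemma distinct_edge_list:
  assumes "r \<ge> 3"
  shows "distinct (edge_list r d)"
proof -
  have z: "Vz j \<in> edge_e r i \<longleftrightarrow> (j = i \<and> j \<noteq> 2 * r - 2) \<or> (j = i - 1 \<and> i \<noteq> 1)"
    if "i \<in> {1..2 * r - 2}" for i j
    using that assms by (auto simp: edge_e_def)
  have x: "Vx 1 \<in> edge_e r i \<longleftrightarrow> i = 1" if "i \<in> {1..2 * r - 2}" for i
    using that assms by (auto simp: edge_e_def)
  have y: "Vy j \<notin> edge_e r i" for i j
    by (simp add: edge_e_def)
  have lt: "edge_e r i \<noteq> edge_e r i'"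
    if i: "i \<in> {1..2 * r - 2}" "i' \<in> {1..2 * r - 2}" "i < i'" for i i'
  proof
    assume eq: "edge_e r i = edge_e r i'"
    have "Vx 1 \<in> edge_e r i' \<longleftrightarrow> i = 1"
      using x[OF i(1)] eq by simp
    then have "i \<noteq> 1"
      using x[OF i(2)] i(3) by auto
    then have "Vz (i - 1) \<in> edge_e r i'"
      using z[OF i(1), of "i - 1"] eq by simp
    then show False
      using z[OF i(2), of "i - 1"] i by auto
  qed
  have "inj_on (edge_e r) {1..2 * r - 2}"
    by (rule inj_onI, rule ccontr) (metis lt linorder_neqE_nat)
  then have e: "distinct (map (edge_e r) [1..<Suc (2 * r - 2)])"
    by (simp add: distinct_map atLeastLessThanSuc_atLeastAtMost del: upt_Suc)
  have ab: "distinct (map edge_a [1..<Suc d])" "distinct (map edge_b [1..<Suc d])"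
    by (simp_all add: distinct_map inj_on_def edge_a_def edge_b_def doubleton_eq_iff del: upt_Suc)
  have "Vx 1 \<in> edge_a i" "Vx 1 \<notin> edge_b j" "Vy i \<in> edge_a i" "Vy j \<in> edge_b j" for i j
    by (simp_all add: edge_a_def edge_b_def)
  then have "edge_a i \<noteq> edge_b j" "edge_a i \<noteq> edge_e r l" "edge_e r l \<noteq> edge_b j" for i j l
    using y by metis+
  then show ?thesis
    unfolding edge_list_def distinct_append using e ab by (auto simp del: upt_Suc)
qed

end

theory Submission
  imports Defs "Jordan_Normal_Form.Determinant"
begin

text \<open>
  Put \<open>a\<^sub>0 = e\<^sub>1 e\<^sub>3 \<cdots> e\<^bsub>2r-3\<^esub>\<close> and \<open>b\<^sub>0 = e\<^sub>2 e\<^sub>4 \<cdots> e\<^bsub>2r-2\<^esub>\<close>. Every binomial relation among the edges comes from the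
  \<open>2 \<times> (d + 1)\<close> matrix with columns \<open>(a\<^sub>j, b\<^sub>j)\<close>, \<open>0 \<le> j \<le> d\<close>: the toric ideal is generated by its \<open>2 \<times> 2\<close> minors, and
  the initial ideal by their leading terms \<open>b\<^sub>i a\<^sub>j\<close>, \<open>i < j\<close>. The reason is that a monomial which no \<open>b\<^sub>i a\<^sub>j\<close> divides (a
  standard monomial) is the least one, in the reverse lexicographic order, among all monomials with the same image
  (\<open>standard_is_grevlex_least\<close>). So each image has at most one standard preimage.

  The ideal of minors is resolved by the Eagon-Northcott complex, whose basis in homological degree \<open>i\<close> consists of
  pairs of an \<open>(i + 2)\<close>-subset \<open>S\<close> of the columns and a number \<open>q \<le> i\<close>. Reading \<open>(S, q)\<close> as the splitting of \<open>S\<close> into its \<open>q + 1\<close>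
  lower and its remaining upper elements, one may keep only those terms of the differential that are
  homogeneous with respect to the monomial \<open>\<Prod> b\<^sub>l \<Prod> a\<^sub>u\<close>, \<open>l\<close> lower and \<open>u\<close> upper; this degeneration resolves the
  ideal of leading terms. Both complexes are exact for the same reason. Their terms, products of a
  monomial and a basis element, are matched in pairs in such a way that the boundary of one partner has the
  other one as leading term; the omitted terms of the differential are smaller and do not matter. A cycle can then be
  reduced by boundaries until only terms are left on which the differential is injective (\<open>triangular_exact\<close>). This
  gives \<open>minimal_resolution\<close>, with the same basis degrees for the toric ideal and for its initial ideal.

  Finally the Betti numbers do not depend on the minimal resolution (\<open>betti_eq_count\<close>): comparison maps between two
  resolutions compose to a map homotopic to the identity, which for a minimal resolution is the identity modulo the
  variables. So it remains to count pairs \<open>(S, q)\<close>. Their degree is \<open>i + 2\<close> if \<open>0 \<notin> S\<close> and \<open>i + r\<close> if \<open>0 \<in> S\<close>, because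
  column \<open>0\<close> has entries of degree \<open>r - 1\<close>. This yields \<open>(i + 1) \<cdot> (d choose (i + 2))\<close> and
  \<open>(i + 1) \<cdot> (d choose (i + 1)) = d \<cdot> ((d - 1) choose i)\<close>.
\<close>

section \<open>Polynomials and their homogeneous components\<close>

type_synonym 'x mono = "'x \<Rightarrow>\<^sub>0 nat"

abbreviation "lookup \<equiv> Poly_Mapping.lookup"
abbreviation "keys \<equiv> Poly_Mapping.keys"
abbreviation "single \<equiv> Poly_Mapping.single"
abbreviation polys :: "'x set \<Rightarrow> ('x, 'k::field) mpoly set" where
  "polys X \<equiv> carrier (mpoly_ring X)"

lemma polys_iff: "p \<in> polys X \<longleftrightarrow> (\<forall>m \<in> keys p. keys m \<subseteq> X)"
  by (simp add: mpoly_ring_def)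

lemma keys_add_nat: "keys (m + m') = keys m \<union> keys (m' :: 'x mono)"
  by (auto simp: in_keys_iff lookup_add)

lemma polys_0 [simp]: "0 \<in> polys X" and polys_1 [simp]: "1 \<in> polys X"
  by (simp_all add: polys_iff)

lemma polys_add: "p \<in> polys X \<Longrightarrow> q \<in> polys X \<Longrightarrow> p + q \<in> polys X"
  unfolding polys_iff using keys_add[of p q] by blast

lemma polys_uminus: "p \<in> polys X \<Longrightarrow> - p \<in> polys X"
  by (simp add: polys_iff)

lemma polys_minus: "p \<in> polys X \<Longrightarrow> q \<in> polys X \<Longrightarrow> p - q \<in> polys X"
  unfolding polys_iff using keys_diff[of p q] by blast

lemma polys_mult: "p \<in> polys X \<Longrightarrow> q \<in> polys X \<Longrightarrow> p * q \<in> polys X"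
  unfolding polys_iff using keys_mult[of p q] by (fastforce simp: keys_add_nat)

lemma polys_sum: "(\<And>a. a \<in> A \<Longrightarrow> f a \<in> polys X) \<Longrightarrow> sum f A \<in> polys X"
  unfolding polys_iff using keys_sum[of f A] by blast

lemma polys_single: "keys m \<subseteq> X \<Longrightarrow> single m c \<in> polys X"
  by (simp add: polys_iff)

lemma poly_expand: "p = (\<Sum>m\<in>keys p. single m (lookup p m))"
proof (rule poly_mapping_eqI)
  fix k
  have "lookup (\<Sum>m\<in>keys p. single m (lookup p m)) k = (\<Sum>m\<in>keys p. if m = k then lookup p m else 0)"
    by (simp add: lookup_sum lookup_single when_def)
  also have "\<dots> = lookup p k"
    by (auto simp: in_keys_iff)
  finally show "lookup p k = lookup (\<Sum>m\<in>keys p. single m (lookup p m)) k" by simp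
qed

lemma lookup_single_mult:
  fixes p :: "('x, 'k::field) mpoly"
  shows "lookup (single a c * p) (a + m) = c * lookup p m"
proof -
  have "single a c * p = (\<Sum>m\<in>keys p. single (a + m) (c * lookup p m))"
    by (subst (1) poly_expand) (simp add: sum_distrib_left mult_single)
  then show ?thesis
    by (auto simp: lookup_sum lookup_single when_def in_keys_iff)
qed

lemma lookup_mult_0:
  fixes p q :: "('x, 'k::field) mpoly"
  shows "lookup (p * q) 0 = lookup p 0 * lookup q 0"
proof -
  have z: "m + m' = 0 \<longleftrightarrow> m = 0 \<and> m' = 0" for m m' :: "'x mono"
  proof
    assume "m + m' = 0"
    then have "lookup m x + lookup m' x = 0" for x by (metis lookup_add lookup_zero)
    then show "m = 0 \<and> m' = 0" by (auto intro!: poly_mapping_eqI)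
  qed simp
  have "p * q = (\<Sum>m\<in>keys p. \<Sum>m'\<in>keys q. single (m + m') (lookup p m * lookup q m'))"
    by (subst (1) poly_expand[of p], subst (1) poly_expand[of q]) (simp only: sum_product mult_single)
  then have "lookup (p * q) 0 = (\<Sum>m\<in>keys p. \<Sum>m'\<in>keys q. if m = 0 \<and> m' = 0 then lookup p m * lookup q m' else 0)"
    by (simp add: lookup_sum lookup_single when_def z)
  also have "\<dots> = (\<Sum>m\<in>keys p. if m = 0 then lookup p 0 * lookup q 0 else 0)"
    by (rule sum.cong) (auto simp: in_keys_iff)
  also have "\<dots> = lookup p 0 * lookup q 0"
    by (auto simp: in_keys_iff)
  finally show ?thesis .
qed

lemma mdegree_add: "mdegree (m + m') = mdegree m + mdegree m'"
proof -
  have *: "mdegree n = (\<Sum>x\<in>keys m \<union> keys m'. lookup n x)" if "keys n \<subseteq> keys m \<union> keys m'" for n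
    unfolding mdegree_def using that by (intro sum.mono_neutral_left) (auto simp: in_keys_iff)
  show ?thesis
    using *[of m] *[of m'] *[of "m + m'"] by (simp add: keys_add_nat lookup_add sum.distrib)
qed

lemma homogeneous_sum: "(\<And>a. a \<in> A \<Longrightarrow> homogeneous n (f a)) \<Longrightarrow> homogeneous n (sum f A)"
  unfolding homogeneous_def using keys_sum[of f A] by blast

lemma homogeneous_mult:
  "homogeneous a p \<Longrightarrow> homogeneous b q \<Longrightarrow> homogeneous (a + b) (p * q)"
  unfolding homogeneous_def using keys_mult[of p q] by (fastforce simp: mdegree_add)

lemma homogeneous_single: "int (mdegree m) = n \<Longrightarrow> homogeneous n (single m c)"
  by (simp add: homogeneous_def)

text \<open>
  The graded piece of degree \<open>n\<close>. It turns an arbitrary lift of a homogeneous vector into a homogeneous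
  lift in the lifting lemma below.
\<close>

definition hom_component :: "int \<Rightarrow> ('x, 'k::field) mpoly \<Rightarrow> ('x, 'k) mpoly" where
  "hom_component n p = (\<Sum>m\<in>{m \<in> keys p. int (mdegree m) = n}. single m (lookup p m))"

lemma lookup_hom_component: "lookup (hom_component n p) m = (if int (mdegree m) = n then lookup p m else 0)"
proof -
  have "lookup (hom_component n p) m =
      (\<Sum>m'\<in>{m \<in> keys p. int (mdegree m) = n}. if m' = m then lookup p m' else 0)"
    by (simp add: hom_component_def lookup_sum lookup_single when_def)
  also have "\<dots> = (if int (mdegree m) = n then lookup p m else 0)"
    by (auto simp: in_keys_iff)
  finally show ?thesis .
qed

lemma homogeneous_hom_component: "homogeneous n (hom_component n p)"
  by (auto simp: homogeneous_def in_keys_iff lookup_hom_component split: if_splits)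

lemma hom_component_polys: "p \<in> polys X \<Longrightarrow> hom_component n p \<in> polys X"
  by (auto simp: polys_iff in_keys_iff lookup_hom_component split: if_splits)

lemma hom_component_sum: "hom_component n (sum f A) = (\<Sum>a\<in>A. hom_component n (f a))"
  by (rule poly_mapping_eqI) (simp add: lookup_hom_component lookup_sum)

lemma hom_component_homogeneous:
  assumes "homogeneous n' p"
  shows "hom_component n p = (if n = n' then p else 0)"
  using assms
  by (intro poly_mapping_eqI) (auto simp: lookup_hom_component homogeneous_def in_keys_iff)

lemma hom_component_mult:
  assumes "homogeneous a p"
  shows "hom_component (a + c) (p * q) = p * hom_component c q"
proof -
  have *: "hom_component (a + c) (p * single m k) = p * hom_component c (single m k)" for m k
  proof -
    have "homogeneous (a + int (mdegree m)) (p * single m k)"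
      by (intro homogeneous_mult assms homogeneous_single) simp
    then show ?thesis
      using hom_component_homogeneous[OF homogeneous_single[of m "int (mdegree m)" k], of c]
      by (subst hom_component_homogeneous) auto
  qed
  have "hom_component (a + c) (p * q) = (\<Sum>m\<in>keys q. hom_component (a + c) (p * single m (lookup q m)))"
    by (subst (1) poly_expand[of q]) (simp add: sum_distrib_left hom_component_sum)
  also have "\<dots> = p * (\<Sum>m\<in>keys q. hom_component c (single m (lookup q m)))"
    by (simp add: * sum_distrib_left)
  also have "\<dots> = p * hom_component c q"
    by (subst (2) poly_expand[of q]) (simp add: hom_component_sum)
  finally show ?thesis .
qed

section \<open>Matrices of polynomials\<close>

definition poly_mat :: "'x set \<Rightarrow> nat \<Rightarrow> nat \<Rightarrow> ('x, 'k::field) mpoly mat \<Rightarrow> bool" where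
  "poly_mat X n k M \<longleftrightarrow> M \<in> carrier_mat n k \<and> (\<forall>p<n. \<forall>q<k. M $$ (p, q) \<in> polys X)"

definition graded_mat :: "'x set \<Rightarrow> int list \<Rightarrow> int list \<Rightarrow> ('x, 'k::field) mpoly mat \<Rightarrow> bool" where
  "graded_mat X s t M \<longleftrightarrow> poly_mat X (length s) (length t) M \<and>
     (\<forall>p<length s. \<forall>q<length t. homogeneous (t ! q - s ! p) (M $$ (p, q)))"

lemma poly_mat_carrier: "poly_mat X n k M \<Longrightarrow> M \<in> carrier_mat n k"
  by (simp add: poly_mat_def)

lemma free_moduleD: "v \<in> free_module X n \<Longrightarrow> v \<in> carrier_vec n"
  "v \<in> free_module X n \<Longrightarrow> q < n \<Longrightarrow> v $ q \<in> polys X"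
  by (auto simp: free_module_def)

lemma graded_matD: "graded_mat X s t M \<Longrightarrow> poly_mat X (length s) (length t) M"
  by (simp add: graded_mat_def)

lemma mat_mult_vec_nth:
  assumes "M \<in> carrier_mat n k" "v \<in> carrier_vec k" "p < n"
  shows "(M *\<^sub>v v) $ p = (\<Sum>q<k. M $$ (p, q) * v $ q)"
  using assms by (auto simp: scalar_prod_def atLeast0LessThan intro!: sum.cong)

lemma mat_mult_nth:
  assumes "M \<in> carrier_mat n k" "N \<in> carrier_mat k l" "p < n" "q < l"
  shows "(M * N) $$ (p, q) = (\<Sum>i<k. M $$ (p, i) * N $$ (i, q))"
  using assms by (auto simp: scalar_prod_def atLeast0LessThan intro!: sum.cong)

lemma poly_mat_mult_vec:
  assumes "poly_mat X n k M" "v \<in> free_module X k"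
  shows "M *\<^sub>v v \<in> free_module X n"
proof -
  have "(M *\<^sub>v v) $ p \<in> polys X" if "p < n" for p
    using assms that
    by (subst mat_mult_vec_nth[OF poly_mat_carrier])
      (auto simp: free_module_def poly_mat_def intro!: polys_sum polys_mult)
  then show ?thesis
    using assms(1) by (auto simp: free_module_def poly_mat_def intro!: carrier_vecI)
qed

lemma poly_mat_mult:
  assumes "poly_mat X n k M" "poly_mat X k l N"
  shows "poly_mat X n l (M * N)"
proof -
  have "(M * N) $$ (p, q) \<in> polys X" if "p < n" "q < l" for p q
    using assms that
    by (subst mat_mult_nth[OF poly_mat_carrier poly_mat_carrier])
      (auto simp: poly_mat_def intro!: polys_sum polys_mult)
  then show ?thesis
    using assms by (auto simp: poly_mat_def)
qed

lemma poly_mat_minus: "poly_mat X n k M \<Longrightarrow> poly_mat X n k N \<Longrightarrow> poly_mat X n k (M - N)"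
  by (auto simp: poly_mat_def polys_minus)

lemma poly_mat_one: "poly_mat X n n (1\<^sub>m n)"
  by (auto simp: poly_mat_def)

lemma poly_mat_zero: "poly_mat X n k (0\<^sub>m n k)"
  by (auto simp: poly_mat_def)

lemma graded_mat_mult:
  assumes M: "graded_mat X s t M" and N: "graded_mat X t u N"
  shows "graded_mat X s u (M * N)"
proof -
  have "homogeneous (u ! q - s ! p) ((M * N) $$ (p, q))"
    if pq: "p < length s" "q < length u" for p q
  proof -
    have "homogeneous ((t ! i - s ! p) + (u ! q - t ! i)) (M $$ (p, i) * N $$ (i, q))"
      if "i < length t" for i
      by (rule homogeneous_mult) (use M N pq that in \<open>simp_all add: graded_mat_def\<close>)
    then show ?thesis
      by (subst mat_mult_nth[OF poly_mat_carrier poly_mat_carrier])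
        (use graded_matD[OF M] graded_matD[OF N] pq in \<open>auto intro!: homogeneous_sum\<close>)
  qed
  then show ?thesis
    using poly_mat_mult[OF graded_matD[OF M] graded_matD[OF N]] by (simp add: graded_mat_def)
qed

lemma lift_poly_mat:
  assumes B: "poly_mat X n l B" and G: "poly_mat X n k G"
    and im: "\<And>v. v \<in> free_module X k \<Longrightarrow> G *\<^sub>v v \<in> (\<lambda>v. B *\<^sub>v v) ` free_module X l"
  obtains H where "poly_mat X l k H" "B * H = G"
proof -
  have unit: "unit_vec k q \<in> free_module X k" if "q < k" for q
    using that by (auto simp: free_module_def unit_vec_def)
  have "\<exists>w. w \<in> free_module X l \<and> B *\<^sub>v w = G *\<^sub>v unit_vec k q" if "q < k" for q
    using im[OF unit[OF that]] by fastforce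
  then obtain w where w: "\<And>q. q < k \<Longrightarrow> w q \<in> free_module X l"
    "\<And>q. q < k \<Longrightarrow> B *\<^sub>v w q = G *\<^sub>v unit_vec k q"
    by metis
  define H where "H = mat l k (\<lambda>(i, q). w q $ i)"
  have Hc: "H \<in> carrier_mat l k" by (simp add: H_def)
  have Bc: "B \<in> carrier_mat n l" and Gc: "G \<in> carrier_mat n k"
    using B G by (auto simp: poly_mat_def)
  have 1: "poly_mat X l k H"
    using w(1) by (auto simp: poly_mat_def H_def intro!: free_moduleD(2))
  have "(B * H) $$ (p, q) = G $$ (p, q)" if pq: "p < n" "q < k" for p q
  proof -
    have "(B * H) $$ (p, q) = (\<Sum>i<l. B $$ (p, i) * w q $ i)"
      unfolding mat_mult_nth[OF Bc Hc pq] by (simp add: H_def pq)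
    also have "\<dots> = (B *\<^sub>v w q) $ p"
      using mat_mult_vec_nth[OF Bc _ pq(1)] free_moduleD(1)[OF w(1)[OF pq(2)]] by simp
    also have "\<dots> = G $$ (p, q)"
      using w(2)[OF pq(2)] pq Gc by (simp add: row_def)
    finally show ?thesis .
  qed
  then have "B * H = G"
    using Bc Gc Hc by (intro eq_matI) auto
  then show ?thesis using that 1 by blast
qed

text \<open>
  Lifting through a graded map can be done degree by degree: choose any preimage of each column and
  keep only the component of the degree that the target prescribes. Multiplication by the homogeneous
  entries of \<open>B\<close> commutes with taking components, so the truncated columns still lift \<open>G\<close>.
\<close>

lemma lift_graded_mat:
  assumes B: "graded_mat X s t B" and G: "graded_mat X s u G"
    and im: "\<And>v. v \<in> free_module X (length u) \<Longrightarrow>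
      G *\<^sub>v v \<in> (\<lambda>v. B *\<^sub>v v) ` free_module X (length t)"
  obtains H where "graded_mat X t u H" "B * H = G"
proof -
  obtain H0 where H0: "poly_mat X (length t) (length u) H0" "B * H0 = G"
    using lift_poly_mat[OF graded_matD[OF B] graded_matD[OF G] im] .
  define H where "H = mat (length t) (length u) (\<lambda>(i, q). hom_component (u ! q - t ! i) (H0 $$ (i, q)))"
  note c = poly_mat_carrier[OF graded_matD[OF B]] poly_mat_carrier[OF H0(1)] poly_mat_carrier[OF graded_matD[OF G]]
  have Hc: "H \<in> carrier_mat (length t) (length u)" by (simp add: H_def)
  have "graded_mat X t u H"
    using H0(1) by (auto simp: graded_mat_def poly_mat_def H_def homogeneous_hom_component hom_component_polys)
  moreover have "(B * H) $$ (p, q) = G $$ (p, q)" if pq: "p < length s" "q < length u" for p q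
  proof -
    have "hom_component (u ! q - s ! p) (B $$ (p, i) * H0 $$ (i, q)) = B $$ (p, i) * H $$ (i, q)"
      if "i < length t" for i
      using hom_component_mult[of "t ! i - s ! p" "B $$ (p, i)" "u ! q - t ! i" "H0 $$ (i, q)"] B pq that
      by (simp add: H_def graded_mat_def)
    then have "(B * H) $$ (p, q) = hom_component (u ! q - s ! p) ((B * H0) $$ (p, q))"
      by (simp add: mat_mult_nth[OF c(1) Hc pq] mat_mult_nth[OF c(1,2) pq] hom_component_sum del: index_mult_mat)
    then show ?thesis
      using G pq by (simp add: H0(2) hom_component_homogeneous[of "u ! q - s ! p"] graded_mat_def del: index_mult_mat)
  qed
  then have "B * H = G"
    using c Hc by (intro eq_matI) auto
  ultimately show ?thesis using that by blast
qed

section \<open>Uniqueness of graded Betti numbers\<close>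

lemma zero_mat_mult_vec: "v \<in> carrier_vec k \<Longrightarrow> 0\<^sub>m n k *\<^sub>v v = 0\<^sub>v n"
  by (rule eq_vecI) (auto simp: scalar_prod_def)

lemma poly_mat_eq_0:
  assumes "poly_mat X n k M" "\<And>v. v \<in> free_module X k \<Longrightarrow> M *\<^sub>v v = 0\<^sub>v n"
  shows "M = 0\<^sub>m n k"
proof (rule eq_matI)
  fix p q assume "p < dim_row (0\<^sub>m n k :: ('a, 'b) mpoly mat)" "q < dim_col (0\<^sub>m n k :: ('a, 'b) mpoly mat)"
  then have pq: "p < n" "q < k" by auto
  have "unit_vec k q \<in> free_module X k"
    using pq by (auto simp: free_module_def unit_vec_def)
  then have "(M *\<^sub>v unit_vec k q) $ p = 0"
    using assms(2) pq by (metis index_zero_vec(1))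
  then show "M $$ (p, q) = 0\<^sub>m n k $$ (p, q)"
    using pq poly_mat_carrier[OF assms(1)] by (simp add: row_def)
qed (use poly_mat_carrier[OF assms(1)] in auto)

text \<open>
  The comparison theorem: since \<open>B\<close> is a complex, each map composed with \<open>B\<close> sends the next module to cycles of
  \<open>B'\<close>. These are boundaries, so the composite lifts to the next map.
\<close>

lemma comparison_map:
  fixes B B' :: "nat \<Rightarrow> ('x, 'k::field) mpoly mat"
  assumes B: "\<And>i. graded_mat X (s i) (s (Suc i)) (B i)"
    and BB: "\<And>i. B i * B (Suc i) = 0\<^sub>m (length (s i)) (length (s (Suc (Suc i))))"
    and B': "\<And>i. graded_mat X (s' i) (s' (Suc i)) (B' i)"
    and exact: "\<And>i w. w \<in> free_module X (length (s' (Suc i))) \<Longrightarrow> B' i *\<^sub>v w = 0\<^sub>v (length (s' i)) \<Longrightarrow>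
        w \<in> (\<lambda>v. B' (Suc i) *\<^sub>v v) ` free_module X (length (s' (Suc (Suc i))))"
    and \<phi>0: "graded_mat X (s' 0) (s 0) \<phi>0"
    and start: "\<And>v. v \<in> free_module X (length (s 1)) \<Longrightarrow>
        (\<phi>0 * B 0) *\<^sub>v v \<in> (\<lambda>v. B' 0 *\<^sub>v v) ` free_module X (length (s' 1))"
  obtains \<phi> where "\<phi> 0 = \<phi>0" "\<And>i. graded_mat X (s' i) (s i) (\<phi> i)"
    "\<And>i. B' i * \<phi> (Suc i) = \<phi> i * B i"
proof -
  \<comment> \<open>The invariant: the composite with the next map of the source lands in the boundaries of the target.\<close>
  define P where "P i M \<longleftrightarrow> graded_mat X (s' i) (s i) M \<and> (i = 0 \<longrightarrow> M = \<phi>0) \<and>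
      (\<forall>v \<in> free_module X (length (s (Suc i))).
         (M * B i) *\<^sub>v v \<in> (\<lambda>v. B' i *\<^sub>v v) ` free_module X (length (s' (Suc i))))" for i M
  have "\<exists>f. \<forall>i. P i (f i) \<and> B' i * f (Suc i) = f i * B i"
  proof (rule dependent_nat_choice)
    show "\<exists>M. P 0 M" using \<phi>0 start by (auto simp: P_def)
  next
    fix M i assume P: "P i M"
    then have M: "graded_mat X (s' i) (s i) M" by (simp add: P_def)
    obtain H where H: "graded_mat X (s' (Suc i)) (s (Suc i)) H" "B' i * H = M * B i"
      using lift_graded_mat[OF B'[of i] graded_mat_mult[OF M B[of i]]] P by (auto simp: P_def)
    note c = poly_mat_carrier[OF graded_matD]
    have "(H * B (Suc i)) *\<^sub>v v \<in> (\<lambda>v. B' (Suc i) *\<^sub>v v) ` free_module X (length (s' (Suc (Suc i))))"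
      if v: "v \<in> free_module X (length (s (Suc (Suc i))))" for v
    proof (rule exact)
      show "H * B (Suc i) *\<^sub>v v \<in> free_module X (length (s' (Suc i)))"
        by (rule poly_mat_mult_vec[OF graded_matD[OF graded_mat_mult[OF H(1) B]] v])
      have "B' i * (H * B (Suc i)) = (B' i * H) * B (Suc i)"
        using assoc_mult_mat[OF c[OF B'[of i]] c[OF H(1)] c[OF B[of "Suc i"]]] by simp
      also have "\<dots> = M * (B i * B (Suc i))"
        unfolding H(2) by (rule assoc_mult_mat[OF c[OF M] c[OF B[of i]] c[OF B[of "Suc i"]]])
      also have "\<dots> = 0\<^sub>m (length (s' i)) (length (s (Suc (Suc i))))"
        unfolding BB by (rule right_mult_zero_mat[OF c[OF M]])
      finally have 0: "B' i * (H * B (Suc i)) = 0\<^sub>m (length (s' i)) (length (s (Suc (Suc i))))" .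
      have "B' i *\<^sub>v (H * B (Suc i) *\<^sub>v v) = (B' i * (H * B (Suc i))) *\<^sub>v v"
        by (rule assoc_mult_mat_vec[symmetric, OF c[OF B'[of i]] c[OF graded_mat_mult[OF H(1) B]]])
          (rule free_moduleD[OF v])
      then show "B' i *\<^sub>v (H * B (Suc i) *\<^sub>v v) = 0\<^sub>v (length (s' i))"
        using 0 zero_mat_mult_vec[OF free_moduleD(1)[OF v]] by simp
    qed
    then show "\<exists>N. P (Suc i) N \<and> B' i * N = M * B i"
      using H by (auto simp: P_def)
  qed
  then obtain f where "\<And>i. P i (f i)" "\<And>i. B' i * f (Suc i) = f i * B i" by blast
  then show ?thesis using that[of f] by (auto simp: P_def)
qed

text \<open>
  Why minimality makes Betti numbers unique. An endomorphism \<open>\<theta>\<close> of an exact complex that is the identity in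
  position \<open>0\<close> is homotopic to the identity, \<open>\<theta> - 1 = B h + h B\<close>. If the maps \<open>B\<close> have no constant terms, neither
  does the right-hand side, so \<open>\<theta>\<close> is the identity modulo the variables.
  Position \<open>0\<close> is the augmentation target; the first map \<open>B 0\<close> may have constant terms because the homotopy
  starts with \<open>0\<close> there.
\<close>

lemma homotopic_to_identity:
  fixes B \<theta> :: "nat \<Rightarrow> ('x, 'k::field) mpoly mat"
  assumes B: "\<And>i. poly_mat X (n i) (n (Suc i)) (B i)"
    and BB: "\<And>i. B i * B (Suc i) = 0\<^sub>m (n i) (n (Suc (Suc i)))"
    and exact: "\<And>i w. w \<in> free_module X (n (Suc i)) \<Longrightarrow> B i *\<^sub>v w = 0\<^sub>v (n i) \<Longrightarrow>
        w \<in> (\<lambda>v. B (Suc i) *\<^sub>v v) ` free_module X (n (Suc (Suc i)))"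
    and minimal: "\<And>i p q. p < n (Suc i) \<Longrightarrow> q < n (Suc (Suc i)) \<Longrightarrow> lookup (B (Suc i) $$ (p, q)) 0 = 0"
    and \<theta>: "\<And>i. poly_mat X (n i) (n i) (\<theta> i)"
    and \<theta>0: "\<theta> 0 = 1\<^sub>m (n 0)"
    and comm: "\<And>i. B i * \<theta> (Suc i) = \<theta> i * B i"
    and pq: "p < n (Suc i)" "q < n (Suc i)"
  shows "lookup (\<theta> (Suc i) $$ (p, q)) 0 = (if p = q then 1 else 0)"
proof -
  note c = poly_mat_carrier
  have Bc: "B i \<in> carrier_mat (n i) (n (Suc i))" and \<theta>c: "\<theta> i \<in> carrier_mat (n i) (n i)" for i
    using B \<theta> c by blast+
  \<comment> \<open>The second condition says that the homotopy can be continued: what is left of \<open>\<theta> - 1\<close> consists of cycles.\<close>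
  define Q where "Q i h \<longleftrightarrow> poly_mat X (n (Suc i)) (n i) h \<and>
      B i * (\<theta> (Suc i) - 1\<^sub>m (n (Suc i)) - h * B i) = 0\<^sub>m (n i) (n (Suc i)) \<and>
      (\<forall>p < n (Suc i). \<forall>q < n (Suc i). lookup ((h * B i) $$ (p, q)) 0 = 0)" for i h
  have Qc: "h \<in> carrier_mat (n (Suc i)) (n i)" if "Q i h" for i h
    using that by (auto simp: Q_def poly_mat_def)
  have lift: "\<exists>h'. poly_mat X (n (Suc (Suc i))) (n (Suc i)) h' \<and>
      B (Suc i) * h' = \<theta> (Suc i) - 1\<^sub>m (n (Suc i)) - h * B i" if h: "Q i h" for i h
  proof -
    let ?G = "\<theta> (Suc i) - 1\<^sub>m (n (Suc i)) - h * B i"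
    have G: "poly_mat X (n (Suc i)) (n (Suc i)) ?G"
      using h by (auto simp: Q_def intro!: poly_mat_minus poly_mat_one \<theta> poly_mat_mult B)
    have "?G *\<^sub>v v \<in> (\<lambda>v. B (Suc i) *\<^sub>v v) ` free_module X (n (Suc (Suc i)))"
      if v: "v \<in> free_module X (n (Suc i))" for v
    proof (rule exact)
      show "?G *\<^sub>v v \<in> free_module X (n (Suc i))" by (rule poly_mat_mult_vec[OF G v])
      have "B i *\<^sub>v (?G *\<^sub>v v) = (B i * ?G) *\<^sub>v v"
        by (rule assoc_mult_mat_vec[symmetric, OF Bc c[OF G] free_moduleD(1)[OF v]])
      then show "B i *\<^sub>v (?G *\<^sub>v v) = 0\<^sub>v (n i)"
        using h zero_mat_mult_vec[OF free_moduleD(1)[OF v]] by (simp add: Q_def)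
    qed
    from lift_poly_mat[OF B[of "Suc i"] G this] show ?thesis by blast
  qed
  have const: "lookup ((M * N) $$ (p, q)) 0 = 0"
    if "M \<in> carrier_mat a b" "N \<in> carrier_mat b e" "p < a" "q < e"
      "\<And>j. j < b \<Longrightarrow> lookup (M $$ (p, j)) 0 = 0 \<or> lookup (N $$ (j, q)) 0 = 0" for M N :: "('x, 'k) mpoly mat" and a b e p q
    using that by (subst mat_mult_nth) (auto simp: lookup_sum lookup_mult_0 intro!: sum.neutral)
  have ex: "\<exists>h. Q i h" for i
  proof (induction i)
    case 0
    have "B 0 * (\<theta> (Suc 0) - 1\<^sub>m (n (Suc 0)) - 0\<^sub>m (n (Suc 0)) (n 0) * B 0) =
        B 0 * \<theta> (Suc 0) - B 0 * 1\<^sub>m (n (Suc 0))"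
    proof -
      have "\<theta> (Suc 0) - 1\<^sub>m (n (Suc 0)) - 0\<^sub>m (n (Suc 0)) (n 0) * B 0 = \<theta> (Suc 0) - 1\<^sub>m (n (Suc 0))"
        using Bc[of 0] \<theta>c[of "Suc 0"] by (auto intro!: eq_matI)
      then show ?thesis
        using mult_minus_distrib_mat[OF Bc[of 0] \<theta>c[of "Suc 0"], of "1\<^sub>m (n (Suc 0))"] by simp
    qed
    also have "\<dots> = 0\<^sub>m (n 0) (n (Suc 0))"
      using Bc[of 0] by (auto simp: comm \<theta>0 intro!: eq_matI)
    finally show ?case
      using Bc[of 0] by (intro exI[of _ "0\<^sub>m (n (Suc 0)) (n 0)"]) (auto simp: Q_def poly_mat_zero)
  next
    case (Suc i)
    then obtain h where h: "Q i h" by blast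
    from lift[OF h] obtain h' where h': "poly_mat X (n (Suc (Suc i))) (n (Suc i)) h'"
      "B (Suc i) * h' = \<theta> (Suc i) - 1\<^sub>m (n (Suc i)) - h * B i" by blast
    let ?B = "B (Suc i)" and ?N = "n (Suc i)" and ?N' = "n (Suc (Suc i))"
    have "?B * (h' * ?B) = (\<theta> (Suc i) - 1\<^sub>m ?N - h * B i) * ?B"
      using assoc_mult_mat[OF Bc[of "Suc i"] c[OF h'(1)] Bc[of "Suc i"]] h'(2) by simp
    also have "\<dots> = (\<theta> (Suc i) - 1\<^sub>m ?N) * ?B - (h * B i) * ?B"
      using Bc \<theta>c Qc[OF h] by (intro minus_mult_distrib_mat[of _ ?N ?N]) auto
    also have "(h * B i) * ?B = h * (B i * ?B)"
      by (rule assoc_mult_mat[OF Qc[OF h] Bc Bc])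
    also have "\<dots> = 0\<^sub>m ?N ?N'"
      unfolding BB by (rule right_mult_zero_mat[OF Qc[OF h]])
    also have "(\<theta> (Suc i) - 1\<^sub>m ?N) * ?B = \<theta> (Suc i) * ?B - 1\<^sub>m ?N * ?B"
      using Bc \<theta>c by (intro minus_mult_distrib_mat[of _ ?N ?N]) auto
    finally have 1: "?B * (h' * ?B) = \<theta> (Suc i) * ?B - ?B - 0\<^sub>m ?N ?N'"
      using left_mult_one_mat[OF Bc[of "Suc i"]] by simp
    have hB: "h' * ?B \<in> carrier_mat ?N' ?N'" using c[OF h'(1)] Bc[of "Suc i"] by auto
    have "?B * (\<theta> (Suc (Suc i)) - 1\<^sub>m ?N' - h' * ?B) = ?B * (\<theta> (Suc (Suc i)) - 1\<^sub>m ?N') - ?B * (h' * ?B)"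
      using \<theta>c hB by (intro mult_minus_distrib_mat[OF Bc[of "Suc i"]]) auto
    also have "?B * (\<theta> (Suc (Suc i)) - 1\<^sub>m ?N') = ?B * \<theta> (Suc (Suc i)) - ?B * 1\<^sub>m ?N'"
      using \<theta>c by (intro mult_minus_distrib_mat[OF Bc[of "Suc i"]]) auto
    also have "\<dots> = \<theta> (Suc i) * ?B - ?B"
      using right_mult_one_mat[OF Bc[of "Suc i"]] by (simp add: comm)
    finally have "?B * (\<theta> (Suc (Suc i)) - 1\<^sub>m ?N' - h' * ?B) = 0\<^sub>m ?N ?N'"
      unfolding 1 using Bc[of "Suc i"] \<theta>c[of "Suc i"] by (auto intro!: eq_matI)
    moreover have "lookup ((h' * ?B) $$ (p, q)) 0 = 0" if "p < ?N'" "q < ?N'" for p q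
      using that minimal by (intro const[OF c[OF h'(1)] Bc]) auto
    ultimately show ?case using h'(1) by (auto simp: Q_def)
  qed
  obtain h where h: "Q i h" using ex by blast
  from lift[OF h] obtain h' where h': "poly_mat X (n (Suc (Suc i))) (n (Suc i)) h'"
    "B (Suc i) * h' = \<theta> (Suc i) - 1\<^sub>m (n (Suc i)) - h * B i" by blast
  have "lookup ((B (Suc i) * h') $$ (p, q)) 0 = 0"
    using pq minimal by (intro const[OF Bc c[OF h'(1)]]) auto
  moreover have "lookup ((h * B i) $$ (p, q)) 0 = 0"
    using h pq by (auto simp: Q_def)
  moreover have "(\<theta> (Suc i) - 1\<^sub>m (n (Suc i)) - h * B i) $$ (p, q) =
      \<theta> (Suc i) $$ (p, q) - (if p = q then 1 else 0) - (h * B i) $$ (p, q)"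
    using pq \<theta>c[of "Suc i"] Qc[OF h] Bc[of i] by simp
  ultimately show ?thesis
    unfolding h'(2) using pq by (simp add: lookup_minus split: if_splits)
qed

text \<open>
  The identity matrix of size \<open>card Q\<close> cannot factor through a space of smaller dimension: after padding both
  factors with zeros to square matrices, the product in the other order would be the identity as well,
  although its last row is zero.
\<close>

lemma card_le_if_factors_identity:
  fixes a b :: "nat \<Rightarrow> nat \<Rightarrow> 'k::field"
  assumes "finite P" "finite Q"
    and ab: "\<And>q q'. q \<in> Q \<Longrightarrow> q' \<in> Q \<Longrightarrow> (\<Sum>p\<in>P. a q p * b p q') = (if q = q' then 1 else 0)"
  shows "card Q \<le> card P"
proof (rule ccontr)
  assume "\<not> card Q \<le> card P"
  define n m where "n = card Q" and "m = card P"
  have mn: "m < n" using \<open>\<not> card Q \<le> card P\<close> by (simp add: n_def m_def)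
  obtain eQ eP where eQ: "bij_betw eQ {0..<n} Q" and eP: "bij_betw eP {0..<m} P"
    using ex_bij_betw_nat_finite[OF assms(1)] ex_bij_betw_nat_finite[OF assms(2)]
    unfolding n_def m_def by blast
  \<comment> \<open>Padded with zero columns and zero rows, respectively.\<close>
  define A where "A = mat n n (\<lambda>(i, k). if k < m then a (eQ i) (eP k) else 0)"
  define B where "B = mat n n (\<lambda>(k, j). if k < m then b (eP k) (eQ j) else 0)"
  have car: "A \<in> carrier_mat n n" "B \<in> carrier_mat n n" by (simp_all add: A_def B_def)
  have "A * B = 1\<^sub>m n"
  proof (rule eq_matI)
    fix i j assume "i < dim_row (1\<^sub>m n :: 'k mat)" "j < dim_col (1\<^sub>m n :: 'k mat)"
    then have ij: "i < n" "j < n" by auto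
    have "(A * B) $$ (i, j) = (\<Sum>k<n. A $$ (i, k) * B $$ (k, j))"
      using ij car by (auto simp: scalar_prod_def atLeast0LessThan intro!: sum.cong)
    also have "\<dots> = (\<Sum>k\<in>{0..<m}. A $$ (i, k) * B $$ (k, j))"
      using mn ij by (intro sum.mono_neutral_right) (auto simp: A_def B_def)
    also have "\<dots> = (\<Sum>k\<in>{0..<m}. a (eQ i) (eP k) * b (eP k) (eQ j))"
      using mn ij by (intro sum.cong) (auto simp: A_def B_def)
    also have "\<dots> = (\<Sum>p\<in>P. a (eQ i) p * b p (eQ j))"
      by (rule sum.reindex_bij_betw[OF eP])
    also have "\<dots> = (if eQ i = eQ j then 1 else 0)"
      using ij bij_betwE[OF eQ] by (intro ab) auto
    also have "\<dots> = 1\<^sub>m n $$ (i, j)"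
      using ij bij_betw_imp_inj_on[OF eQ] by (auto dest: inj_onD)
    finally show "(A * B) $$ (i, j) = 1\<^sub>m n $$ (i, j)" .
  qed (use car in auto)
  then have "B * A = 1\<^sub>m n"
    by (rule mat_mult_left_right_inverse[OF car])
  then have "(B * A) $$ (n - 1, n - 1) = 1"
    using mn by simp
  moreover have "(B * A) $$ (n - 1, n - 1) = (\<Sum>k<n. B $$ (n - 1, k) * A $$ (k, n - 1))"
    using mn car by (auto simp: scalar_prod_def atLeast0LessThan intro!: sum.cong)
  moreover have "\<not> n - 1 < m" using mn by simp
  ultimately show False
    using mn by (simp add: B_def)
qed

text \<open>
  A resolution and its augmentation are treated as one sequence of matrices: the rank one module \<open>R\<close> is put
  in position \<open>0\<close> and the generators form the matrix with a single row from position \<open>1\<close> to position \<open>0\<close>.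
\<close>

definition aug_shifts :: "(nat \<Rightarrow> int list) \<Rightarrow> nat \<Rightarrow> int list" where
  "aug_shifts s = case_nat [0] s"

definition aug_maps ::
  "('x, 'k::field) mpoly vec \<Rightarrow> (nat \<Rightarrow> ('x, 'k) mpoly mat) \<Rightarrow> nat \<Rightarrow> ('x, 'k) mpoly mat" where
  "aug_maps f A = case_nat (mat 1 (dim_vec f) (\<lambda>(p, q). f $ q)) A"

lemma aug_simps [simp]:
  "aug_shifts s 0 = [0]" "aug_shifts s (Suc i) = s i"
  "aug_maps f A 0 = mat 1 (dim_vec f) (\<lambda>(p, q). f $ q)" "aug_maps f A (Suc i) = A i"
  by (simp_all add: aug_shifts_def aug_maps_def)

lemma augmentation_mult_vec:
  "mat 1 (dim_vec f) (\<lambda>(p, q). f $ q) *\<^sub>v v = vec 1 (\<lambda>_. f \<bullet> v)"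
proof (rule eq_vecI)
  fix i :: nat assume "i < dim_vec (vec 1 (\<lambda>_. f \<bullet> v))"
  then have i: "i = 0" by simp
  have "row (mat 1 (dim_vec f) (\<lambda>(p, q). f $ q)) 0 = f"
    by (rule eq_vecI) auto
  then show "(mat 1 (dim_vec f) (\<lambda>(p, q). f $ q) *\<^sub>v v) $ i = vec 1 (\<lambda>_. f \<bullet> v) $ i"
    by (simp add: i)
qed simp

context
  fixes X :: "'x set" and I :: "('x, 'k::field) mpoly set" and s f A
  assumes res: "graded_free_resolution X I s f A"
begin

lemma aug_graded: "graded_mat X (aug_shifts s i) (aug_shifts s (Suc i)) (aug_maps f A i)"
  using res
  by (cases i)
    (auto simp: graded_free_resolution_def graded_mat_def poly_mat_def free_module_def)

lemma aug_image_0: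
  "(\<lambda>v. aug_maps f A 0 *\<^sub>v v) ` free_module X (length (aug_shifts s 1)) = (\<lambda>p. vec 1 (\<lambda>_. p)) ` I"
proof -
  have I: "I = (\<lambda>v. f \<bullet> v) ` free_module X (length (s 0))"
    using res by (simp add: graded_free_resolution_def)
  show ?thesis
    by (subst I) (simp add: augmentation_mult_vec[unfolded One_nat_def] image_image)
qed

lemma aug_exact:
  "{v \<in> free_module X (length (aug_shifts s (Suc i))). aug_maps f A i *\<^sub>v v = 0\<^sub>v (length (aug_shifts s i))}
    = (\<lambda>v. aug_maps f A (Suc i) *\<^sub>v v) ` free_module X (length (aug_shifts s (Suc (Suc i))))"
proof (cases i)
  case 0
  have "vec (Suc 0) (\<lambda>_. p) = 0\<^sub>v (Suc 0) \<longleftrightarrow> p = 0" for p :: "('x, 'k) mpoly"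
    by (metis One_nat_def index_vec index_zero_vec(1) less_Suc0 zero_vec_def)
  then show ?thesis
    using res 0 by (simp add: graded_free_resolution_def augmentation_mult_vec[unfolded One_nat_def])
next
  case (Suc k)
  then show ?thesis using res by (simp add: graded_free_resolution_def)
qed

lemma aug_square_0:
  "aug_maps f A i * aug_maps f A (Suc i) = 0\<^sub>m (length (aug_shifts s i)) (length (aug_shifts s (Suc (Suc i))))"
proof (rule poly_mat_eq_0)
  note g = graded_matD[OF aug_graded]
  show "poly_mat X (length (aug_shifts s i)) (length (aug_shifts s (Suc (Suc i))))
      (aug_maps f A i * aug_maps f A (Suc i))"
    by (rule poly_mat_mult[OF g g])
  fix v :: "('x, 'k) mpoly vec" assume v: "v \<in> free_module X (length (aug_shifts s (Suc (Suc i))))"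
  have "aug_maps f A i *\<^sub>v (aug_maps f A (Suc i) *\<^sub>v v) = 0\<^sub>v (length (aug_shifts s i))"
    using aug_exact[of i] v by blast
  then show "aug_maps f A i * aug_maps f A (Suc i) *\<^sub>v v = 0\<^sub>v (length (aug_shifts s i))"
    using assoc_mult_mat_vec[OF poly_mat_carrier[OF g[of i]] poly_mat_carrier[OF g[of "Suc i"]]
        free_moduleD(1)[OF v]] by simp
qed

end

lemma resolution_comparison:
  fixes I :: "('x, 'k::field) mpoly set"
  assumes r: "graded_free_resolution X I s f A" and r': "graded_free_resolution X I s' f' A'"
  obtains \<phi> where "\<phi> 0 = 1\<^sub>m 1" "\<And>i. graded_mat X (aug_shifts s' i) (aug_shifts s i) (\<phi> i)"
    "\<And>i. aug_maps f' A' i * \<phi> (Suc i) = \<phi> i * aug_maps f A i"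
proof (rule comparison_map[of X "aug_shifts s" "aug_maps f A" "aug_shifts s'" "aug_maps f' A'" "1\<^sub>m 1"])
  show "graded_mat X (aug_shifts s' 0) (aug_shifts s 0) (1\<^sub>m 1)"
    by (auto simp: graded_mat_def poly_mat_one homogeneous_def mdegree_def)
  have "1\<^sub>m 1 * aug_maps f A 0 = aug_maps f A 0"
    using left_mult_one_mat[OF poly_mat_carrier[OF graded_matD[OF aug_graded[OF r, of 0]]]] by simp
  then show "1\<^sub>m 1 * aug_maps f A 0 *\<^sub>v v
      \<in> (*\<^sub>v) (aug_maps f' A' 0) ` free_module X (length (aug_shifts s' 1))"
    if "v \<in> free_module X (length (aug_shifts s 1))" for v
    using that unfolding aug_image_0[OF r'] aug_image_0[OF r, symmetric] by auto
  show "w \<in> (*\<^sub>v) (aug_maps f' A' (Suc i)) ` free_module X (length (aug_shifts s' (Suc (Suc i))))"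
    if "w \<in> free_module X (length (aug_shifts s' (Suc i)))"
      "aug_maps f' A' i *\<^sub>v w = 0\<^sub>v (length (aug_shifts s' i))" for i w
    using aug_exact[OF r', of i] that by blast
qed (use aug_graded[OF r] aug_graded[OF r'] aug_square_0[OF r] that in \<open>auto simp del: aug_simps\<close>)

lemma count_list_card: "count_list xs j = card {q. q < length xs \<and> xs ! q = j}"
  by (simp add: count_list_eq_length_filter length_filter_conv_card eq_commute)

text \<open>
  Comparison maps in both directions compose to an endomorphism that is the identity modulo the variables.
  The constant part of a graded map only connects basis elements of equal degree, so the identity on the
  basis elements of degree \<open>j\<close> of the minimal resolution factors through those of the other resolution.
\<close>

lemma minimal_resolution_count_le:
  fixes I :: "('x, 'k::field) mpoly set"
  assumes m: "minimal_graded_free_resolution X I s f A" and r': "graded_free_resolution X I s' f' A'"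
  shows "count_list (s i) j \<le> count_list (s' i) j"
proof -
  have r: "graded_free_resolution X I s f A"
    using m by (simp add: minimal_graded_free_resolution_def)
  obtain \<phi> where \<phi>: "\<phi> 0 = 1\<^sub>m 1" "\<And>i. graded_mat X (aug_shifts s' i) (aug_shifts s i) (\<phi> i)"
    "\<And>i. aug_maps f' A' i * \<phi> (Suc i) = \<phi> i * aug_maps f A i"
    using resolution_comparison[OF r r'] by blast
  obtain \<psi> where \<psi>: "\<psi> 0 = 1\<^sub>m 1" "\<And>i. graded_mat X (aug_shifts s i) (aug_shifts s' i) (\<psi> i)"
    "\<And>i. aug_maps f A i * \<psi> (Suc i) = \<psi> i * aug_maps f' A' i"
    using resolution_comparison[OF r' r] by blast
  note c = poly_mat_carrier[OF graded_matD]
  note cs = c[OF \<phi>(2)] c[OF \<psi>(2)] c[OF aug_graded[OF r]] c[OF aug_graded[OF r']]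
  have \<theta>: "graded_mat X (aug_shifts s i) (aug_shifts s i) (\<psi> i * \<phi> i)" for i
    by (rule graded_mat_mult[OF \<psi>(2) \<phi>(2)])
  have comm: "aug_maps f A i * (\<psi> (Suc i) * \<phi> (Suc i)) = \<psi> i * \<phi> i * aug_maps f A i" for i
  proof -
    have "aug_maps f A i * (\<psi> (Suc i) * \<phi> (Suc i)) = \<psi> i * aug_maps f' A' i * \<phi> (Suc i)"
      using assoc_mult_mat[OF cs(3)[of i] cs(2)[of "Suc i"] cs(1)[of "Suc i"]] \<psi>(3)[of i] by simp
    also have "\<dots> = \<psi> i * (\<phi> i * aug_maps f A i)"
      using assoc_mult_mat[OF cs(2)[of i] cs(4)[of i] cs(1)[of "Suc i"]] \<phi>(3)[of i] by simp
    also have "\<dots> = \<psi> i * \<phi> i * aug_maps f A i"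
      using assoc_mult_mat[OF cs(2)[of i] cs(1)[of i] cs(3)[of i]] by simp
    finally show ?thesis .
  qed
  have id: "lookup ((\<psi> (Suc i) * \<phi> (Suc i)) $$ (p, q)) 0 = (if p = q then 1 else 0)"
    if "p < length (s i)" "q < length (s i)" for p q
  proof (rule homotopic_to_identity[where X = X and B = "aug_maps f A" and \<theta> = "\<lambda>i. \<psi> i * \<phi> i"
        and n = "\<lambda>i. length (aug_shifts s i)"])
    show "lookup (aug_maps f A (Suc i) $$ (p, q)) 0 = 0"
      if "p < length (aug_shifts s (Suc i))" "q < length (aug_shifts s (Suc (Suc i)))" for i p q
      using m that by (simp add: minimal_graded_free_resolution_def)
    show "\<psi> 0 * \<phi> 0 = 1\<^sub>m (length (aug_shifts s 0))"
      using \<phi>(1) \<psi>(1) by simp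
    show "w \<in> (*\<^sub>v) (aug_maps f A (Suc i)) ` free_module X (length (aug_shifts s (Suc (Suc i))))"
      if "w \<in> free_module X (length (aug_shifts s (Suc i)))"
        "aug_maps f A i *\<^sub>v w = 0\<^sub>v (length (aug_shifts s i))" for i w
      using aug_exact[OF r, of i] that by blast
  qed (use that graded_matD[OF aug_graded[OF r]] aug_square_0[OF r] graded_matD[OF \<theta>] comm in
      \<open>auto simp del: aug_simps simp: aug_simps(2)\<close>)
  define Q P where "Q = {q. q < length (s i) \<and> s i ! q = j}" and "P = {p. p < length (s' i) \<and> s' i ! p = j}"
  have "card Q \<le> card P"
  proof (rule card_le_if_factors_identity)
    show "finite P" "finite Q" by (simp_all add: P_def Q_def)
    fix q q' assume q: "q \<in> Q" and q': "q' \<in> Q"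
    then have l: "q < length (s i)" "q' < length (s i)" by (auto simp: Q_def)
    have "lookup (\<phi> (Suc i) $$ (p, q')) 0 = 0" if "p < length (s' i)" "p \<notin> P" for p
    proof (rule ccontr)
      assume "lookup (\<phi> (Suc i) $$ (p, q')) 0 \<noteq> 0"
      then have "0 \<in> keys (\<phi> (Suc i) $$ (p, q'))" by (simp add: in_keys_iff)
      moreover have "homogeneous (s i ! q' - s' i ! p) (\<phi> (Suc i) $$ (p, q'))"
        using \<phi>(2)[of "Suc i"] that l by (simp add: graded_mat_def)
      ultimately have "s i ! q' - s' i ! p = 0"
        by (auto simp: homogeneous_def mdegree_def)
      then show False using that q' by (simp add: P_def Q_def)
    qed
    then have "(\<Sum>p\<in>P. lookup (\<psi> (Suc i) $$ (q, p)) 0 * lookup (\<phi> (Suc i) $$ (p, q')) 0) =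
        (\<Sum>p<length (s' i). lookup (\<psi> (Suc i) $$ (q, p)) 0 * lookup (\<phi> (Suc i) $$ (p, q')) 0)"
      by (intro sum.mono_neutral_left) (auto simp: P_def)
    also have "\<dots> = lookup ((\<psi> (Suc i) * \<phi> (Suc i)) $$ (q, q')) 0"
      using cs(1,2)[of "Suc i"] l by (subst mat_mult_nth) (auto simp: lookup_sum lookup_mult_0)
    finally show "(\<Sum>p\<in>P. lookup (\<psi> (Suc i) $$ (q, p)) 0 * lookup (\<phi> (Suc i) $$ (p, q')) 0) =
        (if q = q' then 1 else 0)"
      using id l by simp
  qed
  then show ?thesis by (simp add: count_list_card P_def Q_def)
qed

text \<open>
  By symmetry of the previous inequality any minimal resolution computes the Betti numbers.
\<close>

theorem betti_eq_count:
  assumes "minimal_graded_free_resolution X I s f A"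
  shows "betti X I i j = count_list (s i) j"
  unfolding betti_def
proof (rule the_equality)
  show "\<exists>s' f' A'. minimal_graded_free_resolution X I s' f' A' \<and> count_list (s i) j = count_list (s' i) j"
    using assms by blast
next
  fix n assume "\<exists>s' f' A'. minimal_graded_free_resolution X I s' f' A' \<and> n = count_list (s' i) j"
  then obtain s' f' A' where m: "minimal_graded_free_resolution X I s' f' A'" "n = count_list (s' i) j"
    by blast
  then show "n = count_list (s i) j"
    using minimal_resolution_count_le[OF assms] minimal_resolution_count_le[OF m(1)] assms
    by (auto simp: minimal_graded_free_resolution_def intro!: antisym)
qed

section \<open>Exactness by leading terms\<close>

text \<open>
  A basis element \<open>\<tau>\<close> of a free module together with a monomial \<open>m\<close> is a \<open>k\<close>-basis element \<open>(\<tau>, m)\<close> of the module.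
  This is the matrix of \<open>D\<close> with respect to these \<open>k\<close>-bases.
\<close>

definition column_coeff ::
  "('s \<Rightarrow> 't \<Rightarrow> ('x, 'k::field) mpoly) \<Rightarrow> 't \<times> 'x mono \<Rightarrow> 's \<times> 'x mono \<Rightarrow> 'k" where
  "column_coeff D y x = lookup (D (fst x) (fst y) * single (snd y) 1) (snd x)"

text \<open>
  The image of each \<open>y \<in> T\<close> has \<open>h y\<close> as its leading term, where terms are compared by a natural number
  \<open>key\<close>; different terms may have the same key.
\<close>

definition leads_on ::
  "'s set \<Rightarrow> ('s \<Rightarrow> 't \<Rightarrow> ('x, 'k::field) mpoly) \<Rightarrow> ('s \<times> 'x mono \<Rightarrow> nat)
    \<Rightarrow> ('t \<times> 'x mono) set \<Rightarrow> ('t \<times> 'x mono \<Rightarrow> 's \<times> 'x mono) \<Rightarrow> bool" where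
  "leads_on P D key T h \<longleftrightarrow> (\<forall>y \<in> T. fst (h y) \<in> P \<and> column_coeff D y (h y) \<noteq> 0 \<and>
     (\<forall>x. fst x \<in> P \<longrightarrow> column_coeff D y x \<noteq> 0 \<longrightarrow> x \<noteq> h y \<longrightarrow> key x < key (h y)))"

lemma leads_onD:
  assumes "leads_on P D key T h" "y \<in> T"
  shows "fst (h y) \<in> P" "column_coeff D y (h y) \<noteq> 0"
    "fst x \<in> P \<Longrightarrow> column_coeff D y x \<noteq> 0 \<Longrightarrow> x \<noteq> h y \<Longrightarrow> key x < key (h y)"
  using assms by (simp_all add: leads_on_def del: split_paired_All)

lemma lookup_mult_single:
  fixes p :: "('x, 'k::field) mpoly"
  shows "lookup (p * single m c) n = lookup (p * single m 1) n * c"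
proof -
  have "single 0 c * (p * single m 1) = p * (single 0 c * single m 1)"
    by (rule mult.left_commute)
  then have "p * single m c = single 0 c * (p * single m 1)"
    by (simp add: mult_single)
  then show ?thesis
    using lookup_single_mult[of 0 c "p * single m 1" n] by simp
qed

lemma lookup_column_sum:
  fixes D :: "'s \<Rightarrow> 't \<Rightarrow> ('x, 'k::field) mpoly"
  assumes "finite Q"
  shows "lookup (\<Sum>\<tau>\<in>Q. D (fst x) \<tau> * c \<tau>) (snd x) =
    (\<Sum>y\<in>Sigma Q (\<lambda>\<tau>. keys (c \<tau>)). column_coeff D y x * lookup (c (fst y)) (snd y))"
proof -
  have "lookup (D (fst x) \<tau> * c \<tau>) (snd x) =
      (\<Sum>m\<in>keys (c \<tau>). column_coeff D (\<tau>, m) x * lookup (c \<tau>) m)" for \<tau>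
    by (subst (1) poly_expand[of "c \<tau>"])
      (simp add: sum_distrib_left lookup_sum column_coeff_def lookup_mult_single[of _ _ "lookup _ _"])
  then show ?thesis
    using assms by (simp add: lookup_sum sum.Sigma split_def)
qed

text \<open>
  Division with remainder: terms in \<open>h ` T\<close> are cancelled by images of elements of \<open>T\<close>, those with the largest
  key first. Every cancellation only creates terms of smaller key, so induction on a bound for the keys
  applies.
\<close>

lemma triangular_reduction:
  fixes D :: "'s \<Rightarrow> 't \<Rightarrow> ('x, 'k::field) mpoly" and c :: "'s \<Rightarrow> ('x, 'k) mpoly"
  assumes fin: "finite P" "finite Q"
    and lead: "leads_on P D key T h"
    and T: "\<And>y. y \<in> T \<Longrightarrow> fst y \<in> Q \<and> keys (snd y) \<subseteq> X"
    and HT: "H \<subseteq> h ` T"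
  obtains c' where "\<And>\<tau>. \<tau> \<in> Q \<Longrightarrow> c' \<tau> \<in> polys X"
    "\<And>\<sigma> m. (\<sigma>, m) \<in> H \<Longrightarrow> lookup (c \<sigma> - (\<Sum>\<tau>\<in>Q. D \<sigma> \<tau> * c' \<tau>)) m = 0"
proof -
  define t where "t = inv_into T h"
  have t: "t x \<in> T \<and> h (t x) = x" if "x \<in> H" for x
    using subsetD[OF HT that] by (simp add: t_def inv_into_into f_inv_into_f)
  have reduce: "\<exists>c'. (\<forall>\<tau>\<in>Q. c' \<tau> \<in> polys X) \<and>
      (\<forall>x\<in>H. lookup (c (fst x) - (\<Sum>\<tau>\<in>Q. D (fst x) \<tau> * c' \<tau>)) (snd x) = 0)"
    if "\<And>x. x \<in> H \<Longrightarrow> lookup (c (fst x)) (snd x) \<noteq> 0 \<Longrightarrow> key x < N" for N c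
    using that
  proof (induction N arbitrary: c)
    case 0
    then show ?case by (intro exI[of _ "\<lambda>_. 0"]) auto
  next
    case (Suc N)
    \<comment> \<open>The terms of largest key, which are all cancelled in one step.\<close>
    define X0 where "X0 = {x \<in> H. lookup (c (fst x)) (snd x) \<noteq> 0 \<and> key x = N}"
    have X0P: "fst x \<in> P" if "x \<in> H" for x
      using leads_onD(1)[OF lead] t[OF that] by metis
    have "X0 \<subseteq> Sigma P (\<lambda>\<sigma>. keys (c \<sigma>))"
      using X0P by (auto simp: X0_def in_keys_iff)
    then have X0: "finite X0"
      by (rule finite_subset) (use fin in auto)
    define a where "a x = lookup (c (fst x)) (snd x) / column_coeff D (t x) x" for x
    define c0 where "c0 \<tau> = (\<Sum>x\<in>{x \<in> X0. fst (t x) = \<tau>}. single (snd (t x)) (a x))" for \<tau>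
    have tQ: "fst (t x) \<in> Q" if "x \<in> X0" for x
      using t T that by (auto simp: X0_def)
    have bd: "(\<Sum>\<tau>\<in>Q. D \<sigma> \<tau> * c0 \<tau>) = (\<Sum>x\<in>X0. D \<sigma> (fst (t x)) * single (snd (t x)) (a x))" for \<sigma>
    proof -
      have "(\<Sum>\<tau>\<in>Q. D \<sigma> \<tau> * c0 \<tau>) =
          (\<Sum>\<tau>\<in>Q. \<Sum>x\<in>{x \<in> X0. fst (t x) = \<tau>}. D \<sigma> (fst (t x)) * single (snd (t x)) (a x))"
        by (auto simp: c0_def sum_distrib_left intro!: sum.cong)
      also have "\<dots> = (\<Sum>x\<in>X0. D \<sigma> (fst (t x)) * single (snd (t x)) (a x))"
        by (rule sum.group) (use X0 fin tQ in auto)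
      finally show ?thesis .
    qed
    define c1 where "c1 \<sigma> = c \<sigma> - (\<Sum>\<tau>\<in>Q. D \<sigma> \<tau> * c0 \<tau>)" for \<sigma>
    have c1: "lookup (c1 (fst y)) (snd y) =
        lookup (c (fst y)) (snd y) - (\<Sum>x\<in>X0. column_coeff D (t x) y * a x)" for y
      by (simp add: c1_def bd lookup_minus lookup_sum column_coeff_def lookup_mult_single[of _ _ "a _"])
    have "key y < N" if y: "y \<in> H" and nz: "lookup (c1 (fst y)) (snd y) \<noteq> 0" for y
    proof (rule ccontr)
      assume "\<not> key y < N"
      have "column_coeff D (t x) y = 0" if "x \<in> X0" "x \<noteq> y" for x
      proof (rule ccontr)
        assume "column_coeff D (t x) y \<noteq> 0"
        then have "key y < key (h (t x))"
          using leads_onD(3)[OF lead, of "t x" y] t[of x] X0P[OF y] that by (auto simp: X0_def)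
        then show False
          using \<open>\<not> key y < N\<close> that t[of x] by (auto simp: X0_def)
      qed
      then have "(\<Sum>x\<in>X0. column_coeff D (t x) y * a x) =
          (\<Sum>x\<in>X0. if x = y then column_coeff D (t y) y * a y else 0)"
        by (intro sum.cong) auto
      also have "\<dots> = (if y \<in> X0 then lookup (c (fst y)) (snd y) else 0)"
        using X0 leads_onD(2)[OF lead, of "t y"] t[OF y] by (auto simp: a_def)
      finally have "y \<notin> X0 \<and> lookup (c (fst y)) (snd y) \<noteq> 0"
        using nz c1[of y] by (auto split: if_splits)
      then show False
        using Suc.prems[OF y] y \<open>\<not> key y < N\<close> by (auto simp: X0_def)
    qed
    then obtain c'' where c'': "\<forall>\<tau>\<in>Q. c'' \<tau> \<in> polys X"
      "\<forall>x\<in>H. lookup (c1 (fst x) - (\<Sum>\<tau>\<in>Q. D (fst x) \<tau> * c'' \<tau>)) (snd x) = 0"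
      using Suc.IH[of c1] by blast
    have "c0 \<tau> + c'' \<tau> \<in> polys X" if "\<tau> \<in> Q" for \<tau>
    proof (rule polys_add)
      show "c0 \<tau> \<in> polys X"
        unfolding c0_def using t T by (intro polys_sum polys_single) (auto simp: X0_def)
    qed (use c'' that in auto)
    moreover have "c (fst x) - (\<Sum>\<tau>\<in>Q. D (fst x) \<tau> * (c0 \<tau> + c'' \<tau>)) =
        c1 (fst x) - (\<Sum>\<tau>\<in>Q. D (fst x) \<tau> * c'' \<tau>)" for x
      by (simp add: c1_def distrib_left sum.distrib)
    ultimately show ?case
      using c'' by (intro exI[of _ "\<lambda>\<tau>. c0 \<tau> + c'' \<tau>"]) auto
  qed
  have "\<exists>N. \<forall>x\<in>H. lookup (c (fst x)) (snd x) \<noteq> 0 \<longrightarrow> key x < N"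
  proof -
    let ?S = "Sigma P (\<lambda>\<sigma>. keys (c \<sigma>))"
    have "finite (key ` ?S)" using fin by auto
    then have "\<forall>x\<in>?S. key x < Suc (Max (key ` ?S))"
      by (auto simp: less_Suc_eq_le)
    moreover have "x \<in> ?S" if "x \<in> H" "lookup (c (fst x)) (snd x) \<noteq> 0" for x
    proof -
      have "fst x \<in> P" using leads_onD(1)[OF lead] t[OF that(1)] by metis
      then show ?thesis using that(2) by (cases x) (auto simp: in_keys_iff)
    qed
    ultimately show ?thesis by blast
  qed
  then obtain N where N: "\<And>x. x \<in> H \<Longrightarrow> lookup (c (fst x)) (snd x) \<noteq> 0 \<Longrightarrow> key x < N" by blast
  obtain c' where c': "\<And>\<tau>. \<tau> \<in> Q \<Longrightarrow> c' \<tau> \<in> polys X"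
    "\<And>x. x \<in> H \<Longrightarrow> lookup (c (fst x) - (\<Sum>\<tau>\<in>Q. D (fst x) \<tau> * c' \<tau>)) (snd x) = 0"
    using reduce[of c N, OF N] by blast
  show ?thesis by (rule that[of c']) (use c'(1) c'(2)[of "(_, _)"] in auto)
qed

text \<open>
  Distinct elements of \<open>T\<close> have distinct leading terms. Among the leading terms of the images of the terms of \<open>c\<close>, one
  of largest key therefore cannot cancel.
\<close>

lemma triangular_injective:
  fixes D :: "'s \<Rightarrow> 't \<Rightarrow> ('x, 'k::field) mpoly" and c :: "'t \<Rightarrow> ('x, 'k) mpoly"
  assumes "finite Q"
    and lead: "leads_on P D key T h"
    and inj: "inj_on h T"
    and cT: "\<And>\<tau> m. \<tau> \<in> Q \<Longrightarrow> m \<in> keys (c \<tau>) \<Longrightarrow> (\<tau>, m) \<in> T"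
    and cycle: "\<And>\<sigma>. \<sigma> \<in> P \<Longrightarrow> (\<Sum>\<tau>\<in>Q. D \<sigma> \<tau> * c \<tau>) = 0"
    and "\<tau> \<in> Q"
  shows "c \<tau> = 0"
proof (rule ccontr)
  assume "c \<tau> \<noteq> 0"
  let ?S = "Sigma Q (\<lambda>\<tau>. keys (c \<tau>))"
  have fin: "finite ?S" using assms(1) by auto
  have "?S \<noteq> {}" using \<open>c \<tau> \<noteq> 0\<close> \<open>\<tau> \<in> Q\<close>
    by (metis (mono_tags, lifting) SigmaI all_not_in_conv in_keys_iff poly_mapping_eqI lookup_zero)
  then have "Max (key ` h ` ?S) \<in> key ` h ` ?S" using fin by (intro Max_in) auto
  then obtain y where y: "y \<in> ?S" and key_y: "Max (key ` h ` ?S) = key (h y)" by blast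
  have max: "key (h y') \<le> key (h y)" if "y' \<in> ?S" for y'
    unfolding key_y[symmetric] using fin that by (intro Max_ge) auto
  have ST: "y' \<in> T" if "y' \<in> ?S" for y' using cT that by auto
  have P: "fst (h y) \<in> P" and nz: "column_coeff D y (h y) \<noteq> 0"
    using leads_onD[OF lead ST[OF y]] by auto
  have "column_coeff D y' (h y) = 0" if "y' \<in> ?S" "y' \<noteq> y" for y'
  proof (rule ccontr)
    assume "column_coeff D y' (h y) \<noteq> 0"
    moreover have "h y \<noteq> h y'"
      using inj_onD[OF inj] ST[OF y] ST[OF that(1)] that(2) by metis
    ultimately have "key (h y) < key (h y')"
      using leads_onD(3)[OF lead ST[OF that(1)] P] by simp
    then show False using max[OF that(1)] by simp
  qed
  then have "lookup (\<Sum>\<tau>\<in>Q. D (fst (h y)) \<tau> * c \<tau>) (snd (h y)) =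
      (\<Sum>y'\<in>?S. if y' = y then column_coeff D y (h y) * lookup (c (fst y)) (snd y) else 0)"
    unfolding lookup_column_sum[OF assms(1)] by (intro sum.cong) auto
  also have "\<dots> = column_coeff D y (h y) * lookup (c (fst y)) (snd y)"
    using fin y by simp
  also have "\<dots> \<noteq> 0"
    using nz y by (auto simp: in_keys_iff)
  finally show False using cycle[OF P] by simp
qed

text \<open>
  Exactness follows from matching the terms of the middle module: each of them is either the leading term of a
  boundary or one of the terms \<open>T0\<close> on which \<open>D0\<close> is injective. A cycle is reduced by boundaries to a cycle
  supported on \<open>T0\<close>, which is zero.
\<close>

lemma triangular_exact:
  fixes D0 :: "'s \<Rightarrow> 't \<Rightarrow> ('x, 'k::field) mpoly" and D1 :: "'t \<Rightarrow> 'u \<Rightarrow> ('x, 'k) mpoly"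
  assumes fin: "finite Q" "finite R"
    and lead0: "leads_on P D0 key0 T0 h0" "inj_on h0 T0"
    and lead1: "leads_on Q D1 key1 T1 h1"
    and T1: "\<And>y. y \<in> T1 \<Longrightarrow> fst y \<in> R \<and> keys (snd y) \<subseteq> X"
    and split: "\<And>\<tau> m. \<tau> \<in> Q \<Longrightarrow> keys m \<subseteq> X \<Longrightarrow> (\<tau>, m) \<in> T0 \<union> h1 ` T1"
    and D1: "\<And>\<tau> \<rho>. \<tau> \<in> Q \<Longrightarrow> \<rho> \<in> R \<Longrightarrow> D1 \<tau> \<rho> \<in> polys X"
    and square: "\<And>\<sigma> \<rho>. \<sigma> \<in> P \<Longrightarrow> \<rho> \<in> R \<Longrightarrow> (\<Sum>\<tau>\<in>Q. D0 \<sigma> \<tau> * D1 \<tau> \<rho>) = 0"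
    and c: "\<And>\<tau>. \<tau> \<in> Q \<Longrightarrow> c \<tau> \<in> polys X"
    and cycle: "\<And>\<sigma>. \<sigma> \<in> P \<Longrightarrow> (\<Sum>\<tau>\<in>Q. D0 \<sigma> \<tau> * c \<tau>) = 0"
  obtains c' where "\<And>\<rho>. \<rho> \<in> R \<Longrightarrow> c' \<rho> \<in> polys X"
    "\<And>\<tau>. \<tau> \<in> Q \<Longrightarrow> c \<tau> = (\<Sum>\<rho>\<in>R. D1 \<tau> \<rho> * c' \<rho>)"
proof -
  obtain c' where c': "\<And>\<rho>. \<rho> \<in> R \<Longrightarrow> c' \<rho> \<in> polys X"
    "\<And>\<tau> m. (\<tau>, m) \<in> h1 ` T1 \<Longrightarrow> lookup (c \<tau> - (\<Sum>\<rho>\<in>R. D1 \<tau> \<rho> * c' \<rho>)) m = 0"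
    using triangular_reduction[OF fin lead1 T1 order_refl] by blast
  define e where "e \<tau> = c \<tau> - (\<Sum>\<rho>\<in>R. D1 \<tau> \<rho> * c' \<rho>)" for \<tau>
  have "e \<tau> = 0" if "\<tau> \<in> Q" for \<tau>
  proof (rule triangular_injective[OF fin(1) lead0])
    fix \<tau> m assume \<tau>: "\<tau> \<in> Q" "m \<in> keys (e \<tau>)"
    have "e \<tau> \<in> polys X"
      unfolding e_def using \<tau>(1) c c'(1) D1 by (intro polys_minus polys_sum polys_mult) auto
    then have "keys m \<subseteq> X" using \<tau>(2) by (auto simp: polys_iff)
    moreover have "(\<tau>, m) \<notin> h1 ` T1"
      using c'(2)[of \<tau> m] \<tau>(2) by (auto simp: e_def in_keys_iff)
    ultimately show "(\<tau>, m) \<in> T0" using split[OF \<tau>(1)] by blast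
  next
    fix \<sigma> assume \<sigma>: "\<sigma> \<in> P"
    have "(\<Sum>\<tau>\<in>Q. D0 \<sigma> \<tau> * (\<Sum>\<rho>\<in>R. D1 \<tau> \<rho> * c' \<rho>)) =
        (\<Sum>\<rho>\<in>R. (\<Sum>\<tau>\<in>Q. D0 \<sigma> \<tau> * D1 \<tau> \<rho>) * c' \<rho>)"
      unfolding sum_distrib_left sum_distrib_right mult.assoc by (rule sum.swap)
    also have "\<dots> = 0" using square[OF \<sigma>] by simp
    finally show "(\<Sum>\<tau>\<in>Q. D0 \<sigma> \<tau> * e \<tau>) = 0"
      using cycle[OF \<sigma>] by (simp add: e_def right_diff_distrib sum_subtractf)
  qed (use that in auto)
  then show ?thesis using that[of c'] c'(1) by (simp add: e_def)
qed

section \<open>Ranks of elements in a set of numbers\<close>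

definition rank :: "nat set \<Rightarrow> nat \<Rightarrow> nat" where
  "rank S j = card {k \<in> S. k < j}"

lemma rank_less: "finite S \<Longrightarrow> j \<in> S \<Longrightarrow> j < k \<Longrightarrow> rank S j < rank S k"
  unfolding rank_def by (rule psubset_card_mono) auto

lemma rank_le: "finite S \<Longrightarrow> j \<le> k \<Longrightarrow> rank S j \<le> rank S k"
  unfolding rank_def by (rule card_mono) auto

lemma rank_less_iff: "finite S \<Longrightarrow> j \<in> S \<Longrightarrow> k \<in> S \<Longrightarrow> rank S j < rank S k \<longleftrightarrow> j < k"
  using rank_less rank_le by (metis leD linorder_not_less)

lemma rank_eq_iff: "finite S \<Longrightarrow> j \<in> S \<Longrightarrow> k \<in> S \<Longrightarrow> rank S j = rank S k \<longleftrightarrow> j = k"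
  using rank_less_iff by (metis linorder_neqE_nat nat_neq_iff)

lemma rank_less_card: "finite S \<Longrightarrow> j \<in> S \<Longrightarrow> rank S j < card S"
  unfolding rank_def by (rule psubset_card_mono) auto

lemma rank_surj:
  assumes "finite S" "r < card S"
  obtains k where "k \<in> S" "rank S k = r"
proof -
  have "inj_on (rank S) S"
    using assms(1) by (auto simp: inj_on_def rank_eq_iff)
  then have "card (rank S ` S) = card S" by (rule card_image)
  moreover have "rank S ` S \<subseteq> {..<card S}" using rank_less_card[OF assms(1)] by auto
  ultimately have "rank S ` S = {..<card S}" by (intro card_subset_eq) auto
  then show ?thesis using assms(2) that by (metis imageE lessThan_iff)
qed

lemma rank_remove:
  assumes "finite S" "j \<in> S"
  shows "rank (S - {j}) k = (if j < k then rank S k - 1 else rank S k)"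
proof (cases "j < k")
  case True
  have "{i \<in> S - {j}. i < k} = {i \<in> S. i < k} - {j}" by auto
  then show ?thesis using assms True by (simp add: rank_def)
next
  case False
  then have "{i \<in> S - {j}. i < k} = {i \<in> S. i < k}" by auto
  then show ?thesis using False by (simp add: rank_def)
qed

lemma rank_Min: "finite S \<Longrightarrow> S \<noteq> {} \<Longrightarrow> rank S (Min S) = 0"
  by (auto simp: rank_def)

lemma rank_Max: "finite S \<Longrightarrow> S \<noteq> {} \<Longrightarrow> rank S (Max S) = card S - 1"
proof -
  assume S: "finite S" "S \<noteq> {}"
  have "{k \<in> S. k < Max S} = S - {Max S}"
    using S by (auto simp: le_neq_implies_less)
  then show ?thesis using S by (simp add: rank_def)
qed

text \<open>
  A face \<open>(S, q)\<close> of the complex below stands for the decomposition of \<open>S\<close> into its \<open>q + 1\<close> smallest elements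
  and the set of the others, \<open>upper S q\<close>. The next four lemmas describe how the upper part changes when an element of
  \<open>S\<close> is removed and \<open>q\<close> is kept or lowered by one.
\<close>

definition upper :: "nat set \<Rightarrow> nat \<Rightarrow> nat set" where
  "upper S q = {k \<in> S. q < rank S k}"

lemma upper_remove_low:
  assumes "finite S" "j \<in> S" "rank S j \<le> q" "0 < q"
  shows "upper (S - {j}) (q - 1) = upper S q"
proof -
  have "rank S k < rank S j" if "k \<in> S" "k < j" for k using rank_less[OF assms(1) that] .
  then show ?thesis
    using assms by (fastforce simp: upper_def rank_remove split: if_splits)
qed

lemma upper_remove_high:
  assumes "finite S" "j \<in> S" "q < rank S j"
  shows "upper (S - {j}) q = upper S q - {j}"
proof -
  have "rank S j < rank S k" if "k \<in> S" "j < k" for k using rank_less[OF assms(1,2) that(2)] .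
  then show ?thesis
    using assms by (fastforce simp: upper_def rank_remove split: if_splits)
qed

lemma upper_remove_high_shift:
  assumes "finite S" "j \<in> S" "q < rank S j" "0 < q"
  obtains l where "l < j" "l \<in> S" "l \<notin> upper S q" "upper (S - {j}) (q - 1) = insert l (upper S q - {j})"
proof -
  have "q < card S" using rank_less_card[OF assms(1,2)] assms(3) by simp
  then obtain l where l: "l \<in> S" "rank S l = q" using rank_surj[OF assms(1)] by blast
  have lj: "l < j" using l assms rank_less_iff[OF assms(1) l(1) assms(2)] by simp
  have 1: "rank S j < rank S k" if "k \<in> S" "j < k" for k using rank_less[OF assms(1,2) that(2)] .
  have 2: "rank S k = q \<longleftrightarrow> k = l" if "k \<in> S" for k using l rank_eq_iff[OF assms(1) that l(1)] by simp
  have "k \<in> upper (S - {j}) (q - 1) \<longleftrightarrow> k \<in> insert l (upper S q - {j})" for k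
  proof (cases "k \<in> S \<and> k \<noteq> j")
    case True
    then have "k \<in> upper (S - {j}) (q - 1) \<longleftrightarrow> q \<le> rank S k"
      using assms 1[of k] by (auto simp: upper_def rank_remove)
    also have "\<dots> \<longleftrightarrow> k = l \<or> q < rank S k" using 2[of k] True by (simp add: le_less eq_commute[of q] disj_commute)
    finally show ?thesis using True by (auto simp: upper_def)
  qed (use l lj in \<open>auto simp: upper_def\<close>)
  then show ?thesis using that[of l] l lj by (auto simp: upper_def)
qed

lemma upper_remove_low_shift:
  assumes "finite S" "j \<in> S" "rank S j \<le> q" "q + 2 < card S"
  obtains u where "j < u" "u \<in> upper S q" "upper (S - {j}) q = upper S q - {u}"
proof -
  have "q + 1 < card S" using assms(4) by simp
  then obtain u where u: "u \<in> S" "rank S u = q + 1" using rank_surj[OF assms(1)] by blast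
  have ju: "j < u" using u assms rank_less_iff[OF assms(1,2) u(1)] by simp
  have 1: "rank S k < rank S j" if "k \<in> S" "k < j" for k using rank_less[OF assms(1) that] .
  have 2: "rank S k = q + 1 \<longleftrightarrow> k = u" if "k \<in> S" for k using u rank_eq_iff[OF assms(1) that u(1)] by simp
  have "k \<in> upper (S - {j}) q \<longleftrightarrow> k \<in> upper S q - {u}" for k
  proof (cases "k \<in> S \<and> k \<noteq> j")
    case True
    then have "k \<in> upper (S - {j}) q \<longleftrightarrow> q + 1 < rank S k"
      using assms 1[of k] by (auto simp: upper_def rank_remove)
    also have "\<dots> \<longleftrightarrow> q < rank S k \<and> k \<noteq> u" using 2[of k] True by linarith
    finally show ?thesis using True by (auto simp: upper_def)
  qed (use assms in \<open>auto simp: upper_def\<close>)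
  then show ?thesis using that[of u] u ju by (auto simp: upper_def)
qed

section \<open>Divisibility of monomials\<close>

definition mdvd :: "'x mono \<Rightarrow> 'x mono \<Rightarrow> bool" where
  "mdvd a m \<longleftrightarrow> (\<forall>x. lookup a x \<le> lookup m x)"

lemma mdvd_add [simp]: "mdvd a (a + m)" "mdvd a (m + a)"
  by (simp_all add: mdvd_def lookup_add)

lemma mdvd_0_iff: "mdvd a 0 \<longleftrightarrow> a = 0"
  by (auto simp: mdvd_def intro: poly_mapping_eqI)

lemma mdvd_add_right: "mdvd a m \<Longrightarrow> mdvd a (m + n)"
  by (simp add: mdvd_def lookup_add trans_le_add1)

lemma mdvd_diff_add: "mdvd a m \<Longrightarrow> m - a + a = m"
  by (rule poly_mapping_eqI) (simp add: mdvd_def lookup_add lookup_minus)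

lemma mdvd_coprime_add:
  assumes "keys a \<inter> keys b = {}"
  shows "mdvd a (m + b) \<longleftrightarrow> mdvd a m"
proof -
  have "lookup a x = 0 \<or> lookup b x = 0" for x using assms by (auto simp: in_keys_iff)
  then have "lookup a x \<le> lookup m x + lookup b x \<longleftrightarrow> lookup a x \<le> lookup m x" for x
    by (metis add.right_neutral le0)
  then show ?thesis by (simp add: mdvd_def lookup_add)
qed

lemma keys_diff_nat: "keys (m - a :: 'x mono) \<subseteq> keys m"
  by (auto simp: in_keys_iff lookup_minus)

section \<open>The Eagon-Northcott complex of a matrix of monomials and its degeneration\<close>

lemma sum_antisym:
  fixes g :: "nat \<Rightarrow> nat \<Rightarrow> 'a::ab_group_add"
  assumes "finite S" "\<And>j k. j \<in> S \<Longrightarrow> k \<in> S \<Longrightarrow> j < k \<Longrightarrow> g j k = - g k j"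
  shows "(\<Sum>j\<in>S. \<Sum>k\<in>S - {j}. g j k) = 0"
proof -
  have "(\<Sum>k\<in>S - {j}. g j k) = (\<Sum>k\<in>S. if j < k then g j k else 0) + (\<Sum>k\<in>S. if k < j then g j k else 0)" for j
  proof -
    have "(\<Sum>k\<in>S - {j}. g j k) = (\<Sum>k\<in>S - {j}. (if j < k then g j k else 0) + (if k < j then g j k else 0))"
      by (rule sum.cong) auto
    also have "\<dots> = (\<Sum>k\<in>S. (if j < k then g j k else 0) + (if k < j then g j k else 0))"
      using assms(1) by (intro sum.mono_neutral_left) auto
    finally show ?thesis by (simp add: sum.distrib)
  qed
  then have "(\<Sum>j\<in>S. \<Sum>k\<in>S - {j}. g j k) =
      (\<Sum>j\<in>S. \<Sum>k\<in>S. if j < k then g j k else 0) + (\<Sum>j\<in>S. \<Sum>k\<in>S. if k < j then g j k else 0)"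
    by (simp add: sum.distrib)
  also have "(\<Sum>j\<in>S. \<Sum>k\<in>S. if k < j then g j k else 0) = (\<Sum>j\<in>S. \<Sum>k\<in>S. if j < k then g k j else 0)"
    by (rule sum.swap)
  also have "(\<Sum>j\<in>S. \<Sum>k\<in>S. if j < k then g j k else 0) = - (\<Sum>j\<in>S. \<Sum>k\<in>S. if j < k then g k j else 0)"
    unfolding sum_negf[symmetric] using assms(2) by (intro sum.cong) auto
  finally show ?thesis by simp
qed

text \<open>
  The bookkeeping behind \<open>\<partial> \<partial> = 0\<close>: dropping \<open>j\<close> first and then \<open>k > j\<close> collects the same monomials as the opposite order.
  Here \<open>a\<close> and \<open>b + 1\<close> are the ranks of \<open>j\<close> and \<open>k\<close>, and \<open>T q' r B A\<close> is the coefficient for dropping an element of rank \<open>r\<close>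
  from a face with second component \<open>q'\<close>.
\<close>

lemma drop_terms_commute:
  fixes Aj Ak Bj Bk :: "'a::comm_ring_1"
  assumes ab: "a \<le> (b::nat)" and q: "q \<le> Suc (Suc i)"
    and T: "\<And>q' r B A. T q' r B A = (if 0 < q' \<and> q'' = q' - 1 \<and> (eps \<or> r \<le> q') then B else 0) +
      (if q' \<le> i \<and> q'' = q' \<and> (eps \<or> q' < r) then A else (0::'a))"
  shows "(if 0 < q \<and> (eps \<or> a \<le> q) then T (q - 1) b Bk Ak * Bj else 0) +
    (if q \<le> Suc i \<and> (eps \<or> q < a) then T q b Bk Ak * Aj else 0) =
    (if 0 < q \<and> (eps \<or> Suc b \<le> q) then T (q - 1) a Bj Aj * Bk else 0) +
    (if q \<le> Suc i \<and> (eps \<or> q < Suc b) then T q a Bj Aj * Ak else 0)"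
proof -
  consider (AA) "q'' = q" | (AB) "q = Suc q''" | (BB) "q = Suc (Suc q'')"
    | (no) "q'' \<noteq> q" "q \<noteq> Suc q''" "q \<noteq> Suc (Suc q'')" by blast
  then show ?thesis
  proof cases
    case AA
    then have "T q r B A = (if q \<le> i \<and> (eps \<or> q < r) then A else 0)"
      "0 < q \<Longrightarrow> T (q - 1) r B A = 0" for r B A
      by (auto simp: T)
    then show ?thesis using ab by (cases "q = 0") (simp_all add: mult.commute)
  next
    case AB
    then have "T q r B A = (if eps \<or> r \<le> q then B else 0)"
      "T (q - 1) r B A = (if q'' \<le> i \<and> (eps \<or> q'' < r) then A else 0)" for r B A
      by (auto simp: T)
    then show ?thesis using ab q by (cases eps) (simp_all add: AB mult.commute)
  next
    case BB
    then have "T q r B A = 0" "T (q - 1) r B A = (if eps \<or> r < q then B else 0)" for r B A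
      by (auto simp: T)
    then show ?thesis using ab by (cases eps) (simp_all add: BB mult.commute)
  next
    case no
    then have n: "\<not> (0 < q \<and> q'' = q - 1)" "\<not> (0 < q - 1 \<and> q'' = q - 1 - 1)" by arith+
    have T0: "T q r B A = 0" for r B A
      unfolding T using n(1) no(1) by (simp only: if_False conj_assoc[symmetric] simp_thms add_0_left)
    have T1: "0 < q \<Longrightarrow> T (q - 1) r B A = 0" for r B A
      unfolding T using n by (simp only: if_False conj_assoc[symmetric] simp_thms add_0_left)
    show ?thesis unfolding T0 using T1 by (cases "q = 0") simp_all
  qed
qed

text \<open>
  A matrix with two rows \<open>am 0, \<dots>, am d\<close> and \<open>bm 0, \<dots>, bm d\<close> of pairwise coprime monomials other than \<open>1\<close>. The weight makes
  the term \<open>bm i * am j\<close> of the minor of the columns \<open>i < j\<close> larger than \<open>am i * bm j\<close>; it plays the role of a monomial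
  order for which the former is the leading term.
\<close>

locale monomial_columns =
  fixes X :: "'x set" and d :: nat and am bm :: "nat \<Rightarrow> 'x mono" and wt :: "'x mono \<Rightarrow> nat"
  assumes keys_am: "j \<le> d \<Longrightarrow> keys (am j) \<subseteq> X" and keys_bm: "j \<le> d \<Longrightarrow> keys (bm j) \<subseteq> X"
    and am_bm: "i \<le> d \<Longrightarrow> j \<le> d \<Longrightarrow> keys (am i) \<inter> keys (bm j) = {}"
    and am_am: "i \<le> d \<Longrightarrow> j \<le> d \<Longrightarrow> i \<noteq> j \<Longrightarrow> keys (am i) \<inter> keys (am j) = {}"
    and bm_bm: "i \<le> d \<Longrightarrow> j \<le> d \<Longrightarrow> i \<noteq> j \<Longrightarrow> keys (bm i) \<inter> keys (bm j) = {}"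
    and am_nz: "j \<le> d \<Longrightarrow> am j \<noteq> 0" and bm_nz: "j \<le> d \<Longrightarrow> bm j \<noteq> 0"
    and deg_eq: "j \<le> d \<Longrightarrow> mdegree (bm j) = mdegree (am j)"
    and wt_add: "wt (m + n) = wt m + wt n"
    and wt_am: "i < j \<Longrightarrow> j \<le> d \<Longrightarrow> wt (am i) < wt (am j)"
    and wt_bm: "j \<le> d \<Longrightarrow> wt (bm j) = 0"
begin

type_synonym face = "nat set \<times> nat"

text \<open>
  Basis elements of the complex. In position \<open>Suc i\<close> these are the pairs \<open>(S, q)\<close>, which index the basis
  \<open>e\<^sub>S \<otimes> s\<^sup>p t\<^sup>q\<close>, \<open>p + q = i\<close>, of the Eagon-Northcott complex (with divided powers). The ring itself is in position
  \<open>0\<close>, with \<open>({}, 0)\<close> as the name of its basis element.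
\<close>

definition faces :: "nat \<Rightarrow> face set" where
  "faces n = (case n of 0 \<Rightarrow> {({}, 0)} | Suc i \<Rightarrow> {(S, q). S \<subseteq> {..d} \<and> card S = i + 2 \<and> q \<le> i})"

text \<open>
  With \<open>eps\<close> the \<open>2 \<times> 2\<close> minor of the columns \<open>i\<close> and \<open>j\<close>, without \<open>eps\<close> its leading term. The same switch in \<open>drop_coeff\<close> and
  \<open>bd\<close> selects either the Eagon-Northcott complex or its degeneration, which resolves the ideal of the
  leading terms.
\<close>

definition minor :: "bool \<Rightarrow> nat \<Rightarrow> nat \<Rightarrow> ('x, 'k::field) mpoly" where
  "minor eps i j = single (bm i + am j) 1 - (if eps then single (am i + bm j) 1 else 0)"

text \<open>
  Coefficient, up to sign, for dropping \<open>j\<close> from \<open>S\<close>: the entry \<open>bm j\<close> when \<open>q\<close> decreases and \<open>am j\<close> when \<open>q\<close> stays, which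
  lowers the complementary exponent \<open>p = card S - 2 - q\<close>. In the degeneration only lower elements are dropped with \<open>bm j\<close> and
  only upper elements with \<open>am j\<close>, so that the monomial \<open>\<Prod> bm\<close> over the lower part times \<open>\<Prod> am\<close> over the upper part gives a
  multigrading.
\<close>

definition drop_coeff :: "bool \<Rightarrow> nat set \<Rightarrow> nat \<Rightarrow> nat \<Rightarrow> nat \<Rightarrow> ('x, 'k::field) mpoly" where
  "drop_coeff eps S q j q' =
    (if 0 < q \<and> q' = q - 1 \<and> (eps \<or> rank S j \<le> q) then single (bm j) 1 else 0) +
    (if q + 2 < card S \<and> q' = q \<and> (eps \<or> q < rank S j) then single (am j) 1 else 0)"

definition bd :: "bool \<Rightarrow> face \<Rightarrow> face \<Rightarrow> ('x, 'k::field) mpoly" where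
  "bd eps \<sigma> \<tau> = (if card (fst \<tau>) = 2 then (if \<sigma> = ({}, 0) then minor eps (Min (fst \<tau>)) (Max (fst \<tau>)) else 0)
     else (\<Sum>j\<in>fst \<tau>. if fst \<sigma> = fst \<tau> - {j}
       then (- 1) ^ rank (fst \<tau>) j * drop_coeff eps (fst \<tau>) (snd \<tau>) j (snd \<sigma>) else 0))"

lemma finite_face: "(S, q) \<in> faces n \<Longrightarrow> finite S"
  by (auto simp: faces_def split: nat.splits intro: finite_subset)

lemma finite_faces: "finite (faces n)"
proof -
  have "faces n \<subseteq> Pow {..d} \<times> {..n}"
    by (auto simp: faces_def split: nat.splits)
  then show ?thesis by (rule finite_subset) auto
qed

lemma bd_remove:
  assumes "finite S" "card S \<noteq> 2" "j \<in> S"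
  shows "(bd eps (S - {j}, q') (S, q) :: ('x, 'k::field) mpoly) = (- 1) ^ rank S j * drop_coeff eps S q j q'"
proof -
  have "(\<Sum>i\<in>S. if S - {j} = S - {i} then (- 1) ^ rank S i * drop_coeff eps S q i q' else 0) =
      (\<Sum>i\<in>S. if i = j then (- 1) ^ rank S j * drop_coeff eps S q j q' else (0 :: ('x, 'k) mpoly))"
    using assms(3) by (intro sum.cong) auto
  also have "\<dots> = (- 1) ^ rank S j * drop_coeff eps S q j q'"
    using assms by simp
  finally show ?thesis
    using assms(2) by (simp only: bd_def fst_conv snd_conv if_False)
qed

lemma bd_two:
  "i < j \<Longrightarrow> bd eps \<sigma> ({i, j}, q) = (if \<sigma> = ({}, 0) then minor eps i j else 0)"
  by (simp add: bd_def)

lemma keys_minor: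
  "keys (minor eps i j :: ('x, 'k::field) mpoly) \<subseteq> insert (bm i + am j) (if eps then {am i + bm j} else {})"
  unfolding minor_def by (rule subset_trans[OF keys_diff]) auto

lemma keys_drop_coeff:
  "keys (drop_coeff eps S q j q' :: ('x, 'k::field) mpoly) \<subseteq> {am j, bm j}"
  unfolding drop_coeff_def
  by (rule subset_trans[OF keys_add]) auto

lemma signed_mult: "((- 1) ^ n * p :: 'a::comm_ring_1) = (if even n then p else - p)"
  by (induction n) auto

lemma keys_bd:
  assumes "m \<in> keys (bd eps \<sigma> \<tau> :: ('x, 'k::field) mpoly)"
  obtains (minor) "card (fst \<tau>) = 2" "\<sigma> = ({}, 0)"
      "m = bm (Min (fst \<tau>)) + am (Max (fst \<tau>)) \<or> m = am (Min (fst \<tau>)) + bm (Max (fst \<tau>))"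
  | (drop) j where "card (fst \<tau>) \<noteq> 2" "j \<in> fst \<tau>" "fst \<sigma> = fst \<tau> - {j}" "m = am j \<or> m = bm j"
proof (cases "card (fst \<tau>) = 2")
  case True
  then have "\<sigma> = ({}, 0)" "m \<in> keys (minor eps (Min (fst \<tau>)) (Max (fst \<tau>)) :: ('x, 'k) mpoly)"
    using assms by (auto simp: bd_def split: if_splits)
  then have "m = bm (Min (fst \<tau>)) + am (Max (fst \<tau>)) \<or> m = am (Min (fst \<tau>)) + bm (Max (fst \<tau>))"
    using keys_minor[where 'k = 'k, of eps "Min (fst \<tau>)" "Max (fst \<tau>)"] by (auto split: if_splits)
  then show ?thesis using minor True \<open>\<sigma> = ({}, 0)\<close> by blast
next
  case False
  then have "m \<in> keys (\<Sum>j\<in>fst \<tau>. if fst \<sigma> = fst \<tau> - {j}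
       then (- 1) ^ rank (fst \<tau>) j * drop_coeff eps (fst \<tau>) (snd \<tau>) j (snd \<sigma>) else (0 :: ('x, 'k) mpoly))"
    using assms by (simp add: bd_def)
  from subsetD[OF keys_sum this] obtain j where j: "j \<in> fst \<tau>" "m \<in> keys (if fst \<sigma> = fst \<tau> - {j}
       then (- 1) ^ rank (fst \<tau>) j * drop_coeff eps (fst \<tau>) (snd \<tau>) j (snd \<sigma>) else (0 :: ('x, 'k) mpoly))"
    by (rule UN_E)
  then have "fst \<sigma> = fst \<tau> - {j}" "m \<in> keys (drop_coeff eps (fst \<tau>) (snd \<tau>) j (snd \<sigma>) :: ('x, 'k) mpoly)"
    by (auto simp: signed_mult split: if_splits)
  then show ?thesis using drop False j(1) keys_drop_coeff by blast
qed

lemma face_subset: "\<tau> \<in> faces n \<Longrightarrow> fst \<tau> \<subseteq> {..d}"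
  by (auto simp: faces_def split: nat.splits)

lemma face_MinMax:
  assumes "\<tau> \<in> faces n" "card (fst \<tau>) = 2"
  obtains i j where "i < j" "j \<le> d" "fst \<tau> = {i, j}" "Min (fst \<tau>) = i" "Max (fst \<tau>) = j"
proof -
  obtain a b where ab: "fst \<tau> = {a, b}" "a \<noteq> b" using assms(2) by (meson card_2_iff)
  have "{a, b} \<subseteq> {..d}" using face_subset[OF assms(1)] ab by simp
  then show ?thesis
    using ab that[of "min a b" "max a b"] by (cases "a < b") (auto simp: insert_commute)
qed

lemma bd_polys:
  assumes "\<tau> \<in> faces n"
  shows "(bd eps \<sigma> \<tau> :: ('x, 'k::field) mpoly) \<in> polys X"
  unfolding polys_iff
proof
  fix m assume "m \<in> keys (bd eps \<sigma> \<tau> :: ('x, 'k) mpoly)"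
  then show "keys m \<subseteq> X"
  proof (cases rule: keys_bd)
    case minor
    obtain i j where "i < j" "j \<le> d" "Min (fst \<tau>) = i" "Max (fst \<tau>) = j"
      using face_MinMax[OF assms minor(1)] by metis
    then show ?thesis
      using minor(3) keys_am[of i] keys_am[of j] keys_bm[of i] keys_bm[of j] by (auto simp: keys_add_nat)
  next
    case (drop j)
    then show ?thesis using face_subset[OF assms] keys_am[of j] keys_bm[of j] by auto
  qed
qed

lemma bd_const:
  assumes "\<tau> \<in> faces n"
  shows "lookup (bd eps \<sigma> \<tau> :: ('x, 'k::field) mpoly) 0 = 0"
proof (rule ccontr)
  assume "lookup (bd eps \<sigma> \<tau> :: ('x, 'k) mpoly) 0 \<noteq> 0"
  then have "0 \<in> keys (bd eps \<sigma> \<tau> :: ('x, 'k) mpoly)" by (simp add: in_keys_iff)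
  then show False
  proof (cases rule: keys_bd)
    case minor
    obtain i j where ij: "i < j" "j \<le> d" "Min (fst \<tau>) = i" "Max (fst \<tau>) = j"
      using face_MinMax[OF assms minor(1)] by metis
    have "keys (am j) \<noteq> {}" "keys (am i) \<noteq> {}" using am_nz[of i] am_nz[of j] ij by auto
    moreover have "keys (bm i + am j) = {} \<or> keys (am i + bm j) = {}"
      using minor(3) ij by (metis keys_zero)
    ultimately show ?thesis by (auto simp: keys_add_nat)
  next
    case (drop j)
    then show ?thesis using face_subset[OF assms] am_nz[of j] bm_nz[of j] by auto
  qed
qed

definition shift :: "face \<Rightarrow> int" where
  "shift \<tau> = (\<Sum>j\<in>fst \<tau>. int (mdegree (am j)))"

text \<open>
  Since both entries of a column have the same degree, the degree of a basis element only depends on its set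
  of columns.
\<close>

lemma bd_homogeneous:
  assumes "\<tau> \<in> faces n"
  shows "homogeneous (shift \<tau> - shift \<sigma>) (bd eps \<sigma> \<tau> :: ('x, 'k::field) mpoly)"
  unfolding homogeneous_def
proof
  fix m assume "m \<in> keys (bd eps \<sigma> \<tau> :: ('x, 'k) mpoly)"
  then show "int (mdegree m) = shift \<tau> - shift \<sigma>"
  proof (cases rule: keys_bd)
    case minor
    obtain i j where ij: "i < j" "j \<le> d" "fst \<tau> = {i, j}" "Min (fst \<tau>) = i" "Max (fst \<tau>) = j"
      using face_MinMax[OF assms minor(1)] by metis
    then show ?thesis
      using minor deg_eq[of i] deg_eq[of j] by (auto simp: shift_def mdegree_add)
  next
    case (drop j)
    have "finite (fst \<tau>)" using finite_face[of "fst \<tau>" "snd \<tau>" n] assms by simp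
    then show ?thesis using drop face_subset[OF assms] deg_eq[of j]
      by (auto simp: shift_def sum.remove[of _ j])
  qed
qed

section \<open>The boundary of a boundary\<close>

lemma bd_sum_faces:
  fixes p :: "face \<Rightarrow> ('x, 'k::field) mpoly"
  assumes \<rho>: "(S, q) \<in> faces (Suc (Suc i))"
  shows "(\<Sum>\<tau>\<in>faces (Suc i). p \<tau> * bd eps \<tau> (S, q)) =
    (\<Sum>j\<in>S. (- 1) ^ rank S j * (\<Sum>q'\<le>i. p (S - {j}, q') * drop_coeff eps S q j q'))"
proof -
  have fin: "finite S" by (rule finite_face[OF \<rho>])
  have S: "S \<subseteq> {..d}" "card S = i + 3" using \<rho> by (auto simp: faces_def)
  define F where "F = {S'. S' \<subseteq> {..d} \<and> card S' = i + 2}"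
  have finF: "finite F" by (rule finite_subset[of _ "Pow {..d}"]) (auto simp: F_def)
  have faces: "faces (Suc i) = F \<times> {..i}" by (auto simp: faces_def F_def)
  have bd: "bd eps (S', q') (S, q) = (\<Sum>j\<in>S. if S' = S - {j}
      then (- 1) ^ rank S j * drop_coeff eps S q j q' else (0 :: ('x, 'k) mpoly))" for S' q'
    using S(2) by (simp only: bd_def fst_conv snd_conv) simp
  have "(\<Sum>\<tau>\<in>faces (Suc i). p \<tau> * bd eps \<tau> (S, q)) =
      (\<Sum>S'\<in>F. \<Sum>q'\<le>i. p (S', q') * bd eps (S', q') (S, q))"
    unfolding faces by (simp add: sum.cartesian_product split_def)
  also have "\<dots> =
      (\<Sum>S'\<in>F. \<Sum>q'\<le>i. \<Sum>j\<in>S. if S' = S - {j} then (- 1) ^ rank S j * (p (S', q') * drop_coeff eps S q j q') else 0)"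
    unfolding bd sum_distrib_left by (intro sum.cong refl) (simp add: mult.left_commute)
  also have "\<dots> = (\<Sum>S'\<in>F. \<Sum>j\<in>S. \<Sum>q'\<le>i. if S' = S - {j} then (- 1) ^ rank S j * (p (S', q') * drop_coeff eps S q j q') else 0)"
    by (rule sum.cong[OF refl], rule sum.swap)
  also have "\<dots> = (\<Sum>j\<in>S. \<Sum>S'\<in>F. \<Sum>q'\<le>i. if S' = S - {j} then (- 1) ^ rank S j * (p (S', q') * drop_coeff eps S q j q') else 0)"
    by (rule sum.swap)
  also have "\<dots> = (\<Sum>j\<in>S. \<Sum>S'\<in>F. if S' = S - {j} then (- 1) ^ rank S j * (\<Sum>q'\<le>i. p (S - {j}, q') * drop_coeff eps S q j q') else 0)"
    by (intro sum.cong refl) (auto simp: sum_distrib_left)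
  also have "\<dots> = (\<Sum>j\<in>S. (- 1) ^ rank S j * (\<Sum>q'\<le>i. p (S - {j}, q') * drop_coeff eps S q j q'))"
  proof (rule sum.cong[OF refl])
    fix j assume "j \<in> S"
    then have "S - {j} \<in> F" using S fin by (auto simp: F_def)
    then show "(\<Sum>S'\<in>F. if S' = S - {j} then (- 1) ^ rank S j * (\<Sum>q'\<le>i. p (S - {j}, q') * drop_coeff eps S q j q') else 0)
        = (- 1) ^ rank S j * (\<Sum>q'\<le>i. p (S - {j}, q') * drop_coeff eps S q j q')"
      using finF by simp
  qed
  finally show ?thesis .
qed

lemma sum_drop_coeff:
  fixes P :: "nat \<Rightarrow> ('x, 'k::field) mpoly"
  assumes "card S = i + 3" "q \<le> Suc i"
  shows "(\<Sum>q'\<le>i. P q' * drop_coeff eps S q j q') =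
    (if 0 < q \<and> (eps \<or> rank S j \<le> q) then P (q - 1) * single (bm j) 1 else 0) +
    (if q \<le> i \<and> (eps \<or> q < rank S j) then P q * single (am j) 1 else 0)"
proof -
  have "P q' * drop_coeff eps S q j q' =
      (if q' = q - 1 then (if 0 < q \<and> (eps \<or> rank S j \<le> q) then P (q - 1) * single (bm j) 1 else 0) else 0) +
      (if q' = q then (if q \<le> i \<and> (eps \<or> q < rank S j) then P q * single (am j) 1 else 0) else 0)" for q'
    using assms(1) by (auto simp: drop_coeff_def distrib_left)
  then show ?thesis
    using assms(2) by (auto simp: sum.distrib)
qed

text \<open>
  The Laplace expansion along a repeated row of the \<open>3 \<times> 3\<close> determinants with rows from the given matrix; in
  the degeneration, its leading terms.
\<close>

lemma bd_bd_0:
  assumes \<rho>: "\<rho> \<in> faces (Suc (Suc 0))"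
  shows "(\<Sum>\<tau>\<in>faces (Suc 0). bd eps ({}, 0) \<tau> * bd eps \<tau> \<rho>) = (0 :: ('x, 'k::field) mpoly)"
proof -
  obtain S q where \<rho>_eq: "\<rho> = (S, q)" by fastforce
  have fin: "finite S" using finite_face \<rho> \<rho>_eq by blast
  have S: "S \<subseteq> {..d}" "card S = 3" "q \<le> 1" using \<rho> by (auto simp: faces_def \<rho>_eq)
  obtain x where x: "x \<in> S" "rank S x = 0" using rank_surj[OF fin, of 0] S(2) by auto
  obtain y where y: "y \<in> S" "rank S y = 1" using rank_surj[OF fin, of 1] S(2) by auto
  obtain z where z: "z \<in> S" "rank S z = 2" using rank_surj[OF fin, of 2] S(2) by auto
  have lt: "x < y" "y < z"
    using rank_less_iff[OF fin x(1) y(1)] rank_less_iff[OF fin y(1) z(1)] x(2) y(2) z(2) by auto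
  have "{x, y, z} = S"
    using x(1) y(1) z(1) lt S(2) by (intro card_subset_eq[OF fin]) auto
  then have S_eq: "S = {x, y, z}" by simp
  have rem: "S - {x} = {y, z}" "S - {y} = {x, z}" "S - {z} = {x, y}"
    using lt by (auto simp: S_eq)
  have bd: "bd eps ({}, 0) ({i, j}, 0) = minor eps i j" if "i < j" for i j
    using that by (simp add: bd_two)
  have "(\<Sum>\<tau>\<in>faces (Suc 0). bd eps ({}, 0) \<tau> * bd eps \<tau> \<rho>) =
      (\<Sum>j\<in>S. (- 1) ^ rank S j * (\<Sum>q'\<le>0. bd eps ({}, 0) (S - {j}, q') * drop_coeff eps S q j q' :: ('x, 'k) mpoly))"
    unfolding \<rho>_eq by (rule bd_sum_faces) (use \<rho> \<rho>_eq in simp)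
  also have "\<dots> = (\<Sum>j\<in>{x, y, z}. (- 1) ^ rank S j * (bd eps ({}, 0) (S - {j}, 0) * drop_coeff eps S q j 0 :: ('x, 'k) mpoly))"
    by (simp flip: S_eq)
  also have "\<dots> = minor eps y z * drop_coeff eps S q x 0 - minor eps x z * drop_coeff eps S q y 0
      + minor eps x y * drop_coeff eps S q z 0"
    using lt x(2) y(2) z(2) by (simp add: rem bd)
  also have "\<dots> = 0"
    using S(2,3) x(2) y(2) z(2)
    by (cases "q = 0"; cases eps)
      (auto simp: drop_coeff_def minor_def left_diff_distrib mult_single add_ac)
  finally show ?thesis .
qed

lemma bd_bd_Suc:
  assumes \<sigma>: "\<sigma> \<in> faces (Suc i)" and \<rho>: "\<rho> \<in> faces (Suc (Suc (Suc i)))"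
  shows "(\<Sum>\<tau>\<in>faces (Suc (Suc i)). bd eps \<sigma> \<tau> * bd eps \<tau> \<rho>) = (0 :: ('x, 'k::field) mpoly)"
proof -
  obtain S q where \<rho>_eq: "\<rho> = (S, q)" by fastforce
  obtain S' q'' where \<sigma>_eq: "\<sigma> = (S', q'')" by fastforce
  have fin: "finite S" using finite_face \<rho> \<rho>_eq by blast
  have S: "card S = Suc i + 3" "q \<le> Suc (Suc i)" using \<rho> by (auto simp: faces_def \<rho>_eq)
  define c where "c j k = (\<Sum>q'\<le>Suc i. drop_coeff eps (S - {j}) q' k q'' * drop_coeff eps S q j q' :: ('x, 'k) mpoly)" for j k
  define g where "g j k = (if S' = S - {j} - {k} then
      (- 1) ^ rank S j * ((- 1) ^ rank (S - {j}) k * c j k) else 0)" for j k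
  have "(- 1) ^ rank S j * (\<Sum>q'\<le>Suc i. bd eps \<sigma> (S - {j}, q') * drop_coeff eps S q j q') =
      (\<Sum>k\<in>S - {j}. g j k)" if "j \<in> S" for j
  proof -
    have "card (S - {j}) \<noteq> 2" using S that fin by simp
    then have "bd eps \<sigma> (S - {j}, q') = (\<Sum>k\<in>S - {j}. if S' = S - {j} - {k} then
        (- 1) ^ rank (S - {j}) k * drop_coeff eps (S - {j}) q' k q'' else (0 :: ('x, 'k) mpoly))" for q'
      by (simp only: bd_def \<sigma>_eq fst_conv snd_conv if_False)
    then have "(\<Sum>q'\<le>Suc i. bd eps \<sigma> (S - {j}, q') * drop_coeff eps S q j q') =
        (\<Sum>q'\<le>Suc i. \<Sum>k\<in>S - {j}. if S' = S - {j} - {k} then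
        (- 1) ^ rank (S - {j}) k * (drop_coeff eps (S - {j}) q' k q'' * drop_coeff eps S q j q') else (0 :: ('x, 'k) mpoly))"
      by (simp only: sum_distrib_right if_distrib[of "\<lambda>p. p * _"] mult_zero_left mult.assoc)
    also have "\<dots> = (\<Sum>k\<in>S - {j}. \<Sum>q'\<le>Suc i. if S' = S - {j} - {k} then
        (- 1) ^ rank (S - {j}) k * (drop_coeff eps (S - {j}) q' k q'' * drop_coeff eps S q j q') else (0 :: ('x, 'k) mpoly))"
      by (rule sum.swap)
    also have "\<dots> = (\<Sum>k\<in>S - {j}. if S' = S - {j} - {k} then (- 1) ^ rank (S - {j}) k * c j k else 0)"
      by (intro sum.cong refl) (simp add: c_def sum_distrib_left del: sum.atMost_Suc)
    finally show ?thesis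
      by (simp only: g_def sum_distrib_left if_distrib[of "\<lambda>p. _ * p"] mult_zero_right)
  qed
  then have "(\<Sum>\<tau>\<in>faces (Suc (Suc i)). bd eps \<sigma> \<tau> * bd eps \<tau> \<rho>) = (\<Sum>j\<in>S. \<Sum>k\<in>S - {j}. g j k)"
    using \<rho> unfolding \<rho>_eq by (subst bd_sum_faces) (auto simp del: sum.atMost_Suc intro!: sum.cong)
  also have "\<dots> = 0"
  proof (rule sum_antisym[OF fin])
    fix j k assume jk: "j \<in> S" "k \<in> S" "j < k"
    have r: "rank S j < rank S k" by (rule rank_less[OF fin jk(1,3)])
    have rj: "rank (S - {k}) j = rank S j" using jk fin by (simp add: rank_remove)
    have rk: "rank (S - {j}) k = rank S k - 1" using jk fin by (simp add: rank_remove)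
    obtain b where ab: "rank S k = Suc b" "rank S j \<le> b" using r by (cases "rank S k") auto
    have sj: "card (S - {j}) = i + 3" and sk: "card (S - {k}) = i + 3" using S jk fin by simp_all
    define T where "T q' r B A = (if 0 < q' \<and> q'' = q' - 1 \<and> (eps \<or> r \<le> q') then B else 0) +
      (if q' \<le> i \<and> q'' = q' \<and> (eps \<or> q' < r) then A else (0 :: ('x, 'k) mpoly))" for q' r B A
    have drop: "drop_coeff eps (S - {j}) q' k q'' = T q' b (single (bm k) 1) (single (am k) 1)"
      "drop_coeff eps (S - {k}) q' j q'' = T q' (rank S j) (single (bm j) 1) (single (am j) 1)" for q'
      using ab by (auto simp: T_def drop_coeff_def sj sk rj rk)
    have "c j k = c k j"
      unfolding c_def sum_drop_coeff[OF S] ab(1) drop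
      by (rule drop_terms_commute[OF ab(2) S(2) T_def])
    moreover have "S - {j} - {k} = S - {k} - {j}" by auto
    moreover have "(- 1) ^ rank S k = - ((- 1) ^ (rank S k - 1) :: ('x, 'k) mpoly)"
      using r by (cases "rank S k") auto
    ultimately show "g j k = - g k j"
      by (simp add: g_def rj rk mult.left_commute)
  qed
  finally show ?thesis .
qed

section \<open>The matching of basis elements\<close>

text \<open>
  \<open>Bs m\<close> and \<open>As m\<close> record which entries divide \<open>m\<close>. With \<open>lo\<close> and \<open>hi\<close> they define the matching of \<open>k\<close>-basis elements:
  for a basis element \<open>((S, q), m)\<close> the smallest index \<open>lo\<close> that occurs either in \<open>S\<close> or as a factor \<open>bm\<close> of \<open>m\<close>
  is moved from \<open>S\<close> to \<open>m\<close> or back. Moving it out of \<open>S\<close> is impossible when it is the only lower element of \<open>S\<close>; then the largest index \<open>hi\<close>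
  in \<open>S\<close> or among the factors \<open>am\<close> of \<open>m\<close> is moved instead.
\<close>

definition Bs :: "'x mono \<Rightarrow> nat set" where
  "Bs m = {j. j \<le> d \<and> mdvd (bm j) m}"

definition As :: "'x mono \<Rightarrow> nat set" where
  "As m = {j. j \<le> d \<and> mdvd (am j) m}"

lemma finite_Bs [simp]: "finite (Bs m)" and finite_As [simp]: "finite (As m)"
  by (simp_all add: Bs_def As_def)

lemma Bs_add_bm:
  assumes "j \<le> d"
  shows "Bs (m + bm j) = insert j (Bs m)"
proof (rule Set.set_eqI)
  fix i show "i \<in> Bs (m + bm j) \<longleftrightarrow> i \<in> insert j (Bs m)"
    using mdvd_coprime_add[OF bm_bm, of i j m] assms by (cases "i = j") (auto simp: Bs_def)
qed

lemma Bs_add_am: "j \<le> d \<Longrightarrow> Bs (m + am j) = Bs m"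
  using mdvd_coprime_add[of "bm i" "am j" m for i] am_bm[of j] by (auto simp: Bs_def Int_commute)

lemma As_add_am:
  assumes "j \<le> d"
  shows "As (m + am j) = insert j (As m)"
proof (rule Set.set_eqI)
  fix i show "i \<in> As (m + am j) \<longleftrightarrow> i \<in> insert j (As m)"
    using mdvd_coprime_add[OF am_am, of i j m] assms by (cases "i = j") (auto simp: As_def)
qed

lemma As_add_bm: "j \<le> d \<Longrightarrow> As (m + bm j) = As m"
  using mdvd_coprime_add[of "am i" "bm j" m for i] am_bm[of _ j] by (auto simp: As_def)

definition lo :: "'x mono \<Rightarrow> nat set \<Rightarrow> nat" where
  "lo m S = Min (Bs m \<union> S)"

definition hi :: "'x mono \<Rightarrow> nat set \<Rightarrow> nat" where
  "hi m S = Max (As m \<union> S)"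

lemma lo_le: "finite S \<Longrightarrow> x \<in> Bs m \<union> S \<Longrightarrow> lo m S \<le> x"
  by (simp add: lo_def)

lemma hi_ge: "finite S \<Longrightarrow> x \<in> As m \<union> S \<Longrightarrow> x \<le> hi m S"
  by (simp add: hi_def)

text \<open>
  Basis elements from which the matching moves an index out of \<open>S\<close>.
\<close>

definition tails :: "nat \<Rightarrow> (face \<times> 'x mono) set" where
  "tails n = {((S, q), m) |S q m. (S, q) \<in> faces n \<and> S \<noteq> {} \<and> keys m \<subseteq> X \<and> lo m S \<in> S \<and>
     (0 < q \<or> hi m S \<in> S)}"

text \<open>
  The partner of a tail. In the case \<open>card S = 2\<close> both indices are moved at once, and the partner is a monomial
  of the ring.
\<close>

definition lead :: "face \<times> 'x mono \<Rightarrow> face \<times> 'x mono" where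
  "lead = (\<lambda>((S, q), m).
     if card S = 2 then (({}, 0), m + (bm (lo m S) + am (hi m S)))
     else if 0 < q then ((S - {lo m S}, q - 1), m + bm (lo m S))
     else ((S - {hi m S}, 0), m + am (hi m S)))"

definition weight :: "nat set \<Rightarrow> nat \<Rightarrow> 'x mono \<Rightarrow> nat" where
  "weight S q m = wt m + (\<Sum>u\<in>upper S q. wt (am u))"

text \<open>
  The factor \<open>4\<close> makes the weight decisive, as the two corrections add up to at most \<open>3\<close>. They break ties
  between terms of equal weight: terms from which \<open>lo\<close> has been removed come first, then those
  from which \<open>hi\<close> has been removed.
\<close>

definition potential :: "face \<times> 'x mono \<Rightarrow> nat" where
  "potential = (\<lambda>((S, q), m). 4 * weight S q m + (if lo m S \<in> S then 0 else 2) + (if hi m S \<in> S then 0 else 1))"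

lemma tailsD:
  assumes "((S, q), m) \<in> tails n"
  shows "(S, q) \<in> faces n" "finite S" "S \<noteq> {}" "S \<subseteq> {..d}" "keys m \<subseteq> X"
    "lo m S \<in> S" "lo m S = Min S" "rank S (lo m S) = 0"
    "q = 0 \<Longrightarrow> hi m S \<in> S" "q = 0 \<Longrightarrow> hi m S = Max S" "q = 0 \<Longrightarrow> rank S (hi m S) = card S - 1"
proof -
  show 1: "(S, q) \<in> faces n" "S \<noteq> {}" "keys m \<subseteq> X" "lo m S \<in> S" "q = 0 \<Longrightarrow> hi m S \<in> S"
    using assms by (auto simp: tails_def)
  show 2: "finite S" using finite_face[OF 1(1)] .
  show "S \<subseteq> {..d}" using face_subset[OF 1(1)] by simp
  show 3: "lo m S = Min S"
    using 1(2,4) 2 by (intro Min_eqI[symmetric]) (auto simp: lo_def)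
  show 4: "hi m S = Max S" if "q = 0"
    using 1(2,5) 2 that by (intro Max_eqI[symmetric]) (auto simp: hi_def)
  show "rank S (lo m S) = 0" using 3 rank_Min[OF 2 1(2)] by simp
  show "rank S (hi m S) = card S - 1" if "q = 0" using 4[OF that] rank_Max[OF 2 1(2)] by simp
qed

lemma column_coeff_keys:
  assumes "column_coeff D y x \<noteq> 0"
  obtains m0 where "m0 \<in> keys (D (fst x) (fst y))" "snd x = snd y + m0"
proof -
  have "snd x \<in> keys (D (fst x) (fst y) * single (snd y) 1)"
    using assms by (simp add: column_coeff_def in_keys_iff)
  then show ?thesis using keys_mult that by (fastforce simp: add.commute)
qed

lemma column_coeff_at: "column_coeff D (\<tau>, m) (\<sigma>, m + m0) = lookup (D \<sigma> \<tau>) m0"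
  using lookup_single_mult[of m 1 "D \<sigma> \<tau>" m0] by (simp add: column_coeff_def mult.commute)

lemma keys_bd_drop [consumes 2]:
  assumes "m0 \<in> keys (bd eps (S', q') (S, q) :: ('x, 'k::field) mpoly)" "card S \<noteq> 2"
  obtains (b) j where "j \<in> S" "S' = S - {j}" "0 < q" "q' = q - 1" "m0 = bm j"
  | (a) j where "j \<in> S" "S' = S - {j}" "q + 2 < card S" "q' = q" "m0 = am j"
proof -
  have fin: "finite S"
  proof (rule ccontr)
    assume "infinite S"
    then show False using assms by (simp add: bd_def)
  qed
  from assms(1) obtain j where j: "j \<in> S" "S' = S - {j}"
    by (cases rule: keys_bd) (use assms(2) in auto)
  have "m0 \<in> keys (drop_coeff eps S q j q' :: ('x, 'k) mpoly)"
    using assms(1) bd_remove[OF fin assms(2) j(1), where 'k = 'k] by (auto simp: j(2) signed_mult split: if_splits)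
  then show ?thesis
    using a[OF j] b[OF j] unfolding drop_coeff_def by (auto split: if_splits dest: subsetD[OF keys_add])
qed

text \<open>
  Dropping a lower element with \<open>bm\<close> or an upper element with \<open>am\<close> preserves the weight. The remaining terms of the
  Eagon-Northcott differential shift the border between the lower and upper part; they replace a factor \<open>bm i * am j\<close>, \<open>i < j\<close>, of the
  label by \<open>am i * bm j\<close> and so have smaller weight.
\<close>

lemma weight_remove_low_bm:
  assumes "finite S" "j \<in> S" "rank S j \<le> q" "0 < q" "S \<subseteq> {..d}"
  shows "weight (S - {j}) (q - 1) (m + bm j) = weight S q m"
  using assms upper_remove_low[OF assms(1-4)] wt_bm[of j] by (auto simp: weight_def wt_add)

lemma weight_remove_high_am:
  assumes "finite S" "j \<in> S" "q < rank S j"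
  shows "weight (S - {j}) q (m + am j) = weight S q m"
proof -
  have "finite (upper S q)" "j \<in> upper S q" using assms by (auto simp: upper_def)
  then show ?thesis
    unfolding weight_def upper_remove_high[OF assms] by (simp add: wt_add sum.remove)
qed

lemma weight_remove_high_bm:
  assumes "finite S" "j \<in> S" "q < rank S j" "0 < q" "S \<subseteq> {..d}"
  shows "weight (S - {j}) (q - 1) (m + bm j) < weight S q m"
proof -
  obtain l where l: "l < j" "l \<in> S" "l \<notin> upper S q" "upper (S - {j}) (q - 1) = insert l (upper S q - {j})"
    using upper_remove_high_shift[OF assms(1-4)] .
  have U: "finite (upper S q)" "j \<in> upper S q" using assms by (auto simp: upper_def)
  have "wt (am l) < wt (am j)" "wt (bm j) = 0" using wt_am[OF l(1)] wt_bm[of j] assms(2,5) by auto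
  then show ?thesis
    unfolding weight_def l(4) using U l(3) by (simp add: wt_add sum.remove)
qed

lemma weight_remove_low_am:
  assumes "finite S" "j \<in> S" "rank S j \<le> q" "q + 2 < card S" "S \<subseteq> {..d}"
  shows "weight (S - {j}) q (m + am j) < weight S q m"
proof -
  obtain u where u: "j < u" "u \<in> upper S q" "upper (S - {j}) q = upper S q - {u}"
    using upper_remove_low_shift[OF assms(1-4)] .
  have U: "finite (upper S q)" using assms by (auto simp: upper_def)
  have "wt (am j) < wt (am u)" using wt_am[OF u(1)] u(2) assms(5) by (auto simp: upper_def)
  then show ?thesis
    unfolding weight_def u(3) using U u(2) by (simp add: wt_add sum.remove)
qed

text \<open>
  Terms of smaller weight are harmless. A term of equal weight other than \<open>lead y\<close> keeps \<open>lo\<close> in its set, and for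
  \<open>q = 0\<close> it also keeps \<open>hi\<close>, so it loses the tie-break.
\<close>

lemma lead_leads_Suc:
  "leads_on (faces (Suc n)) (bd eps :: _ \<Rightarrow> _ \<Rightarrow> ('x, 'k::field) mpoly) potential (tails (Suc (Suc n))) lead"
  unfolding leads_on_def
proof (intro ballI conjI allI impI)
  fix y assume "y \<in> tails (Suc (Suc n))"
  then obtain S q m where y: "y = ((S, q), m)" and yT: "((S, q), m) \<in> tails (Suc (Suc n))"
    by (cases y) (auto simp: tails_def)
  note T = tailsD[OF yT]
  have S: "card S = n + 3" "q \<le> Suc n" using T(1) by (auto simp: faces_def)
  let ?l = "lo m S" and ?h = "hi m S"
  have ld: "?l \<le> d" using T(4,6) by auto
  have hd: "?h \<le> d" if "q = 0" using T(4) T(9)[OF that] by auto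
  have lead: "lead y = (if 0 < q then ((S - {?l}, q - 1), m + bm ?l) else ((S - {?h}, 0), m + am ?h))"
    using S by (simp add: y lead_def)
  have lh: "q = 0 \<Longrightarrow> ?l \<noteq> ?h" using T(8,11) S by auto
  show "fst (lead y) \<in> faces (Suc n)"
    unfolding lead using T(2,4,6,9) S by (auto simp: faces_def)
  show "column_coeff (bd eps :: _ \<Rightarrow> _ \<Rightarrow> ('x, 'k) mpoly) y (lead y) \<noteq> 0"
    unfolding lead using T(2,6,8,9,11) S
    by (auto simp: y column_coeff_at bd_remove drop_coeff_def signed_mult)
  have "Bs m \<union> S = insert ?l (Bs m) \<union> (S - {?l})" using T(6) by auto
  then have lo_b: "lo (m + bm ?l) (S - {?l}) = ?l" using ld by (simp add: lo_def Bs_add_bm)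
  have keyl: "0 < q \<Longrightarrow> potential (lead y) \<ge> 4 * weight S q m + 2" 
    using weight_remove_low_bm[OF T(2,6) _ _ T(4), of q m] T(8)
    by (simp add: lead potential_def lo_b)
  have hi_a: "hi (m + am ?h) (S - {?h}) = ?h" if "q = 0"
  proof -
    have "As m \<union> S = insert ?h (As m) \<union> (S - {?h})" using T(9)[OF that] by auto
    then show ?thesis using hd[OF that] by (simp add: hi_def As_add_am)
  qed
  have keyh: "potential (lead y) \<ge> 4 * weight S q m + 1" if "q = 0"
    using weight_remove_high_am[OF T(2) T(9)[OF that], of q m] T(11)[OF that] S that
    by (simp add: lead potential_def hi_a)
  fix x assume x: "fst x \<in> faces (Suc n)" "column_coeff (bd eps :: _ \<Rightarrow> _ \<Rightarrow> ('x, 'k) mpoly) y x \<noteq> 0" "x \<noteq> lead y"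
  obtain S' q' m' where xe: "x = ((S', q'), m')" by (metis surj_pair)
  obtain m0 where m0: "m0 \<in> keys (bd eps (S', q') (S, q) :: ('x, 'k) mpoly)" "m' = m + m0"
    using column_coeff_keys[OF x(2)] by (auto simp: xe y)
  have le: "4 * weight S q m \<le> potential (lead y)" using keyl keyh by (cases "q = 0") auto
  have small: "potential x < potential (lead y)" if "weight S' q' m' < weight S q m"
    using that le by (auto simp: xe potential_def)
  have "card S \<noteq> 2" using S(1) by simp
  with m0(1) show "potential x < potential (lead y)"
  proof (cases rule: keys_bd_drop)
    case (b j)
    have jd: "j \<le> d" using b(1) T(4) by auto
    show ?thesis
    proof (cases "rank S j \<le> q")
      case True
      have "j \<noteq> ?l" using x(3) b m0(2) by (auto simp: xe lead)
      have "insert j (Bs m) \<union> (S - {j}) = Bs m \<union> S" using b(1) by auto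
      then have "lo m' S' = ?l"
        using jd by (simp add: b m0(2) lo_def Bs_add_bm)
      then have "potential x \<le> 4 * weight S q m + 1"
        using weight_remove_low_bm[OF T(2) b(1) True b(3) T(4), of m] T(6) \<open>j \<noteq> ?l\<close>
        by (simp add: xe potential_def b m0(2))
      then show ?thesis using keyl[OF b(3)] by simp
    next
      case False
      then show ?thesis
        using weight_remove_high_bm[OF T(2) b(1) _ b(3) T(4), of m] by (intro small) (simp add: b m0(2))
    qed
  next
    case (a j)
    have jd: "j \<le> d" using a(1) T(4) by auto
    show ?thesis
    proof (cases "rank S j \<le> q")
      case True
      then show ?thesis
        using weight_remove_low_am[OF T(2) a(1) True a(3) T(4), of m] by (intro small) (simp add: a m0(2))
    next
      case False
      then have jl: "j \<noteq> ?l" using T(8) by auto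
      have lo: "lo m' S' = ?l"
      proof -
        have "Min (Bs m \<union> (S - {j})) = ?l"
          using T(2,6) jl by (intro Min_eqI) (auto simp: lo_def)
        then show ?thesis using jd by (simp add: a m0(2) lo_def Bs_add_am)
      qed
      have w: "weight S' q' m' = weight S q m"
        using weight_remove_high_am[OF T(2) a(1), of q m] False by (simp add: a m0(2))
      show ?thesis
      proof (cases "q = 0")
        case True
        have "j \<noteq> ?h" using x(3) a m0(2) True by (auto simp: xe lead)
        have "insert j (As m) \<union> (S - {j}) = As m \<union> S" using a(1) by auto
        then have "hi m' S' = ?h"
          using jd by (simp add: a m0(2) hi_def As_add_am)
        with \<open>j \<noteq> ?h\<close> have "potential x \<le> 4 * weight S q m"
          using w lo T(6) T(9)[OF True] jl a(2) by (simp add: xe potential_def)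
        then show ?thesis using keyh[OF True] by simp
      next
        case False
        have "potential x \<le> 4 * weight S q m + 1"
          using w lo T(6) jl a(2) by (simp add: xe potential_def)
        then show ?thesis using keyl False by simp
      qed
    qed
  qed
qed

lemma lead_leads_0:
  "leads_on (faces 0) (bd eps :: _ \<Rightarrow> _ \<Rightarrow> ('x, 'k::field) mpoly) potential (tails (Suc 0)) lead"
  unfolding leads_on_def
proof (intro ballI conjI allI impI)
  fix y assume "y \<in> tails (Suc 0)"
  then obtain S q m where y: "y = ((S, q), m)" and yT: "((S, q), m) \<in> tails (Suc 0)"
    by (cases y) (auto simp: tails_def)
  note T = tailsD[OF yT]
  have S: "card S = 2" "q = 0" using T(1) by (auto simp: faces_def)
  obtain i j where ij: "i < j" "j \<le> d" "S = {i, j}" "Min S = i" "Max S = j"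
    using face_MinMax[OF T(1)] S by auto
  have lo: "lo m S = i" "hi m S = j" using T(7) T(10)[OF S(2)] ij by auto
  have lead: "lead y = (({}, 0), m + (bm i + am j))" using S by (simp add: y lead_def lo)
  have wlt: "wt (am i + bm j) < wt (bm i + am j)" using wt_am[OF ij(1,2)] ij by (simp add: wt_add wt_bm)
  then have ne: "am i + bm j \<noteq> bm i + am j" by auto
  show "fst (lead y) \<in> faces 0" by (simp add: lead faces_def)
  show "column_coeff (bd eps :: _ \<Rightarrow> _ \<Rightarrow> ('x, 'k) mpoly) y (lead y) \<noteq> 0"
    unfolding lead unfolding y column_coeff_at using ij ne
    by (simp add: bd_two minor_def lookup_minus lookup_single when_def)
  fix x assume x: "fst x \<in> faces 0" "column_coeff (bd eps :: _ \<Rightarrow> _ \<Rightarrow> ('x, 'k) mpoly) y x \<noteq> 0" "x \<noteq> lead y"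
  obtain S' q' m' where xe: "x = ((S', q'), m')" by (metis surj_pair)
  have S': "S' = {}" "q' = 0" using x(1) by (auto simp: xe faces_def)
  obtain m0 where m0: "m0 \<in> keys (bd eps (S', q') (S, q) :: ('x, 'k) mpoly)" "m' = m + m0"
    using column_coeff_keys[OF x(2)] by (auto simp: xe y)
  have "m0 \<in> keys (minor eps i j :: ('x, 'k) mpoly)" using m0(1) ij by (simp add: bd_two S')
  then have "m0 = bm i + am j \<or> m0 = am i + bm j" using keys_minor[where 'k = 'k, of eps i j] by (auto split: if_splits)
  then have "m0 = am i + bm j" using x(3) m0(2) by (auto simp: xe lead S')
  then show "potential x < potential (lead y)"
    using wlt by (simp add: xe lead potential_def S' m0(2) weight_def upper_def wt_add)
qed

lemma lead_leads:
  "leads_on (faces n) (bd eps :: _ \<Rightarrow> _ \<Rightarrow> ('x, 'k::field) mpoly) potential (tails (Suc n)) lead"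
  using lead_leads_0 lead_leads_Suc by (cases n) auto

lemma inj_on_lead: "inj_on lead (tails (Suc n))"
proof (cases n)
  case 0
  have "S = {Min (Bs M), Max (As M)} \<and> q = 0 \<and> lead ((S, q), m) = (({}, 0), m + (bm (Min (Bs M)) + am (Max (As M))))"
    if yT: "((S, q), m) \<in> tails (Suc 0)" and M: "M = snd (lead ((S, q), m))" for S q m M
  proof -
    note T = tailsD[OF yT]
    have S: "card S = 2" "q = 0" using T(1) by (auto simp: faces_def)
    obtain i j where ij: "i < j" "j \<le> d" "S = {i, j}" "Min S = i" "Max S = j"
      using face_MinMax[OF T(1)] S by auto
    have lo: "lo m S = i" "hi m S = j" using T(7) T(10)[OF S(2)] ij by auto
    have lead: "lead ((S, q), m) = (({}, 0), m + (bm i + am j))" using S by (simp add: lead_def lo)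
    have M: "M = m + bm i + am j" using M by (simp add: lead add.assoc)
    have "Bs M = insert i (Bs m)" "As M = insert j (As m)"
      using ij by (simp_all add: M Bs_add_bm Bs_add_am As_add_am As_add_bm)
    moreover have "Min (insert i (Bs m)) = i" using lo_le[OF T(2), of _ m] lo(1) by (intro Min_eqI) auto
    moreover have "Max (insert j (As m)) = j" using hi_ge[OF T(2), of _ m] lo(2) by (intro Max_eqI) auto
    ultimately show ?thesis using lead S ij by simp
  qed
  note * = this
  have "y = y'" if "y \<in> tails (Suc 0)" "y' \<in> tails (Suc 0)" "lead y = lead y'" for y y'
  proof -
    obtain S q m S' q' m' where y: "y = ((S, q), m)" "y' = ((S', q'), m')" by (metis surj_pair)
    define M where "M = snd (lead ((S, q), m))"
    have 1: "S = {Min (Bs M), Max (As M)} \<and> q = 0 \<and>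
        lead y = (({}, 0), m + (bm (Min (Bs M)) + am (Max (As M))))"
      using *[of S q m M] that(1) by (simp only: y M_def)
    have M': "M = snd (lead ((S', q'), m'))" using that(3) by (simp add: y M_def)
    have 2: "S' = {Min (Bs M), Max (As M)} \<and> q' = 0 \<and>
        lead y' = (({}, 0), m' + (bm (Min (Bs M)) + am (Max (As M))))"
      using *[OF that(2)[unfolded y(2)] M'] unfolding y(2) .
    have "m = m'" using 1 2 that(3) by (metis add_right_cancel snd_conv)
    then show ?thesis using 1 2 y by simp
  qed
  then show ?thesis unfolding 0 by (rule inj_onI)
next
  case (Suc n')
  \<comment> \<open>A left inverse: \<open>lo\<close> tells which of the two indices has been moved.\<close>
  define pull where "pull = (\<lambda>((S, q :: nat), m). if lo m S \<notin> S
    then ((insert (lo m S) S, q + 1), m - bm (lo m S)) else ((insert (hi m S) S, 0), m - am (hi m S)))"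
  have "pull (lead y) = y" if "y \<in> tails (Suc (Suc n'))" for y
  proof -
    obtain S q m where y: "y = ((S, q), m)" by (metis surj_pair)
    have yT: "((S, q), m) \<in> tails (Suc (Suc n'))" using that y by simp
    note T = tailsD[OF yT]
    have S: "card S = n' + 3" "q \<le> Suc n'" using T(1) by (auto simp: faces_def)
    let ?l = "lo m S" and ?h = "hi m S"
    have ld: "?l \<le> d" using T(4,6) by auto
    show ?thesis
    proof (cases "q = 0")
      case False
      have "Bs m \<union> S = insert ?l (Bs m) \<union> (S - {?l})" using T(6) by auto
      then have "lo (m + bm ?l) (S - {?l}) = ?l" using ld by (simp add: lo_def Bs_add_bm)
      then show ?thesis using False S T(6) by (auto simp: y lead_def pull_def)
    next
      case True
      note h = T(9)[OF True]
      have lh: "?l \<noteq> ?h" using T(8) T(11)[OF True] S by auto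
      have hd: "?h \<le> d" using h T(4) by auto
      have "Min (Bs m \<union> (S - {?h})) = ?l" using T(2,6) lh by (intro Min_eqI) (auto simp: lo_def)
      then have lo: "lo (m + am ?h) (S - {?h}) = ?l" using hd by (simp add: lo_def Bs_add_am)
      have "As m \<union> S = insert ?h (As m) \<union> (S - {?h})" using h by auto
      then have "hi (m + am ?h) (S - {?h}) = ?h" using hd by (simp add: hi_def As_add_am)
      then show ?thesis using True S T(6) h lh lo by (auto simp: y lead_def pull_def)
    qed
  qed
  then show ?thesis unfolding Suc by (rule inj_on_inverseI)
qed

text \<open>
  The set of the tail consists of the smallest index whose entry \<open>bm\<close> divides \<open>m\<close> and the largest one whose
  entry \<open>am\<close> does. These are distinct because of \<open>i < j\<close>.
\<close>

lemma lead_covers_0: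
  assumes "keys m \<subseteq> X" "i < j" "j \<le> d" "mdvd (bm i) m" "mdvd (am j) m"
  shows "(({}, 0), m) \<in> lead ` tails (Suc 0)"
proof -
  define l h where "l = Min (Bs m)" and "h = Max (As m)"
  have i: "i \<in> Bs m" and j: "j \<in> As m" using assms by (auto simp: Bs_def As_def)
  have lh: "l < h" using Min_le[OF finite_Bs i] Max_ge[OF finite_As j] assms(2) by (simp add: l_def h_def)
  have l: "l \<in> Bs m" and h: "h \<in> As m" using Min_in[OF finite_Bs, of m] Max_in[OF finite_As, of m] i j unfolding l_def h_def by blast+
  have ld: "l \<le> d" "mdvd (bm l) m" and hd: "h \<le> d" "mdvd (am h) m" using l h by (auto simp: Bs_def As_def)
  define m1 where "m1 = m - am h"
  have m1: "m = m1 + am h" using mdvd_diff_add[OF hd(2)] by (simp add: m1_def)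
  have "mdvd (bm l) m1" using mdvd_coprime_add[of "bm l" "am h" m1] am_bm[OF hd(1) ld(1)] ld(2) m1 by (auto simp: Int_commute)
  define m2 where "m2 = m1 - bm l"
  have m2: "m1 = m2 + bm l" using mdvd_diff_add[OF \<open>mdvd (bm l) m1\<close>] by (simp add: m2_def)
  have min: "l \<le> x" if "x \<in> Bs m" for x
    unfolding l_def by (rule Min_le[OF finite_Bs that])
  have max: "x \<le> h" if "x \<in> As m" for x
    unfolding h_def by (rule Max_ge[OF finite_As that])
  have AsE: "As m = insert h (As m2)" and BsE: "Bs m = insert l (Bs m2)"
    using ld hd by (simp_all add: m1 m2 Bs_add_bm Bs_add_am As_add_am As_add_bm)
  have lo: "lo m2 {l, h} = l"
    unfolding lo_def
  proof (rule Min_eqI)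
    fix x assume "x \<in> Bs m2 \<union> {l, h}"
    then have "x \<in> Bs m \<or> x = h" using BsE by blast
    then show "l \<le> x" using min lh by auto
  qed auto
  have hi: "hi m2 {l, h} = h"
    unfolding hi_def
  proof (rule Max_eqI)
    fix x assume "x \<in> As m2 \<union> {l, h}"
    then have "x \<in> As m \<or> x = l" using AsE by blast
    then show "x \<le> h" using max lh by auto
  qed auto
  have "keys m2 \<subseteq> X"
    using assms(1) keys_diff_nat[of m "am h"] keys_diff_nat[of m1 "bm l"] by (auto simp: m2_def m1_def)
  then have "(({l, h}, 0), m2) \<in> tails (Suc 0)"
    using lh ld hd lo hi by (auto simp: tails_def faces_def)
  moreover have "lead (({l, h}, 0), m2) = (({}, 0), m)"
    using lh by (simp add: lead_def lo hi m1 m2 add.assoc)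
  ultimately show ?thesis by (metis image_eqI)
qed

text \<open>
  If \<open>lo\<close> is not in \<open>S\<close>, then moving it from the monomial into \<open>S\<close> gives a tail with this partner. If \<open>lo\<close> is the
  only lower element of \<open>S\<close> and \<open>hi\<close> is not in \<open>S\<close>, then moving \<open>hi\<close> does.
\<close>

lemma lead_covers_Suc:
  assumes \<tau>: "\<tau> \<in> faces (Suc n)" and m: "keys m \<subseteq> X"
  shows "(\<tau>, m) \<in> tails (Suc n) \<union> lead ` tails (Suc (Suc n))"
proof -
  obtain S q where \<tau>_eq: "\<tau> = (S, q)" by fastforce
  have S: "S \<subseteq> {..d}" "card S = n + 2" "q \<le> n" using \<tau> by (auto simp: faces_def \<tau>_eq)
  have fin: "finite S" and ne: "S \<noteq> {}" using finite_face \<tau> \<tau>_eq S by auto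
  let ?l = "lo m S" and ?h = "hi m S"
  have l: "?l \<in> Bs m \<union> S" unfolding lo_def using fin ne by (intro Min_in) auto
  have h: "?h \<in> As m \<union> S" unfolding hi_def using fin ne by (intro Max_in) auto
  consider (l) "?l \<notin> S" | (h) "?l \<in> S" "q = 0" "?h \<notin> S" | (t) "?l \<in> S" "0 < q \<or> ?h \<in> S" by auto
  then show ?thesis
  proof cases
    case l
    then have lB: "?l \<le> d" "mdvd (bm ?l) m" using \<open>?l \<in> Bs m \<union> S\<close> by (auto simp: Bs_def)
    define m' where "m' = m - bm ?l"
    have m': "m = m' + bm ?l" using mdvd_diff_add[OF lB(2)] by (simp add: m'_def)
    have "Bs m = insert ?l (Bs m')" using lB(1) Bs_add_bm[of ?l m'] m' by simp
    then have lo: "lo m' (insert ?l S) = ?l" by (metis Un_insert_left Un_insert_right lo_def)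
    have "keys m' \<subseteq> X" using m keys_diff_nat by (fastforce simp: m'_def)
    then have "((insert ?l S, q + 1), m') \<in> tails (Suc (Suc n))"
      using S fin l lB lo by (auto simp: tails_def faces_def)
    moreover have "lead ((insert ?l S, q + 1), m') = (\<tau>, m)"
      using S fin l lo m' by (simp add: lead_def \<tau>_eq)
    ultimately show ?thesis by (metis UnI2 image_eqI)
  next
    case h
    then have hA: "?h \<le> d" "mdvd (am ?h) m" using \<open>?h \<in> As m \<union> S\<close> by (auto simp: As_def)
    define m' where "m' = m - am ?h"
    have m': "m = m' + am ?h" using mdvd_diff_add[OF hA(2)] by (simp add: m'_def)
    have As: "As m = insert ?h (As m')" using hA(1) As_add_am[of ?h m'] m' by simp
    have Bs: "Bs m = Bs m'" using hA(1) Bs_add_am[of ?h m'] m' by simp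
    have hi: "hi m' (insert ?h S) = ?h" using As by (metis Un_insert_left Un_insert_right hi_def)
    have "?l \<le> ?h"
    proof -
      have "?l \<le> Min S" "Max S \<le> ?h" unfolding lo_def hi_def using fin ne by (auto intro!: Min_antimono Max_mono)
      then show ?thesis using Min_le[OF fin Max_in[OF fin ne]] by simp
    qed
    then have lo: "lo m' (insert ?h S) = ?l"
      using fin h(1) unfolding lo_def[of m'] Bs[symmetric]
      by (intro Min_eqI) (auto simp: lo_def)
    have "keys m' \<subseteq> X" using m keys_diff_nat by (fastforce simp: m'_def)
    then have "((insert ?h S, 0), m') \<in> tails (Suc (Suc n))"
      using S fin h hA hi lo by (auto simp: tails_def faces_def)
    moreover have "lead ((insert ?h S, 0), m') = (\<tau>, m)"
      using S fin h hi m' by (simp add: lead_def \<tau>_eq)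
    ultimately show ?thesis by (metis UnI2 image_eqI)
  next
    case t
    then show ?thesis using \<tau> m ne by (auto simp: tails_def \<tau>_eq)
  qed
qed

lemma tails_face: "y \<in> tails n \<Longrightarrow> fst y \<in> faces n \<and> keys (snd y) \<subseteq> X"
  by (auto simp: tails_def)

section \<open>The minimal resolution\<close>

text \<open>
  An arbitrary enumeration of the faces turns families indexed by faces into vectors and matrices; \<open>chain\<close> and
  \<open>coord\<close> below translate between the two.
\<close>

definition face_list :: "nat \<Rightarrow> face list" where
  "face_list n = (SOME xs. set xs = faces n \<and> distinct xs)"

lemma face_list: "set (face_list n) = faces n" "distinct (face_list n)"
proof -
  have "\<exists>xs. set xs = faces n \<and> distinct xs"
    using finite_distinct_list[OF finite_faces] by blast
  then have "set (face_list n) = faces n \<and> distinct (face_list n)"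
    unfolding face_list_def by (rule someI_ex)
  then show "set (face_list n) = faces n" "distinct (face_list n)" by auto
qed

lemma face_list_nth: "q < length (face_list n) \<Longrightarrow> face_list n ! q \<in> faces n"
  using face_list(1) nth_mem by blast

lemma face_list_bij: "bij_betw ((!) (face_list n)) {..<length (face_list n)} (faces n)"
  by (rule bij_betw_nth[OF face_list(2)]) (simp_all add: face_list)

definition coord :: "nat \<Rightarrow> 'a vec \<Rightarrow> face \<Rightarrow> 'a" where
  "coord n v \<tau> = v $ inv_into {..<length (face_list n)} ((!) (face_list n)) \<tau>"

lemma coord_nth: "q < length (face_list n) \<Longrightarrow> coord n v (face_list n ! q) = v $ q"
  using inv_into_f_f[OF bij_betw_imp_inj_on[OF face_list_bij], of q n] by (simp add: coord_def)

lemma ball_faces: "(\<forall>\<tau> \<in> faces n. P \<tau>) \<longleftrightarrow> (\<forall>q < length (face_list n). P (face_list n ! q))"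
  by (metis face_list(1) in_set_conv_nth)

abbreviation chains :: "nat \<Rightarrow> ('x, 'k::field) mpoly vec set" where
  "chains n \<equiv> free_module X (length (face_list n))"

lemma coord_polys: "v \<in> chains n \<Longrightarrow> \<tau> \<in> faces n \<Longrightarrow> coord n v \<tau> \<in> polys X"
  using ball_faces[of n "\<lambda>\<tau>. coord n v \<tau> \<in> polys X"] by (simp add: coord_nth free_module_def)

lemma sum_faces: "(\<Sum>\<tau>\<in>faces n. g \<tau>) = (\<Sum>q<length (face_list n). g (face_list n ! q))"
  by (rule sum.reindex_bij_betw[OF face_list_bij, symmetric])

definition chain :: "nat \<Rightarrow> (face \<Rightarrow> 'a) \<Rightarrow> 'a vec" where
  "chain n c = vec (length (face_list n)) (\<lambda>q. c (face_list n ! q))"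

lemma chain_free: "(\<And>\<tau>. \<tau> \<in> faces n \<Longrightarrow> c \<tau> \<in> polys X) \<Longrightarrow> chain n c \<in> chains n"
  by (auto simp: chain_def free_module_def face_list_nth)

lemma coord_chain: "\<tau> \<in> faces n \<Longrightarrow> coord n (chain n c) \<tau> = c \<tau>"
  using ball_faces[of n "\<lambda>\<tau>. coord n (chain n c) \<tau> = c \<tau>"] by (simp add: coord_nth chain_def)

definition bd_mat :: "bool \<Rightarrow> nat \<Rightarrow> ('x, 'k::field) mpoly mat" where
  "bd_mat eps n = mat (length (face_list n)) (length (face_list (Suc n)))
     (\<lambda>(p, q). bd eps (face_list n ! p) (face_list (Suc n) ! q))"

lemma bd_mat_carrier: "bd_mat eps n \<in> carrier_mat (length (face_list n)) (length (face_list (Suc n)))"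
  by (simp add: bd_mat_def)

lemma bd_mat_mult:
  fixes v :: "('x, 'k::field) mpoly vec"
  assumes "v \<in> chains (Suc n)"
  shows "bd_mat eps n *\<^sub>v v = chain n (\<lambda>\<sigma>. \<Sum>\<tau>\<in>faces (Suc n). bd eps \<sigma> \<tau> * coord (Suc n) v \<tau>)"
proof (rule eq_vecI)
  fix p assume "p < dim_vec (chain n (\<lambda>\<sigma>. \<Sum>\<tau>\<in>faces (Suc n). bd eps \<sigma> \<tau> * coord (Suc n) v \<tau>))"
  then have p: "p < length (face_list n)" by (simp add: chain_def)
  then show "(bd_mat eps n *\<^sub>v v) $ p = chain n (\<lambda>\<sigma>. \<Sum>\<tau>\<in>faces (Suc n). bd eps \<sigma> \<tau> * coord (Suc n) v \<tau>) $ p"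
    unfolding mat_mult_vec_nth[OF bd_mat_carrier free_moduleD(1)[OF assms] p]
    by (simp add: chain_def sum_faces bd_mat_def coord_nth)
qed (simp_all add: chain_def bd_mat_def)

lemma bd_bd: "\<sigma> \<in> faces n \<Longrightarrow> \<rho> \<in> faces (Suc (Suc n)) \<Longrightarrow>
  (\<Sum>\<tau>\<in>faces (Suc n). bd eps \<sigma> \<tau> * bd eps \<tau> \<rho>) = (0 :: ('x, 'k::field) mpoly)"
  using bd_bd_0[of \<rho> eps] bd_bd_Suc[of \<sigma> _ \<rho> eps] by (cases n) (auto simp: faces_def[of 0])

lemma kernel_bd_mat:
  "{v \<in> chains (Suc n). (bd_mat eps n :: ('x, 'k::field) mpoly mat) *\<^sub>v v = 0\<^sub>v (length (face_list n))} =
    (\<lambda>v. bd_mat eps (Suc n) *\<^sub>v v) ` chains (Suc (Suc n))"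
  (is "?K = ?J")
proof
  have zero: "chain n c = 0\<^sub>v (length (face_list n)) \<longleftrightarrow> (\<forall>\<sigma>\<in>faces n. c \<sigma> = 0)"
    for c :: "_ \<Rightarrow> ('x, 'k) mpoly"
    unfolding ball_faces by (auto simp: chain_def vec_eq_iff)
  show "?K \<subseteq> ?J"
  proof
    fix v :: "('x, 'k) mpoly vec" assume "v \<in> ?K"
    then have v: "v \<in> chains (Suc n)"
      and 0: "\<And>\<sigma>. \<sigma> \<in> faces n \<Longrightarrow> (\<Sum>\<tau>\<in>faces (Suc n). bd eps \<sigma> \<tau> * coord (Suc n) v \<tau>) = 0"
      using zero by (auto simp: bd_mat_mult)
    obtain c' where c': "\<And>\<rho>. \<rho> \<in> faces (Suc (Suc n)) \<Longrightarrow> c' \<rho> \<in> polys X"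
      "\<And>\<tau>. \<tau> \<in> faces (Suc n) \<Longrightarrow> coord (Suc n) v \<tau> = (\<Sum>\<rho>\<in>faces (Suc (Suc n)). bd eps \<tau> \<rho> * c' \<rho>)"
    proof (rule triangular_exact[OF finite_faces[of "Suc n"] finite_faces[of "Suc (Suc n)"]
          lead_leads[of n eps] inj_on_lead lead_leads[of "Suc n" eps], where X = X and c = "coord (Suc n) v"])
    qed (use that lead_covers_Suc bd_polys bd_bd coord_polys[OF v] 0 in \<open>auto simp: tails_def\<close>)
    have "bd_mat eps (Suc n) *\<^sub>v chain (Suc (Suc n)) c' = v"
    proof (rule eq_vecI)
      show "dim_vec (bd_mat eps (Suc n) *\<^sub>v chain (Suc (Suc n)) c') = dim_vec v"
        using free_moduleD(1)[OF v] by (simp add: bd_mat_def)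
      fix q assume "q < dim_vec v"
      then have q: "q < length (face_list (Suc n))" using free_moduleD(1)[OF v] by simp
      show "(bd_mat eps (Suc n) *\<^sub>v chain (Suc (Suc n)) c') $ q = v $ q"
        using q c'(2)[OF face_list_nth[OF q]]
        by (simp add: bd_mat_mult[OF chain_free[OF c'(1)]] coord_chain coord_nth) (simp add: chain_def coord_chain)
    qed
    moreover have "chain (Suc (Suc n)) c' \<in> chains (Suc (Suc n))"
      by (rule chain_free) (rule c'(1))
    ultimately show "v \<in> ?J" by blast
  qed
  show "?J \<subseteq> ?K"
  proof
    fix v :: "('x, 'k) mpoly vec" assume "v \<in> ?J"
    then obtain w where w: "w \<in> chains (Suc (Suc n))" "v = bd_mat eps (Suc n) *\<^sub>v w" by blast
    define b where "b \<tau> = (\<Sum>\<rho>\<in>faces (Suc (Suc n)). bd eps \<tau> \<rho> * coord (Suc (Suc n)) w \<rho>)" for \<tau>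
    have v_eq: "v = chain (Suc n) b" unfolding w(2) bd_mat_mult[OF w(1)] b_def ..
    have v: "v \<in> chains (Suc n)"
      unfolding v_eq b_def by (rule chain_free) (intro polys_sum polys_mult bd_polys coord_polys[OF w(1)])
    have "(\<Sum>\<tau>\<in>faces (Suc n). bd eps \<sigma> \<tau> * coord (Suc n) v \<tau>) = 0" if \<sigma>: "\<sigma> \<in> faces n" for \<sigma>
    proof -
      have "(\<Sum>\<tau>\<in>faces (Suc n). bd eps \<sigma> \<tau> * coord (Suc n) v \<tau>) = (\<Sum>\<tau>\<in>faces (Suc n). bd eps \<sigma> \<tau> * b \<tau>)"
        by (simp add: v_eq coord_chain)
      also have "\<dots> = (\<Sum>\<rho>\<in>faces (Suc (Suc n)). (\<Sum>\<tau>\<in>faces (Suc n). bd eps \<sigma> \<tau> * bd eps \<tau> \<rho>) * coord (Suc (Suc n)) w \<rho>)"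
        unfolding b_def sum_distrib_left sum_distrib_right mult.assoc by (rule sum.swap)
      also have "\<dots> = 0" by (simp add: bd_bd[OF \<sigma>])
      finally show ?thesis .
    qed
    then show "v \<in> ?K" using v zero by (simp add: bd_mat_mult)
  qed
qed

definition shifts :: "nat \<Rightarrow> int list" where
  "shifts i = map shift (face_list (Suc i))"

text \<open>
  The last hypothesis says that an element of \<open>I\<close> none of whose monomials lies in the ideal of leading terms is
  zero, so that the minors (or their leading terms) form a Groebner basis of \<open>I\<close>. Division by
  them shows that they generate \<open>I\<close>. The resolution is minimal because the entries of the matrix are
  monomials other than \<open>1\<close>, so no coefficient of \<open>bd\<close> has a constant term.
\<close>

theorem minimal_resolution:
  fixes I :: "('x, 'k::field) mpoly set"
  assumes I_polys: "I \<subseteq> polys X" and I_0: "0 \<in> I"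
    and I_add: "\<And>p q. p \<in> I \<Longrightarrow> q \<in> I \<Longrightarrow> p + q \<in> I"
    and I_minus: "\<And>p q. p \<in> I \<Longrightarrow> q \<in> I \<Longrightarrow> p - q \<in> I"
    and I_minor: "\<And>i j p. i < j \<Longrightarrow> j \<le> d \<Longrightarrow> p \<in> polys X \<Longrightarrow> minor eps i j * p \<in> I"
    and std: "\<And>p. p \<in> I \<Longrightarrow> (\<And>m i j. m \<in> keys p \<Longrightarrow> i < j \<Longrightarrow> j \<le> d \<Longrightarrow> mdvd (bm i) m \<Longrightarrow> \<not> mdvd (am j) m)
      \<Longrightarrow> p = 0"
  shows "\<exists>f A. minimal_graded_free_resolution X I shifts f A"
proof -
  let ?f = "chain (Suc 0) (bd eps ({}, 0)) :: ('x, 'k) mpoly vec"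
  let ?A = "\<lambda>i. bd_mat eps (Suc i) :: ('x, 'k) mpoly mat"
  have f: "?f \<bullet> v = (\<Sum>\<tau>\<in>faces (Suc 0). bd eps ({}, 0) \<tau> * coord (Suc 0) v \<tau>)"
    if "v \<in> chains (Suc 0)" for v
    using free_moduleD(1)[OF that]
    by (auto simp: scalar_prod_def sum_faces chain_def coord_nth atLeast0LessThan)
  have len0: "face_list 0 = [({}, 0)]"
  proof -
    have "set (face_list 0) = {({}, 0)}" "length (face_list 0) = 1"
      using face_list[of 0] distinct_card[of "face_list 0"] by (auto simp: faces_def)
    then show ?thesis by (cases "face_list 0") auto
  qed
  have ker0: "{v \<in> chains (Suc 0). ?f \<bullet> v = 0} =
      {v \<in> chains (Suc 0). bd_mat eps 0 *\<^sub>v v = 0\<^sub>v (length (face_list 0))}"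
  proof -
    have "bd_mat eps 0 *\<^sub>v v = 0\<^sub>v (length (face_list 0)) \<longleftrightarrow> ?f \<bullet> v = 0"
      if "v \<in> chains (Suc 0)" for v
      unfolding f[OF that] bd_mat_mult[OF that] by (simp add: chain_def len0 vec_eq_iff)
    then show ?thesis by blast
  qed
  have image: "(\<lambda>v. ?f \<bullet> v) ` chains (Suc 0) = I"
  proof
    have minor_I: "bd eps ({}, 0) \<tau> * p \<in> I" if \<tau>: "\<tau> \<in> faces (Suc 0)" and p: "p \<in> polys X" for \<tau> p
    proof -
      have "card (fst \<tau>) = 2" using \<tau> by (auto simp: faces_def)
      then obtain i j where "i < j" "j \<le> d" "fst \<tau> = {i, j}" "Min (fst \<tau>) = i" "Max (fst \<tau>) = j"
        using face_MinMax[OF \<tau>] by metis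
      then show ?thesis using I_minor p \<open>card (fst \<tau>) = 2\<close> by (simp add: bd_def)
    qed
    have sum_I: "(\<Sum>\<tau>\<in>faces (Suc 0). bd eps ({}, 0) \<tau> * c \<tau>) \<in> I"
      if "\<And>\<tau>. \<tau> \<in> faces (Suc 0) \<Longrightarrow> c \<tau> \<in> polys X" for c
    proof -
      have "(\<Sum>\<tau>\<in>F. bd eps ({}, 0) \<tau> * c \<tau>) \<in> I" if "F \<subseteq> faces (Suc 0)" "finite F" for F
        using that(2,1) by (induction F) (auto simp: I_0 I_add minor_I \<open>\<And>\<tau>. \<tau> \<in> faces (Suc 0) \<Longrightarrow> c \<tau> \<in> polys X\<close>)
      then show ?thesis using finite_faces by blast
    qed
    show "(\<lambda>v. ?f \<bullet> v) ` chains (Suc 0) \<subseteq> I"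
    proof (rule image_subsetI)
      fix v :: "('x, 'k) mpoly vec" assume v: "v \<in> chains (Suc 0)"
      show "?f \<bullet> v \<in> I" unfolding f[OF v] by (rule sum_I) (rule coord_polys[OF v])
    qed
    show "I \<subseteq> (\<lambda>v. ?f \<bullet> v) ` chains (Suc 0)"
    proof
      fix p assume p: "p \<in> I"
      obtain c' where c': "\<And>\<tau>. \<tau> \<in> faces (Suc 0) \<Longrightarrow> c' \<tau> \<in> polys X"
        "\<And>\<sigma> m. (\<sigma>, m) \<in> lead ` tails (Suc 0) \<Longrightarrow>
           lookup (p - (\<Sum>\<tau>\<in>faces (Suc 0). bd eps \<sigma> \<tau> * c' \<tau>)) m = 0"
        using triangular_reduction[OF finite_faces[of 0] finite_faces[of "Suc 0"] lead_leads[of 0 eps]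
            tails_face order_refl, where c = "\<lambda>_. p"] by blast
      let ?e = "p - (\<Sum>\<tau>\<in>faces (Suc 0). bd eps ({}, 0) \<tau> * c' \<tau>)"
      have eI: "?e \<in> I" by (rule I_minus[OF p sum_I[OF c'(1)]])
      have "?e = 0"
      proof (rule std[OF eI])
        fix m i j assume m: "m \<in> keys ?e" and ij: "i < j" "j \<le> d" "mdvd (bm i) m"
        have "keys m \<subseteq> X" using subsetD[OF I_polys eI] m unfolding polys_iff by blast
        then show "\<not> mdvd (am j) m"
          using lead_covers_0[OF _ ij] c'(2)[of "({}, 0)" m] m by (auto simp: in_keys_iff)
      qed
      then have "p = (\<Sum>\<tau>\<in>faces (Suc 0). bd eps ({}, 0) \<tau> * c' \<tau>)" by simp
      have cf: "chain (Suc 0) c' \<in> chains (Suc 0)"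
        by (rule chain_free) (rule c'(1))
      have "p = ?f \<bullet> chain (Suc 0) c'"
        using \<open>p = _\<close> by (simp add: f[OF cf] coord_chain)
      then show "p \<in> (\<lambda>v. ?f \<bullet> v) ` chains (Suc 0)"
        using cf by blast
    qed
  qed
  have hom0: "homogeneous (shift \<tau>) (bd eps ({}, 0) \<tau> :: ('x, 'k) mpoly)" if "\<tau> \<in> faces (Suc 0)" for \<tau>
    using bd_homogeneous[OF that, of "({}, 0)" eps] by (simp add: shift_def)
  have "graded_free_resolution X I shifts ?f ?A"
    unfolding graded_free_resolution_def shifts_def length_map
  proof (intro conjI allI impI)
    show "?f \<in> chains (Suc 0)"
      by (rule chain_free) (rule bd_polys)
    show "homogeneous (map shift (face_list (Suc 0)) ! q) (?f $ q)"
      if "q < length (face_list (Suc 0))" for q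
      using that hom0[OF face_list_nth[OF that]] by (simp add: chain_def)
    show "?A i \<in> carrier_mat (length (face_list (Suc i))) (length (face_list (Suc (Suc i))))" for i
      by (rule bd_mat_carrier)
    show "?A i $$ (p, q) \<in> polys X"
      "homogeneous (map shift (face_list (Suc (Suc i))) ! q - map shift (face_list (Suc i)) ! p) (?A i $$ (p, q))"
      if "p < length (face_list (Suc i))" "q < length (face_list (Suc (Suc i)))" for i p q
      using that bd_polys[OF face_list_nth[OF that(2)]] bd_homogeneous[OF face_list_nth[OF that(2)]]
      by (simp_all add: bd_mat_def)
    show "(\<lambda>v. ?f \<bullet> v) ` chains (Suc 0) = I" by (rule image)
    show "{v \<in> chains (Suc 0). ?f \<bullet> v = 0} =
        (\<lambda>v. ?A 0 *\<^sub>v v) ` chains (Suc 1)"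
      unfolding ker0 kernel_bd_mat by simp
    show "{v \<in> chains (Suc (Suc i)). ?A i *\<^sub>v v = 0\<^sub>v (length (face_list (Suc i)))} =
        (\<lambda>v. ?A (Suc i) *\<^sub>v v) ` chains (Suc (Suc (Suc i)))" for i
      by (rule kernel_bd_mat)
  qed
  moreover have "lookup (?A i $$ (p, q)) 0 = 0"
    if "p < length (shifts i)" "q < length (shifts (Suc i))" for i p q
    using that bd_const[OF face_list_nth] by (simp add: shifts_def bd_mat_def)
  ultimately show ?thesis
    unfolding minimal_graded_free_resolution_def by blast
qed

end

section \<open>Toric ideals of graphs\<close>

lemma mdegree_0 [simp]: "mdegree 0 = 0"
  by (simp add: mdegree_def)

lemma mdegree_sum: "mdegree (sum f A) = (\<Sum>a\<in>A. mdegree (f a))"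
  by (induction A rule: infinite_finite_induct) (simp_all add: mdegree_add)

lemma mdegree_single [simp]: "mdegree (single x n) = n"
  by (simp add: mdegree_def)

lemma grevlex_less_asym: "grevlex_less xs s t \<Longrightarrow> \<not> grevlex_less xs t s"
proof
  assume a: "grevlex_less xs s t" "grevlex_less xs t s"
  then have deg: "mdegree s = mdegree t" by (auto simp: grevlex_less_def)
  obtain i where i: "i < length xs" "lookup s (xs ! i) > lookup t (xs ! i)"
    "\<And>k. k < length xs \<Longrightarrow> i < k \<Longrightarrow> lookup s (xs ! k) = lookup t (xs ! k)"
    using a(1) deg unfolding grevlex_less_def by auto
  obtain j where j: "j < length xs" "lookup t (xs ! j) > lookup s (xs ! j)"
    "\<And>k. k < length xs \<Longrightarrow> j < k \<Longrightarrow> lookup t (xs ! k) = lookup s (xs ! k)"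
    using a(2) deg unfolding grevlex_less_def by auto
  show False
    using i(2) j(2) i(3)[OF j(1)] j(3)[OF i(1)] by (cases i j rule: linorder_cases) auto
qed

text \<open>
  The exponent of the image of a monomial under the edge homomorphism: each vertex with its multiplicity in
  the multiset of edges \<open>m\<close>.
\<close>

definition incidence :: "('v set \<Rightarrow>\<^sub>0 nat) \<Rightarrow> ('v \<Rightarrow>\<^sub>0 nat)" where
  "incidence m = (\<Sum>e\<in>keys m. \<Sum>i<lookup m e. \<Sum>x\<in>e. single x 1)"

lemma lookup_incidence_superset:
  assumes "finite F" "keys m \<subseteq> F"
  shows "lookup (incidence m) v = (\<Sum>e\<in>F. lookup m e * lookup (\<Sum>x\<in>e. single x 1) v)"
proof -
  have "lookup (incidence m) v = (\<Sum>e\<in>keys m. lookup m e * lookup (\<Sum>x\<in>e. single x 1) v)"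
    by (simp add: incidence_def lookup_sum)
  also have "\<dots> = (\<Sum>e\<in>F. lookup m e * lookup (\<Sum>x\<in>e. single x 1) v)"
    using assms by (intro sum.mono_neutral_left) (auto simp: in_keys_iff)
  finally show ?thesis .
qed

lemma incidence_add: "incidence (m + n) = incidence m + incidence n"
proof (rule poly_mapping_eqI)
  fix v
  let ?F = "keys m \<union> keys n"
  show "lookup (incidence (m + n)) v = lookup (incidence m + incidence n) v"
    using lookup_incidence_superset[of ?F m v] lookup_incidence_superset[of ?F n v]
      lookup_incidence_superset[of ?F "m + n" v]
    by (simp add: lookup_add keys_add_nat distrib_right sum.distrib)
qed

lemma incidence_0: "incidence 0 = 0"
  by (simp add: incidence_def)

lemma incidence_sum: "incidence (sum f A) = (\<Sum>a\<in>A. incidence (f a))"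
  by (induction A rule: infinite_finite_induct) (simp_all add: incidence_add incidence_0)

lemma incidence_single: "incidence (single e 1) = (\<Sum>x\<in>e. single x 1)"
  by (simp add: incidence_def)

lemma mdegree_incidence:
  assumes "\<And>e. e \<in> keys m \<Longrightarrow> card e = 2"
  shows "mdegree (incidence m) = 2 * mdegree m"
proof -
  have "mdegree (incidence m) = (\<Sum>e\<in>keys m. lookup m e * card e)"
    by (simp add: incidence_def mdegree_sum)
  also have "\<dots> = (\<Sum>e\<in>keys m. lookup m e * 2)"
    using assms by (intro sum.cong) auto
  finally show ?thesis by (simp add: mdegree_def sum_distrib_left mult.commute)
qed

lemma prod_single: "(\<Prod>a\<in>A. single (f a) (1::'k::field)) = (single (\<Sum>a\<in>A. f a) 1 :: ('x, 'k) mpoly)"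
  by (induction A rule: infinite_finite_induct) (simp_all add: mult_single)

lemma edge_hom_eq: "edge_hom p = (\<Sum>m\<in>keys p. single (incidence m) (lookup p m))"
proof -
  have pw: "(\<Prod>x\<in>e. mvar x) ^ n = single (\<Sum>i<n. \<Sum>x\<in>e. single x 1) (1::'k::field)"
    for e :: "'v set" and n
    unfolding mvar_def prod_single by (induction n) (simp_all add: mult_single add.commute)
  then show ?thesis
    unfolding edge_hom_def mpoly_subst_def pw prod_single mult_single by (simp add: incidence_def)
qed

lemma edge_hom_superset:
  "finite F \<Longrightarrow> keys p \<subseteq> F \<Longrightarrow> edge_hom p = (\<Sum>m\<in>F. single (incidence m) (lookup p m))"
  unfolding edge_hom_eq by (intro sum.mono_neutral_left) (auto simp: in_keys_iff)

lemma edge_hom_add: "edge_hom (p + q) = edge_hom p + edge_hom q"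
  using edge_hom_superset[of "keys p \<union> keys q" p] edge_hom_superset[of "keys p \<union> keys q" q]
    edge_hom_superset[of "keys p \<union> keys q" "p + q"] keys_add[of p q]
  by (simp add: lookup_add single_add sum.distrib)

lemma edge_hom_minus: "edge_hom (p - q) = edge_hom p - edge_hom q"
  using edge_hom_add[of "p - q" q] by simp

lemma edge_hom_0: "edge_hom 0 = 0"
  by (simp add: edge_hom_eq)

lemma edge_hom_sum: "edge_hom (sum f A) = (\<Sum>a\<in>A. edge_hom (f a))"
  by (induction A rule: infinite_finite_induct) (simp_all add: edge_hom_add edge_hom_0)

lemma edge_hom_single: "edge_hom (single m c) = single (incidence m) c"
  by (cases "c = 0") (simp_all add: edge_hom_eq)

lemma edge_hom_binomial:
  assumes "incidence m = incidence n"
  shows "edge_hom ((single m 1 - single n 1) * p) = 0"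
proof -
  have "(single m 1 - single n 1) * p =
      (\<Sum>k\<in>keys p. single (m + k) (lookup p k) - single (n + k) (lookup p k))"
    by (subst (1) poly_expand[of p]) (simp add: sum_distrib_left left_diff_distrib mult_single sum_subtractf)
  then show ?thesis
    by (simp add: edge_hom_sum edge_hom_minus edge_hom_single incidence_add assms)
qed

lemma toric_ideal_iff: "p \<in> toric_ideal G \<longleftrightarrow> p \<in> polys (snd G) \<and> edge_hom p = 0"
  by (simp add: toric_ideal_def a_kernel_def' mpoly_ring_def)

text \<open>
  The coefficients of an element of the kernel sum to zero over every fibre of \<open>incidence\<close>, so no monomial is
  alone in its fibre.
\<close>

lemma fibre_partner:
  assumes "edge_hom p = 0" "m \<in> keys p"
  obtains m' where "m' \<in> keys p" "m' \<noteq> m" "incidence m' = incidence m"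
proof (rule ccontr)
  assume no: "\<not> thesis"
  have "lookup (edge_hom p) (incidence m) = (\<Sum>m'\<in>keys p. if m' = m then lookup p m' else 0)"
    unfolding edge_hom_eq lookup_sum
    by (rule sum.cong) (use no that in \<open>auto simp: lookup_single when_def\<close>)
  then show False using assms by (simp add: in_keys_iff)
qed

section \<open>Ideals generated by monomials\<close>

lemma mpoly_ring_simps [simp]:
  "monoid.mult (mpoly_ring X) = (*)" "one (mpoly_ring X) = 1"
  "zero (mpoly_ring X) = 0" "add (mpoly_ring X) = (+)"
  by (simp_all add: mpoly_ring_def)

lemma mpoly_ring_cring: "cring (mpoly_ring X :: ('x, 'k::field) mpoly ring)"
proof (rule cringI)
  let ?R = "mpoly_ring X :: ('x, 'k) mpoly ring"
  show "abelian_group ?R"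
  proof (rule abelian_groupI)
    show "\<exists>y\<in>carrier ?R. y \<oplus>\<^bsub>?R\<^esub> x = \<zero>\<^bsub>?R\<^esub>" if "x \<in> carrier ?R" for x
      using polys_uminus[OF that] by (intro bexI[of _ "- x"]) auto
  qed (simp_all add: polys_add add_ac)
  show "Group.comm_monoid ?R"
    by (rule comm_monoidI) (simp_all add: polys_mult mult_ac)
qed (simp add: distrib_right)

lemma mpoly_ring_ring: "ring (mpoly_ring X)"
  using mpoly_ring_cring by (rule cring.axioms(1))

lemma monomial_ideal:
  assumes up: "\<And>m n. P m \<Longrightarrow> P (m + n)"
  shows "ideal {p \<in> polys X. \<forall>m\<in>keys p. P m} (mpoly_ring X :: ('x, 'k::field) mpoly ring)"
proof (rule idealI[OF mpoly_ring_ring])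
  let ?J = "{p \<in> polys X. \<forall>m\<in>keys p. P m} :: ('x, 'k) mpoly set"
  have inv: "\<ominus>\<^bsub>mpoly_ring X\<^esub> a = - a" if "a \<in> polys X" for a :: "('x, 'k) mpoly"
    by (rule abelian_group.minus_equality[OF ring.is_abelian_group[OF mpoly_ring_ring]])
      (use that in \<open>simp_all add: polys_uminus\<close>)
  show "subgroup ?J (add_monoid (mpoly_ring X))"
  proof (rule group.subgroupI)
    show "group (add_monoid (mpoly_ring X))"
      using abelian_group.a_group[OF ring.is_abelian_group[OF mpoly_ring_ring]] .
    show "?J \<noteq> {}" by (auto intro!: exI[of _ 0])
    show "inv\<^bsub>add_monoid (mpoly_ring X)\<^esub> a \<in> ?J" if a: "a \<in> ?J" for a
    proof -
      have "inv\<^bsub>add_monoid (mpoly_ring X)\<^esub> a = - a"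
        using inv[of a] a unfolding a_inv_def by blast
      moreover have "- a \<in> ?J" using a by (simp add: polys_uminus)
      ultimately show ?thesis by (simp only:)
    qed
    show "a \<otimes>\<^bsub>add_monoid (mpoly_ring X)\<^esub> b \<in> ?J" if "a \<in> ?J" "b \<in> ?J" for a b
    proof -
      have "a + b \<in> ?J" using that keys_add[of a b] polys_add[of a X b] by blast
      then show ?thesis by simp
    qed
  qed auto
  fix a x :: "('x, 'k) mpoly"
  assume a: "a \<in> ?J" and x: "x \<in> polys X"
  have "P m" if m: "m \<in> keys (x * a)" for m
  proof -
    obtain k n where "m = k + n" "n \<in> keys a" using m keys_mult[of x a] by blast
    then show ?thesis using a up[of n k] by (simp add: add.commute)
  qed
  then have *: "x * a \<in> ?J" using a x polys_mult by blast
  show "x \<otimes>\<^bsub>mpoly_ring X\<^esub> a \<in> ?J" using * by simp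
  show "a \<otimes>\<^bsub>mpoly_ring X\<^esub> x \<in> ?J" using * by (simp add: mult.commute)
qed

lemma ideal_sum_closed:
  fixes J :: "('x, 'k::field) mpoly set"
  assumes "ideal J (mpoly_ring X)" "\<And>a. a \<in> A \<Longrightarrow> f a \<in> J"
  shows "sum f A \<in> J"
proof -
  note sub = ideal.axioms(1)[OF assms(1)]
  have "0 \<in> J" using additive_subgroup.zero_closed[OF sub] unfolding mpoly_ring_simps .
  moreover have "p + q \<in> J" if "p \<in> J" "q \<in> J" for p q
    using additive_subgroup.a_closed[OF sub that] unfolding mpoly_ring_simps .
  ultimately show ?thesis using assms(2)
    by (induction A rule: infinite_finite_induct) auto
qed

text \<open>
  The polynomials all of whose monomials lie in a set closed under multiples form an ideal, and each term of such
  a polynomial is a multiple of a generator. The predicate \<open>P\<close> says that a monomial is a multiple of some element of \<open>M\<close>.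
\<close>

lemma genideal_monomials:
  fixes P :: "'x mono \<Rightarrow> bool"
  assumes up: "\<And>m n. P m \<Longrightarrow> P (m + n)"
    and MP: "\<And>m. m \<in> M \<Longrightarrow> keys m \<subseteq> X \<and> P m"
    and PM: "\<And>m. keys m \<subseteq> X \<Longrightarrow> P m \<Longrightarrow> \<exists>m0 \<in> M. \<exists>n. m = n + m0"
  shows "genideal (mpoly_ring X) ((\<lambda>m. single m (1::'k::field)) ` M) = {p \<in> polys X. \<forall>m\<in>keys p. P m}"
proof
  interpret R: ring "mpoly_ring X" by (rule mpoly_ring_ring)
  let ?S = "(\<lambda>m. single m (1::'k)) ` M"
  have S: "?S \<subseteq> polys X" using MP by (auto intro!: polys_single)
  show "genideal (mpoly_ring X) ?S \<subseteq> {p \<in> polys X. \<forall>m\<in>keys p. P m}"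
    by (rule R.genideal_minimal[OF monomial_ideal[of P, OF up]]) (use MP in \<open>auto intro!: polys_single\<close>)
  have id: "ideal (genideal (mpoly_ring X) ?S) (mpoly_ring X)" by (rule R.genideal_ideal[OF S])
  show "{p \<in> polys X. \<forall>m\<in>keys p. P m} \<subseteq> genideal (mpoly_ring X) ?S"
  proof
    fix p :: "('x, 'k) mpoly" assume p: "p \<in> {p \<in> polys X. \<forall>m\<in>keys p. P m}"
    have "single m (lookup p m) \<in> genideal (mpoly_ring X) ?S" if m: "m \<in> keys p" for m
    proof -
      have mX: "keys m \<subseteq> X" "P m" using p m by (auto simp: polys_iff)
      then obtain m0 n where m0: "m0 \<in> M" "m = n + m0" using PM by blast
      have "single n (lookup p m) \<in> polys X"
        using mX(1) by (intro polys_single) (simp add: m0 keys_add_nat)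
      moreover have "single m0 1 \<in> genideal (mpoly_ring X) ?S"
        using R.genideal_self[OF S] m0(1) by blast
      ultimately have "single n (lookup p m) * single m0 1 \<in> genideal (mpoly_ring X) ?S"
        using ideal.I_l_closed[OF id] by fastforce
      then show ?thesis by (simp add: mult_single m0)
    qed
    then have "(\<Sum>m\<in>keys p. single m (lookup p m)) \<in> genideal (mpoly_ring X) ?S"
      by (rule ideal_sum_closed[OF id])
    then show "p \<in> genideal (mpoly_ring X) ?S" using poly_expand[of p] by simp
  qed
qed

section \<open>The graphs \<open>G\<^bsub>r,d\<^esub>\<close>\<close>

type_synonym 'k edge_poly = "(vertex set, 'k) mpoly"

text \<open>
  The edges of the path of one parity. The odd ones cover every inner vertex of the path and \<open>x\<^sub>1\<close>, the even ones every
  inner vertex and \<open>x\<^sub>2\<close>; as far as incidences are concerned they behave like the edges \<open>a\<^sub>0\<close> and \<open>b\<^sub>0\<close> at one more vertex \<open>y\<^sub>0\<close>.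
\<close>

definition path_monomial :: "nat \<Rightarrow> (nat \<Rightarrow> bool) \<Rightarrow> vertex set mono" where
  "path_monomial r P = (\<Sum>l\<in>{l \<in> {1..2 * r - 2}. P l}. single (edge_e r l) 1)"

definition a_entry :: "nat \<Rightarrow> nat \<Rightarrow> vertex set mono" where
  "a_entry r j = (if j = 0 then path_monomial r odd else single (edge_a j) 1)"

definition b_entry :: "nat \<Rightarrow> nat \<Rightarrow> vertex set mono" where
  "b_entry r j = (if j = 0 then path_monomial r even else single (edge_b j) 1)"

definition a_weight :: "nat \<Rightarrow> vertex set mono \<Rightarrow> nat" where
  "a_weight d m = (\<Sum>j\<in>{1..d}. j * lookup m (edge_a j))"

context
  fixes r d :: nat
  assumes r3: "r \<ge> 3"
begin

abbreviation (input) "edges \<equiv> snd (graph_G r d)"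

lemma inj_edge_e: "inj_on (edge_e r) {1..2 * r - 2}"
proof -
  have "distinct (map (edge_e r) [1..<Suc (2 * r - 2)])"
    using distinct_edge_list[OF r3, of d] by (simp add: edge_list_def del: upt_Suc)
  then show ?thesis
    by (simp add: distinct_map atLeastLessThanSuc_atLeastAtMost del: upt_Suc)
qed

lemma edge_distinct [simp]:
  "edge_a i = edge_a j \<longleftrightarrow> i = j" "edge_b i = edge_b j \<longleftrightarrow> i = j"
  "edge_a i \<noteq> edge_b j" "edge_b j \<noteq> edge_a i"
  "edge_a i \<noteq> edge_e r l" "edge_e r l \<noteq> edge_a i" "edge_b i \<noteq> edge_e r l" "edge_e r l \<noteq> edge_b i"
proof -
  have "Vx 1 \<in> edge_a i" "Vx 1 \<notin> edge_b j" "Vy i \<in> edge_a i" "Vy j \<in> edge_b j" "Vy i \<notin> edge_e r l" for i j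
    by (simp_all add: edge_a_def edge_b_def edge_e_def)
  then show "edge_a i \<noteq> edge_b j" "edge_b j \<noteq> edge_a i"
    "edge_a i \<noteq> edge_e r l" "edge_e r l \<noteq> edge_a i" "edge_b i \<noteq> edge_e r l" "edge_e r l \<noteq> edge_b i"
    by metis+
qed (auto simp: edge_a_def edge_b_def doubleton_eq_iff)

lemma lookup_path_monomial: "lookup (path_monomial r P) e = (if e \<in> edge_e r ` {l \<in> {1..2 * r - 2}. P l} then 1 else 0)"
proof -
  let ?L = "{l \<in> {1..2 * r - 2}. P l}"
  have "lookup (path_monomial r P) e = (\<Sum>l\<in>?L. if edge_e r l = e then 1 else 0)"
    by (simp add: path_monomial_def lookup_sum lookup_single when_def del: One_nat_def)
  also have "\<dots> = (if e \<in> edge_e r ` ?L then 1 else 0)"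
  proof (cases "e \<in> edge_e r ` ?L")
    case True
    then obtain k where k: "k \<in> ?L" "e = edge_e r k" by blast
    have "(\<Sum>l\<in>?L. if edge_e r l = e then 1 else 0) = (\<Sum>l\<in>?L. if l = k then 1 else (0::nat))"
      using k inj_onD[OF inj_edge_e] by (intro sum.cong) auto
    then show ?thesis using k(1) True by simp
  qed (auto intro!: sum.neutral)
  finally show ?thesis .
qed

lemma keys_path_monomial: "keys (path_monomial r P) = edge_e r ` {l \<in> {1..2 * r - 2}. P l}"
  by (rule Set.set_eqI) (metis in_keys_iff lookup_path_monomial zero_neq_one)

lemma keys_a_entry: "keys (a_entry r j) = (if j = 0 then edge_e r ` {l \<in> {1..2 * r - 2}. odd l} else {edge_a j})"
  by (simp add: a_entry_def keys_path_monomial)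

lemma keys_b_entry: "keys (b_entry r j) = (if j = 0 then edge_e r ` {l \<in> {1..2 * r - 2}. even l} else {edge_b j})"
  by (simp add: b_entry_def keys_path_monomial)

lemma mdegree_path_monomial: "mdegree (path_monomial r P) = card {l \<in> {1..2 * r - 2}. P l}"
  by (simp add: path_monomial_def mdegree_sum)

lemma card_odd: "card {l \<in> {1..2 * r - 2}. odd l} = r - 1"
proof -
  have "{l \<in> {1..2 * r - 2}. odd l} = (\<lambda>i. 2 * i - 1) ` {1..r - 1}"
  proof (intro equalityI subsetI)
    fix l assume "l \<in> {l \<in> {1..2 * r - 2}. odd l}"
    then have "l = 2 * ((l + 1) div 2) - 1" "(l + 1) div 2 \<in> {1..r - 1}" by (auto elim!: oddE)
    then show "l \<in> (\<lambda>i. 2 * i - 1) ` {1..r - 1}" by blast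
  qed auto
  moreover have "inj_on (\<lambda>i. 2 * i - 1 :: nat) {1..r - 1}" by (auto simp: inj_on_def)
  ultimately show ?thesis by (simp add: card_image)
qed

lemma card_even: "card {l \<in> {1..2 * r - 2}. even l} = r - 1"
proof -
  have "{l \<in> {1..2 * r - 2}. even l} = (\<lambda>i. 2 * i) ` {1..r - 1}"
  proof (intro equalityI subsetI)
    fix l assume "l \<in> {l \<in> {1..2 * r - 2}. even l}"
    then have "l = 2 * (l div 2)" "l div 2 \<in> {1..r - 1}" by auto
    then show "l \<in> (\<lambda>i. 2 * i) ` {1..r - 1}" by blast
  qed auto
  moreover have "inj_on (\<lambda>i. 2 * i :: nat) {1..r - 1}" by (auto simp: inj_on_def)
  ultimately show ?thesis by (simp add: card_image)
qed

lemma mdegree_a_entry: "mdegree (a_entry r j) = (if j = 0 then r - 1 else 1)"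
  and mdegree_b_entry: "mdegree (b_entry r j) = (if j = 0 then r - 1 else 1)"
  by (simp_all add: a_entry_def b_entry_def mdegree_path_monomial card_odd card_even del: atLeastAtMost_iff One_nat_def)

lemma edge_e_eq_iff: "l \<in> {1..2 * r - 2} \<Longrightarrow> k \<in> {1..2 * r - 2} \<Longrightarrow> edge_e r l = edge_e r k \<longleftrightarrow> l = k"
  by (rule inj_on_eq_iff[OF inj_edge_e])

lemma graph_columns: "monomial_columns edges d (a_entry r) (b_entry r) (a_weight d)"
proof
  fix i j m n
  show "j \<le> d \<Longrightarrow> keys (a_entry r j) \<subseteq> edges" "j \<le> d \<Longrightarrow> keys (b_entry r j) \<subseteq> edges"
    by (auto simp: keys_a_entry keys_b_entry graph_G_def)
  have e: "edge_e r l \<noteq> edge_e r k" if "l \<in> {1..2 * r - 2}" "k \<in> {1..2 * r - 2}" "odd l" "even k" for l k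
    using edge_e_eq_iff[OF that(1,2)] that(3,4) by auto
  show "keys (a_entry r i) \<inter> keys (b_entry r j) = {}"
    using e by (auto simp: keys_a_entry keys_b_entry split: if_splits)
  show "i \<noteq> j \<Longrightarrow> keys (a_entry r i) \<inter> keys (a_entry r j) = {}"
    "i \<noteq> j \<Longrightarrow> keys (b_entry r i) \<inter> keys (b_entry r j) = {}"
    by (auto simp: keys_a_entry keys_b_entry split: if_splits)
  have "mdegree (a_entry r j) \<noteq> 0" "mdegree (b_entry r j) \<noteq> 0"
    using r3 by (auto simp: mdegree_a_entry mdegree_b_entry)
  then show "a_entry r j \<noteq> 0" "b_entry r j \<noteq> 0" by auto
  show "mdegree (b_entry r j) = mdegree (a_entry r j)" by (simp add: mdegree_a_entry mdegree_b_entry)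
  show "a_weight d (m + n) = a_weight d m + a_weight d n"
    by (simp add: a_weight_def lookup_add distrib_left sum.distrib)
  show "a_weight d (b_entry r j) = 0"
    by (auto simp: a_weight_def b_entry_def lookup_path_monomial lookup_single when_def)
  have w: "a_weight d (a_entry r k) = k" if "k \<le> d" for k
  proof (cases "k = 0")
    case True
    then show ?thesis by (auto simp: a_weight_def a_entry_def lookup_path_monomial)
  next
    case False
    have "a_weight d (a_entry r k) = (\<Sum>j\<in>{1..d}. if j = k then k else 0)"
      unfolding a_weight_def
      by (rule sum.cong) (use False in \<open>auto simp: a_entry_def lookup_single when_def\<close>)
    then show ?thesis using False that by simp
  qed
  show "i < j \<Longrightarrow> j \<le> d \<Longrightarrow> a_weight d (a_entry r i) < a_weight d (a_entry r j)"
    using w[of i] w[of j] by simp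
qed

interpretation G: monomial_columns edges d "a_entry r" "b_entry r" "a_weight d"
  by (rule graph_columns)

lemma finite_edges: "finite edges"
  by (simp add: graph_G_def)

lemma card_edge: "e \<in> edges \<Longrightarrow> card e = 2"
  using finite_simple_graph_G[OF r3, of d] by (auto simp: finite_simple_graph_def)

lemma lookup_incidence_edges:
  assumes "keys m \<subseteq> edges"
  shows "lookup (incidence m) v = (\<Sum>e\<in>{e \<in> edges. v \<in> e}. lookup m e)"
proof -
  have "lookup (\<Sum>x\<in>e. single x (1::nat)) v = (if v \<in> e then 1 else 0)" if "e \<in> edges" for e
  proof -
    have "finite e" using card_edge[OF that] by (metis card.infinite zero_neq_numeral)
    then show ?thesis by (simp add: lookup_sum lookup_single when_def)
  qed
  then have "lookup (incidence m) v = (\<Sum>e\<in>edges. if v \<in> e then lookup m e else 0)"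
    unfolding lookup_incidence_superset[OF finite_edges assms] by (intro sum.cong) auto
  then show ?thesis using finite_edges by (simp add: sum.inter_filter)
qed

lemma edges_at_y: "j \<in> {1..d} \<Longrightarrow> {e \<in> edges. Vy j \<in> e} = {edge_a j, edge_b j}"
  by (auto simp: graph_G_def edge_a_def edge_b_def edge_e_def)

lemma z_in_edge_e:
  assumes "l \<in> {1..2 * r - 2}" "k \<in> {1..2 * r - 3}"
  shows "Vz k \<in> edge_e r l \<longleftrightarrow> l = k \<or> l = k + 1"
  using assms r3 by (auto simp: edge_e_def)

lemma x1_in_edge_e: "l \<in> {1..2 * r - 2} \<Longrightarrow> Vx 1 \<in> edge_e r l \<longleftrightarrow> l = 1"
  using r3 by (auto simp: edge_e_def)

lemma edges_at_z:
  assumes "k \<in> {1..2 * r - 3}"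
  shows "{e \<in> edges. Vz k \<in> e} = {edge_e r k, edge_e r (k + 1)}"
proof -
  have "k \<in> {1..2 * r - 2}" "k + 1 \<in> {1..2 * r - 2}" using assms by auto
  then show ?thesis
    using z_in_edge_e[OF _ assms] by (auto simp: graph_G_def edge_a_def edge_b_def)
qed

lemma edges_at_x1: "{e \<in> edges. Vx 1 \<in> e} = edge_a ` {1..d} \<union> {edge_e r 1}"
proof -
  have "1 \<in> {1..2 * r - 2}" using r3 by auto
  then show ?thesis
    using x1_in_edge_e by (auto simp: graph_G_def edge_a_def edge_b_def)
qed

text \<open>
  Divisible by the leading term of a minor.
\<close>

definition nonstd :: "vertex set mono \<Rightarrow> bool" where
  "nonstd m \<longleftrightarrow> (\<exists>i j. i < j \<and> j \<le> d \<and> mdvd (b_entry r i) m \<and> mdvd (a_entry r j) m)"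

text \<open>
  Two monomials with the same incidences differ by a vector \<open>\<delta>\<^sub>0, \<dots>, \<delta>\<^sub>d\<close> with sum zero: \<open>\<delta>\<^sub>j\<close> is added to the exponent of
  column \<open>j\<close> in the first row and subtracted in the second, where column \<open>0\<close> stands for the path. Let \<open>i\<close> be
  the last index with \<open>\<delta>\<^sub>i \<noteq> 0\<close>. If \<open>\<delta>\<^sub>i < 0\<close>, then \<open>a\<^sub>i\<close> divides \<open>m\<close> and some \<open>\<delta>\<^sub>j > 0\<close> with \<open>j < i\<close> shows that the second
  entry of column \<open>j\<close> divides \<open>m\<close>, so \<open>m\<close> is nonstandard. Hence \<open>\<delta>\<^sub>i > 0\<close>, and \<open>m'\<close> has less of \<open>b\<^sub>i\<close>, the last variable in which the two differ.
\<close>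

lemma standard_is_grevlex_least:
  assumes m: "keys m \<subseteq> edges" and m': "keys m' \<subseteq> edges" and eq: "incidence m = incidence m'"
    and std: "\<not> nonstd m" and ne: "m \<noteq> m'"
  shows "grevlex_less (edge_list r d) m m'"
proof -
  have y: "lookup m (edge_a j) + lookup m (edge_b j) = lookup m' (edge_a j) + lookup m' (edge_b j)"
    if "j \<in> {1..d}" for j
    using lookup_incidence_edges[OF m, of "Vy j"] lookup_incidence_edges[OF m', of "Vy j"] eq
    by (simp add: edges_at_y[OF that])
  have z: "lookup m (edge_e r k) + lookup m (edge_e r (k + 1)) = lookup m' (edge_e r k) + lookup m' (edge_e r (k + 1))"
    if k: "k \<in> {1..2 * r - 3}" for k
  proof -
    have "edge_e r k \<noteq> edge_e r (k + 1)"
    proof -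
      have "k \<in> {1..2 * r - 2}" "k + 1 \<in> {1..2 * r - 2}" using k by auto
      then show ?thesis using edge_e_eq_iff[of k "k + 1"] by simp
    qed
    then show ?thesis
      using lookup_incidence_edges[OF m, of "Vz k"] lookup_incidence_edges[OF m', of "Vz k"] eq
      by (simp add: edges_at_z[OF k])
  qed
  have x: "(\<Sum>j\<in>{1..d}. lookup m (edge_a j)) + lookup m (edge_e r 1) =
      (\<Sum>j\<in>{1..d}. lookup m' (edge_a j)) + lookup m' (edge_e r 1)"
  proof -
    have "(\<Sum>e\<in>edge_a ` {1..d} \<union> {edge_e r 1}. lookup n e) =
        (\<Sum>j\<in>{1..d}. lookup n (edge_a j)) + lookup n (edge_e r 1)" for n :: "vertex set mono"
    proof -
      have "inj_on edge_a {1..d}" by (simp add: inj_on_def)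
      then show ?thesis by (subst sum.union_disjoint) (auto simp: sum.reindex)
    qed
    then show ?thesis
      using lookup_incidence_edges[OF m, of "Vx 1"] lookup_incidence_edges[OF m', of "Vx 1"] eq
      unfolding edges_at_x1 by simp
  qed
  \<comment> \<open>The difference in column \<open>0\<close>: the exponents along the path change alternately by \<open>c\<close> and \<open>- c\<close>.\<close>
  define c where "c = int (lookup m' (edge_e r 1)) - int (lookup m (edge_e r 1))"
  have e: "int (lookup m' (edge_e r l)) - int (lookup m (edge_e r l)) = (if odd l then c else - c)"
    if "l \<in> {1..2 * r - 2}" for l
    using that
  proof (induction l)
    case (Suc l)
    show ?case
    proof (cases "l = 0")
      case False
      then have "l \<in> {1..2 * r - 2}" "l \<in> {1..2 * r - 3}" using Suc.prems by auto
      then show ?thesis using Suc.IH z[of l] by auto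
    qed (simp add: c_def)
  qed simp
  have x': "(\<Sum>j\<in>{1..d}. int (lookup m' (edge_a j)) - int (lookup m (edge_a j))) + c = 0"
    using arg_cong[OF x, of int] by (simp add: c_def sum_subtractf)
  \<comment> \<open>If no exponent of an edge \<open>a\<^sub>j\<close> changed, the sum in the previous step would force \<open>c = 0\<close> and \<open>m = m'\<close>.\<close>
  define J where "J = {j \<in> {1..d}. lookup m' (edge_a j) \<noteq> lookup m (edge_a j)}"
  have "J \<noteq> {}"
  proof
    assume "J = {}"
    then have a: "lookup m' (edge_a j) = lookup m (edge_a j)" if "j \<in> {1..d}" for j
      using that by (auto simp: J_def)
    then have "c = 0" using x' by simp
    have "lookup m f = lookup m' f" for f
    proof (cases "f \<in> edges")
      case True
      then consider j where "j \<in> {1..d}" "f = edge_a j" | j where "j \<in> {1..d}" "f = edge_b j"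
        | l where "l \<in> {1..2 * r - 2}" "f = edge_e r l"
        by (auto simp: graph_G_def)
      then show ?thesis
      proof cases
        case 1 then show ?thesis using a by simp
      next
        case (2 j) then show ?thesis using a[of j] y[of j] by simp
      next
        case (3 l) then show ?thesis using e[of l] \<open>c = 0\<close> by (auto split: if_splits)
      qed
    next
      case False
      then have "f \<notin> keys m" "f \<notin> keys m'" using m m' by auto
      then show ?thesis by (simp add: in_keys_iff)
    qed
    then show False using ne by (auto intro: poly_mapping_eqI)
  qed
  have finJ: "finite J" by (simp add: J_def)
  define i where "i = Max J"
  have "i \<in> J" unfolding i_def by (rule Max_in[OF finJ \<open>J \<noteq> {}\<close>])
  then have i: "i \<in> {1..d}" "lookup m' (edge_a i) \<noteq> lookup m (edge_a i)" by (auto simp: J_def)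
  have above: "lookup m' (edge_a j) = lookup m (edge_a j)" if "i < j" "j \<in> {1..d}" for j
  proof -
    have "j \<notin> J" using that(1) Max_ge[OF finJ, of j] unfolding i_def by linarith
    then show ?thesis using that(2) by (simp add: J_def)
  qed
  have up: "lookup m (edge_a i) < lookup m' (edge_a i)"
  proof (rule ccontr)
    assume "\<not> lookup m (edge_a i) < lookup m' (edge_a i)"
    then have lt: "lookup m' (edge_a i) < lookup m (edge_a i)" using i(2) by simp
    then have ai: "mdvd (a_entry r i) m"
      using i(1) by (auto simp: mdvd_def a_entry_def lookup_single when_def)
    have "\<exists>j. j < i \<and> mdvd (b_entry r j) m"
    proof (cases "c > 0")
      case True
      have "lookup m (edge_e r l) \<ge> 1" if "l \<in> {1..2 * r - 2}" "even l" for l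
        using e[OF that(1)] that(2) True by auto
      then have "mdvd (b_entry r 0) m"
        by (auto simp: mdvd_def b_entry_def lookup_path_monomial)
      then show ?thesis using i(1) by (intro exI[of _ 0]) auto
    next
      case False
      then have "(\<Sum>j\<in>{1..d}. int (lookup m' (edge_a j)) - int (lookup m (edge_a j))) \<ge> 0"
        using x' by simp
      then have "(\<Sum>j\<in>{1..d} - {i}. int (lookup m' (edge_a j)) - int (lookup m (edge_a j))) > 0"
        using i(1) lt by (simp add: sum.remove[of _ i])
      then obtain j where j: "j \<in> {1..d} - {i}" "int (lookup m' (edge_a j)) - int (lookup m (edge_a j)) > 0"
        by (metis (no_types, lifting) not_less sum_nonpos)
      then have "j < i" using above[of j] by (cases i j rule: linorder_cases) auto
      moreover have "lookup m (edge_b j) \<ge> 1" using y[of j] j by auto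
      then have "mdvd (b_entry r j) m"
        using j by (auto simp: mdvd_def b_entry_def lookup_single when_def)
      ultimately show ?thesis by blast
    qed
    then show False using ai std i(1) by (auto simp: nonstd_def)
  qed
  have "2 * mdegree m = 2 * mdegree m'"
    using mdegree_incidence[of m] mdegree_incidence[of m'] card_edge m m' eq by (metis subsetD)
  then have deg: "mdegree m = mdegree m'" by simp
  have len: "length (edge_list r d) = d + (2 * r - 2) + d" by (simp add: edge_list_def del: upt_Suc)
  have nth: "edge_list r d ! (d + (2 * r - 2) + k) = edge_b (Suc k)" if "k < d" for k
  proof -
    have "edge_list r d = (map edge_a [1..<Suc d] @ map (edge_e r) [1..<Suc (2 * r - 2)]) @ map edge_b [1..<Suc d]"
      by (simp add: edge_list_def)
    moreover have "length (map edge_a [1..<Suc d] @ map (edge_e r) [1..<Suc (2 * r - 2)]) = d + (2 * r - 2)"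
      by (simp del: upt_Suc)
    ultimately have "edge_list r d ! (d + (2 * r - 2) + k) = map edge_b [1..<Suc d] ! k"
      by (metis nth_append_length_plus)
    then show ?thesis using that by (simp del: upt_Suc)
  qed
  have "\<exists>k<length (edge_list r d).
      lookup m' (edge_list r d ! k) < lookup m (edge_list r d ! k) \<and>
      (\<forall>j<length (edge_list r d). k < j \<longrightarrow> lookup m (edge_list r d ! j) = lookup m' (edge_list r d ! j))"
  proof (intro exI conjI allI impI)
    let ?k = "d + (2 * r - 2) + (i - 1)"
    show "?k < length (edge_list r d)" using i(1) by (auto simp: len)
    have "edge_list r d ! ?k = edge_b i" using nth[of "i - 1"] i(1) by (cases i) auto
    then show "lookup m' (edge_list r d ! ?k) < lookup m (edge_list r d ! ?k)"
      using y[OF i(1)] up by simp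
    fix j assume j: "j < length (edge_list r d)" "?k < j"
    define l where "l = j - (d + (2 * r - 2))"
    have l: "j = d + (2 * r - 2) + l" "l < d" "i < Suc l" using j i(1) by (auto simp: l_def len)
    then show "lookup m (edge_list r d ! j) = lookup m' (edge_list r d ! j)"
      using y[of "Suc l"] above[of "Suc l"] by (simp add: nth)
  qed
  then show ?thesis using deg by (auto simp: grevlex_less_def)
qed

lemma lookup_incidence_path_monomial:
  "lookup (incidence (path_monomial r P)) v = card {l \<in> {1..2 * r - 2}. P l \<and> v \<in> edge_e r l}"
proof -
  have "lookup (incidence (path_monomial r P)) v = (\<Sum>l\<in>{l \<in> {1..2 * r - 2}. P l}. lookup (\<Sum>x\<in>edge_e r l. single x 1) v)"
    by (simp add: path_monomial_def incidence_sum incidence_single lookup_sum del: One_nat_def)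
  also have "\<dots> = (\<Sum>l\<in>{l \<in> {1..2 * r - 2}. P l}. if v \<in> edge_e r l then 1 else 0)"
  proof (rule sum.cong[OF refl])
    fix l
    have "finite (edge_e r l)" by (simp add: edge_e_def)
    then show "lookup (\<Sum>x\<in>edge_e r l. single x 1) v = (if v \<in> edge_e r l then 1 else 0)"
      by (simp add: lookup_sum lookup_single when_def)
  qed
  also have "\<dots> = card {l \<in> {l \<in> {1..2 * r - 2}. P l}. v \<in> edge_e r l}"
    by (simp add: sum.inter_filter[symmetric] del: mem_Collect_eq atLeastAtMost_iff)
  also have "{l \<in> {l \<in> {1..2 * r - 2}. P l}. v \<in> edge_e r l} = {l \<in> {1..2 * r - 2}. P l \<and> v \<in> edge_e r l}"
    by blast
  finally show ?thesis .
qed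

text \<open>
  Each inner vertex of the path lies on two consecutive edges, exactly one of each parity. The end \<open>x\<^sub>1\<close> lies on
  the first edge, which is odd, and \<open>x\<^sub>2\<close> on the last one, which is even.
\<close>

lemma incidence_path_monomial:
  assumes P: "P = odd \<or> P = even"
  shows "incidence (path_monomial r P) =
    single (Vx (if P 1 then 1 else 2)) 1 + (\<Sum>k\<in>{1..2 * r - 3}. single (Vz k) 1)"
proof (rule poly_mapping_eqI)
  fix v
  have rhs: "lookup (\<Sum>k\<in>{1..2 * r - 3}. single (Vz k) (1::nat)) v = (if v \<in> Vz ` {1..2 * r - 3} then 1 else 0)"
  proof (cases "v \<in> Vz ` {1..2 * r - 3}")
    case True
    then obtain k where k: "k \<in> {1..2 * r - 3}" "v = Vz k" by blast
    then have "lookup (\<Sum>k\<in>{1..2 * r - 3}. single (Vz k) (1::nat)) v = (\<Sum>j\<in>{1..2 * r - 3}. if j = k then 1 else 0)"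
      by (auto simp: lookup_sum lookup_single when_def intro!: sum.cong)
    then show ?thesis using k by simp
  qed (auto simp: lookup_sum lookup_single when_def intro!: sum.neutral)
  let ?S = "{l \<in> {1..2 * r - 2}. P l \<and> v \<in> edge_e r l}"
  have "card ?S = lookup (single (Vx (if P 1 then 1 else 2)) (1::nat)) v + (if v \<in> Vz ` {1..2 * r - 3} then 1 else 0)"
  proof (cases v)
    case (Vx k)
    have "?S = (if k = 1 \<and> P 1 then {1} else if k = 2 \<and> \<not> P 1 then {2 * r - 2} else {})"
    proof -
      have "Vx k \<in> edge_e r l \<longleftrightarrow> k = 1 \<and> l = 1 \<or> k = 2 \<and> l = 2 * r - 2" if "l \<in> {1..2 * r - 2}" for l
        using that r3 by (auto simp: edge_e_def)
      then have S: "?S = {l \<in> {1..2 * r - 2}. P l \<and> (k = 1 \<and> l = 1 \<or> k = 2 \<and> l = 2 * r - 2)}"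
        unfolding Vx by blast
      have "P (2 * r - 2) \<longleftrightarrow> \<not> P 1" using P r3 by auto
      then show ?thesis unfolding S using r3 by auto
    qed
    then show ?thesis by (auto simp: Vx lookup_single when_def)
  next
    case (Vy k)
    then have "?S = {}" by (auto simp: edge_e_def)
    then show ?thesis by (auto simp: Vy lookup_single when_def)
  next
    case (Vz k)
    show ?thesis
    proof (cases "k \<in> {1..2 * r - 3}")
      case True
      have S: "?S = {l \<in> {1..2 * r - 2}. P l \<and> (l = k \<or> l = k + 1)}"
        unfolding Vz using z_in_edge_e[OF _ True] by blast
      have "P (k + 1) \<longleftrightarrow> \<not> P k" using P by auto
      then have "?S = {if P k then k else k + 1}" unfolding S using True by auto
      then show ?thesis using True by (simp add: Vz lookup_single when_def)
    next
      case False
      then have "?S = {}" using r3 by (auto simp: Vz edge_e_def)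
      then show ?thesis using False by (auto simp: Vz lookup_single when_def)
    qed
  qed
  then show "lookup (incidence (path_monomial r P)) v =
      lookup (single (Vx (if P 1 then 1 else 2)) 1 + (\<Sum>k\<in>{1..2 * r - 3}. single (Vz k) 1)) v"
    unfolding lookup_incidence_path_monomial lookup_add rhs .
qed

lemma incidence_columns: "incidence (b_entry r i + a_entry r j) = incidence (a_entry r i + b_entry r j)"
proof -
  have "incidence (a_entry r j) + single (Vx 2) 1 = incidence (b_entry r j) + single (Vx 1) 1" for j
    using incidence_path_monomial[of odd] incidence_path_monomial[of even]
    by (auto simp: a_entry_def b_entry_def incidence_single edge_a_def edge_b_def add_ac simp del: One_nat_def)
  note * = this
  have "incidence (b_entry r i + a_entry r j) + (single (Vx 1) 1 + single (Vx 2) 1) =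
      (incidence (b_entry r i) + single (Vx 1) 1) + (incidence (a_entry r j) + single (Vx 2) 1)"
    by (simp only: incidence_add add_ac)
  also have "\<dots> = (incidence (a_entry r i) + single (Vx 2) 1) + (incidence (b_entry r j) + single (Vx 1) 1)"
    by (simp only: *)
  also have "\<dots> = incidence (a_entry r i + b_entry r j) + (single (Vx 1) 1 + single (Vx 2) 1)"
    by (simp only: incidence_add add_ac)
  finally show ?thesis by simp
qed

abbreviation (input) toric :: "('k::field) edge_poly set" where
  "toric \<equiv> toric_ideal (graph_G r d)"

section \<open>The toric ideal and its initial ideal\<close>

lemma minor_in_toric_ideal:
  assumes "i < j" "j \<le> d" "p \<in> polys edges"
  shows "(G.minor True i j * p :: ('k::field) edge_poly) \<in> toric"
proof -
  have "(G.minor True i j :: 'k edge_poly) \<in> polys edges"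
    unfolding G.minor_def using assms(1,2) G.keys_am[of i] G.keys_am[of j] G.keys_bm[of i] G.keys_bm[of j]
    by (auto intro!: polys_minus polys_single simp: keys_add_nat)
  then show ?thesis
    unfolding toric_ideal_iff using assms(3) edge_hom_binomial[OF incidence_columns]
    by (simp add: polys_mult G.minor_def)
qed

text \<open>
  The monomial \<open>m\<close> is not alone in its fibre and, being standard, is the least one there.
\<close>

lemma standard_term_not_leading:
  fixes p :: "'k::field edge_poly"
  assumes p: "p \<in> toric" and m: "m \<in> keys p" and std: "\<not> nonstd m"
  obtains m' where "m' \<in> keys p" "m' \<noteq> m" "grevlex_less (edge_list r d) m m'" "incidence m' = incidence m"
proof -
  obtain m' where m': "m' \<in> keys p" "m' \<noteq> m" "incidence m' = incidence m"
    using fibre_partner[of p m] p m by (auto simp: toric_ideal_iff)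
  have "keys m \<subseteq> edges" "keys m' \<subseteq> edges" using p m m'(1) by (auto simp: toric_ideal_iff polys_iff)
  then have "grevlex_less (edge_list r d) m m'"
    using standard_is_grevlex_least[of m m'] m' std by auto
  then show ?thesis using that m' by blast
qed

text \<open>
  Distinct standard monomials lie in distinct fibres, since each is the least of its fibre. So no nonzero
  element of the ideal involves only standard monomials.
\<close>

lemma toric_ideal_resolution:
  "\<exists>f A. minimal_graded_free_resolution edges (toric :: ('k::field) edge_poly set) G.shifts f A"
proof (rule G.minimal_resolution[where eps = True])
  fix p :: "'k edge_poly"
  assume p: "p \<in> toric" and "\<And>m i j. m \<in> keys p \<Longrightarrow> i < j \<Longrightarrow> j \<le> d \<Longrightarrow> mdvd (b_entry r i) m \<Longrightarrow> \<not> mdvd (a_entry r j) m"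
  then have std: "\<not> nonstd m" if "m \<in> keys p" for m using that by (auto simp: nonstd_def)
  show "p = 0"
  proof (rule ccontr)
    assume "p \<noteq> 0"
    then obtain m where m: "m \<in> keys p" by (metis keys_eq_empty ex_in_conv)
    obtain m' where m': "m' \<in> keys p" "m' \<noteq> m" "grevlex_less (edge_list r d) m m'" "incidence m' = incidence m"
      using standard_term_not_leading[OF p m std[OF m]] .
    have "keys m \<subseteq> edges" "keys m' \<subseteq> edges" using p m m'(1) by (auto simp: toric_ideal_iff polys_iff)
    then have "grevlex_less (edge_list r d) m' m"
      using standard_is_grevlex_least[of m' m] m' std by auto
    then show False using grevlex_less_asym m'(3) by blast
  qed
qed (auto simp: toric_ideal_iff edge_hom_0 edge_hom_add edge_hom_minus polys_add polys_minus
    dest: minor_in_toric_ideal[unfolded toric_ideal_iff])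

text \<open>
  The other term \<open>am i * bm j\<close> of the minor is standard, hence least in the fibre that both terms share.
\<close>

lemma leading_minor:
  assumes "i < j" "j \<le> d"
  shows "is_leading_monomial (grevlex_less (edge_list r d))
    (G.minor True i j :: ('k::field) edge_poly) (b_entry r i + a_entry r j)"
proof -
  have B0: "G.Bs 0 = {}" "G.As 0 = {}"
    using G.bm_nz G.am_nz by (auto simp: G.Bs_def G.As_def mdvd_0_iff)
  have "G.Bs (0 + a_entry r i + b_entry r j) = {j}" "G.As (0 + a_entry r i + b_entry r j) = {i}"
    using assms by (simp_all only: G.Bs_add_bm G.Bs_add_am G.As_add_bm G.As_add_am B0 le_trans[OF less_imp_le])
  then have B: "mdvd (b_entry r k) (a_entry r i + b_entry r j) \<Longrightarrow> k \<le> d \<Longrightarrow> k = j"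
    "mdvd (a_entry r k) (a_entry r i + b_entry r j) \<Longrightarrow> k \<le> d \<Longrightarrow> k = i" for k
    by (auto simp: G.Bs_def G.As_def)
  have std: "\<not> nonstd (a_entry r i + b_entry r j)"
  proof
    assume "nonstd (a_entry r i + b_entry r j)"
    then obtain i' j' where "i' < j'" "j' \<le> d" "i' = j" "j' = i"
      using B by (auto simp: nonstd_def) (metis less_imp_le le_trans)
    then show False using assms(1) by simp
  qed
  have "a_weight d (a_entry r i + b_entry r j) < a_weight d (b_entry r i + a_entry r j)"
    using G.wt_am[OF assms] assms by (simp add: G.wt_add G.wt_bm)
  then have ne: "a_entry r i + b_entry r j \<noteq> b_entry r i + a_entry r j" by auto
  have "keys (a_entry r i + b_entry r j) \<subseteq> edges" "keys (b_entry r i + a_entry r j) \<subseteq> edges"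
    using assms G.keys_am[of i] G.keys_am[of j] G.keys_bm[of i] G.keys_bm[of j] by (auto simp: keys_add_nat)
  then have "grevlex_less (edge_list r d) (a_entry r i + b_entry r j) (b_entry r i + a_entry r j)"
    by (rule standard_is_grevlex_least[OF _ _ incidence_columns[symmetric] std ne])
  moreover have "keys (G.minor True i j :: 'k edge_poly) \<subseteq> {b_entry r i + a_entry r j, a_entry r i + b_entry r j}"
    using G.keys_minor[where 'k = 'k, of True i j] by auto
  moreover have "b_entry r i + a_entry r j \<in> keys (G.minor True i j :: 'k edge_poly)"
    using ne by (simp add: in_keys_iff G.minor_def lookup_minus lookup_single when_def)
  ultimately show ?thesis unfolding is_leading_monomial_def by blast
qed

text \<open>
  A leading monomial is never least in its fibre, hence nonstandard; conversely the leading terms of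
  the minors generate all nonstandard monomials.
\<close>

lemma initial_ideal_eq:
  "initial_ideal edges (grevlex_less (edge_list r d)) (toric :: ('k::field) edge_poly set) =
    {p \<in> polys edges. \<forall>m\<in>keys p. nonstd m}"
proof -
  let ?lt = "grevlex_less (edge_list r d)"
  let ?M = "{m. \<exists>p \<in> (toric :: 'k edge_poly set). is_leading_monomial ?lt p m}"
  have "{single m (1::'k) | m. \<exists>p \<in> (toric :: 'k edge_poly set). is_leading_monomial ?lt p m} =
      (\<lambda>m. single m 1) ` ?M" by blast
  then have "initial_ideal edges ?lt (toric :: 'k edge_poly set) = genideal (mpoly_ring edges) ((\<lambda>m. single m (1::'k)) ` ?M)"
    by (simp add: initial_ideal_def)
  also have "\<dots> = {p \<in> polys edges. \<forall>m\<in>keys p. nonstd m}"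
  proof (rule genideal_monomials)
    show "nonstd (m + n)" if "nonstd m" for m n
      using that mdvd_add_right unfolding nonstd_def by blast
    show "keys m \<subseteq> edges \<and> nonstd m" if mM: "m \<in> ?M" for m
    proof -
      obtain p :: "'k edge_poly" where p: "p \<in> toric" "is_leading_monomial ?lt p m" using mM by blast
      then have m: "m \<in> keys p" by (simp add: is_leading_monomial_def)
      have "nonstd m"
      proof (rule ccontr)
        assume "\<not> nonstd m"
        then obtain m' where m': "m' \<in> keys p" "m' \<noteq> m" "?lt m m'"
          using standard_term_not_leading[OF p(1) m] by blast
        then have "?lt m' m" using p(2) by (simp add: is_leading_monomial_def)
        then show False using grevlex_less_asym m'(3) by blast
      qed
      then show ?thesis using p(1) m by (auto simp: toric_ideal_iff polys_iff)
    qed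
    show "\<exists>m0 \<in> ?M. \<exists>n. m = n + m0" if ns: "nonstd m" for m
    proof -
      obtain i j where ij: "i < j" "j \<le> d" "mdvd (b_entry r i) m" "mdvd (a_entry r j) m"
        using ns by (auto simp: nonstd_def)
      have m1: "m = (m - a_entry r j) + a_entry r j" using mdvd_diff_add[OF ij(4)] by simp
      have "mdvd (b_entry r i) (m - a_entry r j)"
        using ij(3) mdvd_coprime_add[of "b_entry r i" "a_entry r j" "m - a_entry r j"] G.am_bm[of j i] ij(1,2) m1
        by (simp add: Int_commute)
      then have "m = (m - a_entry r j - b_entry r i) + (b_entry r i + a_entry r j)"
        using mdvd_diff_add[of "b_entry r i" "m - a_entry r j"] m1 by (metis add.assoc)
      moreover have "b_entry r i + a_entry r j \<in> ?M"
        using leading_minor[where 'k = 'k, OF ij(1,2)] minor_in_toric_ideal[OF ij(1,2) polys_1, where 'k = 'k] by auto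
      ultimately show ?thesis by blast
    qed
  qed
  finally show ?thesis .
qed

lemma initial_ideal_resolution:
  "\<exists>f A. minimal_graded_free_resolution edges
     (initial_ideal edges (grevlex_less (edge_list r d)) (toric :: ('k::field) edge_poly set)) G.shifts f A"
  unfolding initial_ideal_eq
proof (rule G.minimal_resolution[where eps = False])
  let ?J = "{p \<in> polys edges. \<forall>m\<in>keys p. nonstd m} :: 'k edge_poly set"
  show "?J \<subseteq> polys edges" "0 \<in> ?J" by auto
  show "p + q \<in> ?J" if "p \<in> ?J" "q \<in> ?J" for p q
    using that keys_add[of p q] by (auto intro: polys_add)
  show "p - q \<in> ?J" if "p \<in> ?J" "q \<in> ?J" for p q
    using that keys_diff[of p q] by (auto intro: polys_minus)
  show "G.minor False i j * p \<in> ?J" if ij: "i < j" "j \<le> d" and p: "p \<in> polys edges" for i j p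
  proof -
    have s: "single (b_entry r i + a_entry r j) (1::'k) \<in> polys edges"
      using ij G.keys_am[of j] G.keys_bm[of i] by (auto intro!: polys_single simp: keys_add_nat)
    have "nonstd m" if mk: "m \<in> keys (single (b_entry r i + a_entry r j) (1::'k) * p)" for m
    proof -
      obtain n where "m = b_entry r i + a_entry r j + n"
        using subsetD[OF keys_mult mk] by auto
      then have "mdvd (b_entry r i) m" "mdvd (a_entry r j) m" by (auto simp: mdvd_def lookup_add)
      then show ?thesis using ij by (auto simp: nonstd_def)
    qed
    then show ?thesis using polys_mult[OF s p] by (simp add: G.minor_def)
  qed
  show "p = 0" if p: "p \<in> ?J" and std: "\<And>m i j. m \<in> keys p \<Longrightarrow> i < j \<Longrightarrow> j \<le> d \<Longrightarrow> mdvd (b_entry r i) m \<Longrightarrow> \<not> mdvd (a_entry r j) m" for p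
  proof -
    have "keys p = {}" using p std by (fastforce simp: nonstd_def)
    then show ?thesis by simp
  qed
qed

section \<open>The Betti numbers\<close>

lemma count_shifts: "count_list (G.shifts i) j = card {\<tau> \<in> G.faces (Suc i). G.shift \<tau> = j}"
proof -
  have "count_list (G.shifts i) j = length (filter (\<lambda>\<tau>. G.shift \<tau> = j) (G.face_list (Suc i)))"
    by (simp add: G.shifts_def count_list_eq_length_filter filter_map o_def eq_commute)
  also have "\<dots> = card (set (filter (\<lambda>\<tau>. G.shift \<tau> = j) (G.face_list (Suc i))))"
    using G.face_list(2) by (metis distinct_card distinct_filter)
  finally show ?thesis by (simp add: G.face_list(1))
qed

text \<open>
  Column \<open>0\<close> has entries of degree \<open>r - 1\<close>, the others of degree \<open>1\<close>. As \<open>r \<ge> 3\<close>, this separates the two strands.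
\<close>

lemma shift_face:
  assumes "\<tau> \<in> G.faces (Suc i)"
  shows "G.shift \<tau> = (if 0 \<in> fst \<tau> then int (i + r) else int (i + 2))"
proof -
  obtain S q where \<tau>: "\<tau> = (S, q)" by fastforce
  have S: "S \<subseteq> {..d}" "card S = i + 2" using assms by (auto simp: \<tau> G.faces_def)
  have fin: "finite S" using S(1) by (rule finite_subset) simp
  have *: "(\<Sum>j\<in>T. int (mdegree (a_entry r j))) = int (card T)" if "0 \<notin> T" for T
  proof -
    have "(\<Sum>j\<in>T. int (mdegree (a_entry r j))) = (\<Sum>j\<in>T. 1)"
      using that by (intro sum.cong) (auto simp: mdegree_a_entry)
    then show ?thesis by simp
  qed
  show ?thesis
  proof (cases "0 \<in> S")
    case True
    have "G.shift \<tau> = int (mdegree (a_entry r 0)) + int (card (S - {0}))"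
      using *[of "S - {0}"] fin True by (simp add: G.shift_def \<tau> sum.remove)
    then show ?thesis using True S(2) fin r3 by (simp add: \<tau> mdegree_a_entry)
  next
    case False
    then show ?thesis using *[OF False] S(2) by (simp add: G.shift_def \<tau>)
  qed
qed

lemma count_shifts_linear: "count_list (G.shifts i) (int (i + 2)) = (i + 1) * (d choose (i + 2))"
proof -
  have "{\<tau> \<in> G.faces (Suc i). G.shift \<tau> = int (i + 2)} = {S. S \<subseteq> {1..d} \<and> card S = i + 2} \<times> {..i}"
  proof -
    have *: "\<tau> \<in> G.faces (Suc i) \<and> G.shift \<tau> = int (i + 2) \<longleftrightarrow>
        fst \<tau> \<subseteq> {1..d} \<and> card (fst \<tau>) = i + 2 \<and> snd \<tau> \<le> i" for \<tau>
    proof -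
      have 1: "\<tau> \<in> G.faces (Suc i) \<and> G.shift \<tau> = int (i + 2) \<longleftrightarrow> \<tau> \<in> G.faces (Suc i) \<and> 0 \<notin> fst \<tau>"
        using shift_face[of \<tau> i] r3 by (cases "0 \<in> fst \<tau>") auto
      have 2: "fst \<tau> \<subseteq> {..d} \<and> 0 \<notin> fst \<tau> \<longleftrightarrow> fst \<tau> \<subseteq> {1..d}"
        by (auto simp: subset_eq Suc_le_eq) (metis neq0_conv)
      have 3: "\<tau> \<in> G.faces (Suc i) \<longleftrightarrow> fst \<tau> \<subseteq> {..d} \<and> card (fst \<tau>) = i + 2 \<and> snd \<tau> \<le> i"
        by (simp add: G.faces_def split_def)
      show ?thesis using 1 2 3 by argo
    qed
    show ?thesis
      by (rule Set.set_eqI) (simp only: mem_Collect_eq * mem_Times_iff atMost_iff conj_assoc)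
  qed
  then show ?thesis
    by (simp add: count_shifts card_cartesian_product n_subsets algebra_simps)
qed

lemma count_shifts_r: "count_list (G.shifts i) (int (i + r)) = d * ((d - 1) choose i)"
proof -
  let ?T = "{S. S \<subseteq> {1..d} \<and> card S = i + 1}"
  have "{\<tau> \<in> G.faces (Suc i). G.shift \<tau> = int (i + r)} = (insert 0 ` ?T) \<times> {..i}"
  proof -
    have 1: "\<tau> \<in> G.faces (Suc i) \<and> G.shift \<tau> = int (i + r) \<longleftrightarrow> \<tau> \<in> G.faces (Suc i) \<and> 0 \<in> fst \<tau>" for \<tau>
      using shift_face[of \<tau> i] r3 by (cases "0 \<in> fst \<tau>") auto
    have 2: "S \<subseteq> {..d} \<and> card S = i + 2 \<and> 0 \<in> S \<longleftrightarrow> S \<in> insert 0 ` ?T" for S :: "nat set"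
    proof
      assume S: "S \<subseteq> {..d} \<and> card S = i + 2 \<and> 0 \<in> S"
      then have "finite S" by (metis finite_subset finite_atMost)
      then have "S - {0} \<in> ?T" "S = insert 0 (S - {0})" using S by (auto simp: subset_eq Suc_le_eq)
      then show "S \<in> insert 0 ` ?T" by blast
    next
      assume "S \<in> insert 0 ` ?T"
      then obtain T where T: "T \<subseteq> {1..d}" "card T = i + 1" "S = insert 0 T" by blast
      then have "finite T" "0 \<notin> T" by (auto intro: finite_subset)
      then show "S \<subseteq> {..d} \<and> card S = i + 2 \<and> 0 \<in> S" using T by auto
    qed
    have "\<tau> \<in> G.faces (Suc i) \<and> 0 \<in> fst \<tau> \<longleftrightarrow> \<tau> \<in> (insert 0 ` ?T) \<times> {..i}" for \<tau>
      using 2[of "fst \<tau>"] by (cases \<tau>) (auto simp: G.faces_def)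
    then show ?thesis using 1 by blast
  qed
  moreover have "card (insert 0 ` ?T) = card ?T"
  proof (rule card_image)
    show "inj_on (insert 0) ?T"
      by (rule inj_onI) (metis (mono_tags, lifting) Diff_insert_absorb atLeastAtMost_iff mem_Collect_eq not_one_le_zero subsetD)
  qed
  ultimately have "count_list (G.shifts i) (int (i + r)) = (i + 1) * (d choose (i + 1))"
    by (simp add: count_shifts card_cartesian_product n_subsets algebra_simps)
  also have "\<dots> = d * ((d - 1) choose i)"
    using binomial_absorption[of i d] by simp
  finally show ?thesis .
qed

lemma count_shifts_other:
  assumes "j \<noteq> int (i + 2)" "j \<noteq> int (i + r)"
  shows "count_list (G.shifts i) j = 0"
proof -
  have "G.shift \<tau> \<noteq> j" if "\<tau> \<in> G.faces (Suc i)" for \<tau>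
    using shift_face[OF that] assms by (cases "0 \<in> fst \<tau>") simp_all
  then have "{\<tau> \<in> G.faces (Suc i). G.shift \<tau> = j} = {}" by blast
  then show ?thesis unfolding count_shifts by (simp only: card.empty)
qed

lemma betti_values:
  assumes "J = (toric :: ('k::field) edge_poly set) \<or> J = initial_ideal edges (grevlex_less (edge_list r d)) toric"
  shows "betti edges J i j = (if j = int (i + 2) then (i + 1) * (d choose (i + 2))
    else if j = int (i + r) then d * ((d - 1) choose i) else 0)"
proof -
  have "\<exists>f A. minimal_graded_free_resolution edges J G.shifts f A"
    using assms toric_ideal_resolution initial_ideal_resolution by blast
  then have "betti edges J i j = count_list (G.shifts i) j"
    using betti_eq_count by blast
  then show ?thesis
    using count_shifts_linear count_shifts_r count_shifts_other by auto
qed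

end

theorem theorem3p9:
  fixes r d :: nat
    and E :: "vertex set set"
    and I inI :: "(vertex set, 'k::field) mpoly set"
  assumes "r \<ge> 3" and "d \<ge> 2"
    and "E = snd (graph_G r d)"
    and "I = toric_ideal (graph_G r d)"
    and "inI = initial_ideal E (grevlex_less (edge_list r d)) I"
  shows "(\<forall>i j :: nat. betti E I i (int (i + j)) = betti E inI i (int (i + j))) \<and>
    (\<forall>i \<le> d - 2. betti E I i (int (i + 2)) = (i + 1) * (d choose (i + 2))) \<and>
    (\<forall>i \<le> d - 1. betti E I i (int (i + r)) = d * ((d - 1) choose i)) \<and>
    (\<forall>(i :: nat) (j :: int).
       \<not> (j = 2 \<and> i \<le> d - 2) \<and> \<not> (j = int r \<and> i \<le> d - 1) \<longrightarrow>
       betti E I i (int i + j) = 0)"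
proof -
  have b: "betti E I i j = (if j = int (i + 2) then (i + 1) * (d choose (i + 2))
      else if j = int (i + r) then d * ((d - 1) choose i) else 0)"
    and b': "betti E inI i j = (if j = int (i + 2) then (i + 1) * (d choose (i + 2))
      else if j = int (i + r) then d * ((d - 1) choose i) else 0)" for i j
    using betti_values[OF assms(1), of I d i j] betti_values[OF assms(1), of inI d i j] assms(3-5) by auto
  have "betti E I i (int i + j) = 0"
    if "\<not> (j = 2 \<and> i \<le> d - 2)" "\<not> (j = int r \<and> i \<le> d - 1)" for i :: nat and j :: int
    using that assms(1,2) by (auto simp: b)
  then show ?thesis
    using assms(1) by (auto simp: b b')
qed

end
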